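(* Let $T>0$, $n\in\mathbb{N}=\{1,2,\dots\}$, and let $\tilde\Lambda_n$, $\tilde\gamma_{1,n}$, $\tilde\lambda_j$, $\tilde\lambda_j(a)$ be as defined in the context. Let $a\in\tilde\Lambda_n$ and let $u$ be any nontrivial solution of $$u''(t)+a(t)u(t)=0,\ t\in(0,T),\qquad u(0)+u(T)=u'(0)+u'(T)=0,$$ such that $u(0)=u(T)=0$. Denote the zeros of $u$ in $[0,T]$ by $0=t_0<t_2<\dots<t_{2m}=T$ and the zeros of $u'$ in $(0,T)$ by $t_1<t_3<\dots<t_{2m-1}$ (the zeros of $u$ and of $u'$ interlace, so $t_i<t_{i+1}$). Then: 1. $t_{i+1}-t_i\le \frac{T}{2(2n-1)}$ for all $0\le i\le 2m-1$, and at least one of these inequalities is strict. 2. $m$ is an odd number and $m\ge 2n+1$. Any odd value $m\ge 2n+1$ is possible (that is, it occurs for some $a\in\tilde\Lambda_n$ and some such $u$). 3. The infimum $\tilde\gamma_{1,n}$ is not attained, and $$\tilde\gamma_{1,n}=T\tilde\lambda_{2n-1}+\frac{2\pi(2n-1)(2n+1)}{T}\cot\frac{(2n-1)\pi}{2(2n+1)}.$$ 4. If $a\in L_T(\mathbb{R},\mathbb{R})$ satisfies $\tilde\lambda_{2n-1}\prec a$ and $\|a\|_{L^1(0,T)}\le\tilde\gamma_{1,n}$, then $\tilde\lambda_{2n}(a)<0<\tilde\lambda_{2n+1}(a)$.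
   Context: $L_T(\mathbb{R},\mathbb{R})$ is the set of $T$-periodic functions $a:\mathbb{R}\to\mathbb{R}$ with $a|_{[0,T]}\in L^1(0,T)$. For $c,d\in L^1(0,T)$, $c\prec d$ means $c(t)\le d(t)$ for a.e. $t\in[0,T]$ and $c(t)<d(t)$ on a set of positive measure. For $a\in L_T(\mathbb{R},\mathbb{R})$, $\tilde\lambda_1(a)\le\tilde\lambda_2(a)<\dots<\tilde\lambda_{2n-1}(a)\le\tilde\lambda_{2n}(a)<\dots$ denote the eigenvalues (counted with multiplicity) $\tilde\lambda$ of the antiperiodic problem $u''(t)+(\tilde\lambda+a(t))u(t)=0$ on $(0,T)$, $u(0)+u(T)=u'(0)+u'(T)=0$. Write $\tilde\lambda_j=\tilde\lambda_j(0)$; thus $\tilde\lambda_{2n-1}=\tilde\lambda_{2n}=(2n-1)^2\pi^2/T^2$ for $n\in\mathbb{N}$. $\tilde\Lambda_n$ is the set of all $a\in L_T(\mathbb{R},\mathbb{R})$ such that $\tilde\lambda_{2n-1}\prec a$ and the problem $u''+a(t)u=0$ on $(0,T)$, $u(0)+u(T)=u'(0)+u'(T)=0$, has nontrivial solutions. Finally $\tilde\gamma_{1,n}=\inf_{a\in\tilde\Lambda_n}\|a\|_{L^1(0,T)}$. *)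

theory Defs
  imports "HOL-Analysis.Analysis"
begin

definition L_per :: "real \<Rightarrow> (real \<Rightarrow> real) set" where
  "L_per T = {a. (\<forall>t. a (t + T) = a t) \<and> a absolutely_integrable_on {0..T}}"

definition L1_norm :: "real \<Rightarrow> (real \<Rightarrow> real) \<Rightarrow> real" where
  "L1_norm T a = integral {0..T} (\<lambda>t. \<bar>a t\<bar>)"

definition prec_ae :: "real \<Rightarrow> (real \<Rightarrow> real) \<Rightarrow> (real \<Rightarrow> real) \<Rightarrow> bool" where
  "prec_ae T c d \<longleftrightarrow>
     (AE t in lebesgue. t \<in> {0..T} \<longrightarrow> c t \<le> d t) \<and>
     emeasure lebesgue {t \<in> {0..T}. c t < d t} > 0"

(* Solutions are meant in the W^{2,1}(0,T) (Caratheodory) sense, as the potential q is only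
   integrable: u is differentiable on [0,T] (one-sidedly at the endpoints), u' is absolutely
   continuous, i.e. the indefinite integral of an L^1 function u'', and u'' + q u = 0 a.e. *)
definition antiper_sol ::
  "real \<Rightarrow> (real \<Rightarrow> real) \<Rightarrow> (real \<Rightarrow> real) \<Rightarrow> (real \<Rightarrow> real) \<Rightarrow> bool" where
  "antiper_sol T q u u' \<longleftrightarrow>
     (\<forall>t\<in>{0..T}. (u has_real_derivative u' t) (at t within {0..T})) \<and>
     (\<exists>u''. u'' absolutely_integrable_on {0..T} \<and>
        (\<forall>t\<in>{0..T}. u' t = u' 0 + integral {0..t} u'') \<and>
        (AE t in lebesgue. t \<in> {0<..<T} \<longrightarrow> u'' t + q t * u t = 0)) \<and>
     u 0 + u T = 0 \<and> u' 0 + u' T = 0"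

definition nontriv_antiper_sol ::
  "real \<Rightarrow> (real \<Rightarrow> real) \<Rightarrow> (real \<Rightarrow> real) \<Rightarrow> (real \<Rightarrow> real) \<Rightarrow> bool" where
  "nontriv_antiper_sol T q u u' \<longleftrightarrow> antiper_sol T q u u' \<and> (\<exists>t\<in>{0..T}. u t \<noteq> 0)"

definition antiper_eigenvalue :: "real \<Rightarrow> (real \<Rightarrow> real) \<Rightarrow> real \<Rightarrow> bool" where
  "antiper_eigenvalue T a \<mu> \<longleftrightarrow> (\<exists>u u'. nontriv_antiper_sol T (\<lambda>t. \<mu> + a t) u u')"

(* Dimension of the eigenspace: the largest number of eigenfunctions that are linearly
   independent as functions on [0,T]. It never exceeds 2. *)
definition antiper_mult :: "real \<Rightarrow> (real \<Rightarrow> real) \<Rightarrow> real \<Rightarrow> nat" where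
  "antiper_mult T a \<mu> = (GREATEST k. \<exists>u u'.
     (\<forall>i<k. antiper_sol T (\<lambda>t. \<mu> + a t) (u i) (u' i)) \<and>
     (\<forall>c :: nat \<Rightarrow> real. (\<forall>t\<in>{0..T}. (\<Sum>i<k. c i * u i t) = 0) \<longrightarrow> (\<forall>i<k. c i = 0)))"

(* The j-th eigenvalue (j = 1, 2, ...) in nondecreasing order, counted with multiplicity.
   For integrable a only finitely many eigenvalues lie below any given bound, so the sum
   ranges over a finite set, and the minimum is attained. *)
definition antiper_eig :: "real \<Rightarrow> (real \<Rightarrow> real) \<Rightarrow> nat \<Rightarrow> real" where
  "antiper_eig T a j =
     (LEAST \<mu>. j \<le> (\<Sum>\<nu> | antiper_eigenvalue T a \<nu> \<and> \<nu> \<le> \<mu>. antiper_mult T a \<nu>))"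

abbreviation antiper_eig0 :: "real \<Rightarrow> nat \<Rightarrow> real" where
  "antiper_eig0 T \<equiv> antiper_eig T (\<lambda>_. 0)"

definition Lambda_antiper :: "real \<Rightarrow> nat \<Rightarrow> (real \<Rightarrow> real) set" where
  "Lambda_antiper T n = {a \<in> L_per T.
     prec_ae T (\<lambda>_. antiper_eig0 T (2 * n - 1)) a \<and> (\<exists>u u'. nontriv_antiper_sol T a u u')}"

definition gamma_antiper :: "real \<Rightarrow> nat \<Rightarrow> real" where
  "gamma_antiper T n = (INF a\<in>Lambda_antiper T n. L1_norm T a)"

(* 0 = t 0 < t 1 < ... < t (2m) = T, where the even-indexed points are exactly the zeros of u
   in [0,T] and the odd-indexed ones exactly the zeros of u' in (0,T). These conditions
   determine m and t on {0..2m}. *)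
definition interlaced_zeros ::
  "real \<Rightarrow> (real \<Rightarrow> real) \<Rightarrow> (real \<Rightarrow> real) \<Rightarrow> nat \<Rightarrow> (nat \<Rightarrow> real) \<Rightarrow> bool" where
  "interlaced_zeros T u u' m t \<longleftrightarrow>
     t 0 = 0 \<and> t (2 * m) = T \<and> (\<forall>i<2 * m. t i < t (i + 1)) \<and>
     t ` {i. i \<le> 2 * m \<and> even i} = {s \<in> {0..T}. u s = 0} \<and>
     t ` {i. i \<le> 2 * m \<and> odd i} = {s \<in> {0<..<T}. u' s = 0}"

end

theory Submission
  imports Defs
begin

text \<open>
  Write \<open>k = 2n - 1\<close> and \<open>\<omega> = k \<pi> / T\<close>, so that \<open>\<lambda>_(2n-1) = \<omega>\<^sup>2\<close>. In polar coordinates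
  \<open>u = r sin \<theta>\<close>, \<open>u' = r cos \<theta>\<close> the equation \<open>u'' + q u = 0\<close> becomes the scalar Lipschitz equation
  \<open>\<theta>' = cos\<^sup>2 \<theta> + q sin\<^sup>2 \<theta>\<close>, whose solutions are monotone in \<open>q\<close>. The rotation \<open>\<theta>(T) - \<theta>(0)\<close>, as a function of
  \<open>\<theta>(0)\<close>, is extremal exactly where \<open>r(T) = r(0)\<close>; hence the antiperiodic eigenvalues are the values of
  the spectral parameter at which the maximal or the minimal rotation is an odd multiple of \<open>\<pi>\<close>, and they
  are counted by these two functions.

  For \<open>q \<succ> \<omega>\<^sup>2\<close> an antiperiodic solution rotates by an odd multiple \<open>m \<pi> > k \<pi>\<close>, so a period consists of \<open>2m\<close>
  quarter waves with \<open>m \<ge> k + 2\<close>. The Wronskian of \<open>u\<close> with \<open>sin (\<omega> t)\<close> shows that a quarter wave of length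
  \<open>l\<close> has \<open>\<omega> l \<le> \<pi>/2\<close> and contributes at least \<open>\<omega> cot (\<omega> l)\<close> to \<open>\<integral> (q - \<omega>\<^sup>2)\<close>, strictly more where \<open>q\<close> is not
  \<open>\<omega>\<^sup>2\<close>; convexity of \<open>cot\<close> gives the bound, which smoothed point masses in the middle of the half waves
  approach. The last claim follows by moving along the segment from \<open>\<omega>\<^sup>2\<close> to \<open>a\<close>.
\<close>

subsection \<open>Indefinite Lebesgue integrals\<close>

text \<open>Potentials are merely integrable, so angles and solutions are only absolutely
  continuous. \<open>indef_int\<close> encodes \<open>F' = f\<close> almost everywhere through the
  integral formula, and chain rule, product rule and integrating factors are derived for it.
  Eigenvalues are defined by counting, and no spectral theory is invoked: for the potential
  \<open>\<mu> + a\<close> the maximal and the minimal rotation are continuous and strictly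
  increasing in \<mu> and less than \<pi> apart. Hence their counts of odd multiples of \<pi> differ
  by at most one, odd-numbered eigenvalues belong to the maximal rotation and even-numbered ones to
  the minimal. The cotangent in the infimum comes from equal quarter waves: 2 (k + 2) of them share
  the period, each with phase \<omega> l = k \<pi> / (2 (k + 2)), and their contributions add up to
  2 (k + 2) \<omega> cot (\<omega> l). The value is not attained, because equality in a single
  quarter wave forces q = \<omega>^2 there, and this cannot happen in all of them at once.\<close>

definition indef_int :: "real \<Rightarrow> real \<Rightarrow> (real \<Rightarrow> real) \<Rightarrow> (real \<Rightarrow> real) \<Rightarrow> bool" where
  "indef_int a b F f \<longleftrightarrow> f absolutely_integrable_on {a..b} \<and>
     (\<forall>t\<in>{a..b}. integral {a..t} f = F t - F a)"

lemma indef_intI: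
  assumes "f absolutely_integrable_on {a..b}"
    and "\<And>t. t \<in> {a..b} \<Longrightarrow> F t = F a + integral {a..t} f"
  shows "indef_int a b F f"
  unfolding indef_int_def
proof (intro conjI ballI)
  fix t assume "t \<in> {a..b}"
  from assms(2)[OF this] show "integral {a..t} f = F t - F a" by linarith
qed (rule assms)

lemma indef_int_abs_int: "indef_int a b F f \<Longrightarrow> f absolutely_integrable_on {a..b}"
  by (simp add: indef_int_def)

lemma indef_intD: "indef_int a b F f \<Longrightarrow> t \<in> {a..b} \<Longrightarrow> F t = F a + integral {a..t} f"
  by (simp add: indef_int_def)

lemma abs_int_subinterval:
  fixes f :: "real \<Rightarrow> real"
  assumes "f absolutely_integrable_on {a..b}" "a \<le> c" "d \<le> b"
  shows "f absolutely_integrable_on {c..d}"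
  by (rule absolutely_integrable_on_subinterval[OF assms(1)]) (use assms in auto)

lemma abs_int_imp_int:
  fixes f :: "real \<Rightarrow> real"
  assumes "f absolutely_integrable_on S"
  shows "f integrable_on S"
  using assms set_lebesgue_integral_eq_integral(1) by blast

lemma abs_int_imp_abs:
  fixes f :: "real \<Rightarrow> real"
  assumes "f absolutely_integrable_on S"
  shows "(\<lambda>t. \<bar>f t\<bar>) absolutely_integrable_on S"
  using absolutely_integrable_norm[OF assms] by (simp add: comp_def)

lemma abs_int_mult_bounded:
  fixes f g :: "real \<Rightarrow> real"
  assumes "f absolutely_integrable_on {a..b}" "g \<in> borel_measurable (lebesgue_on {a..b})"
    and "\<And>t. t \<in> {a..b} \<Longrightarrow> \<bar>g t\<bar> \<le> B"
  shows "(\<lambda>t. f t * g t) absolutely_integrable_on {a..b}" "(\<lambda>t. g t * f t) absolutely_integrable_on {a..b}"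
proof -
  have "bounded (g ` {a..b})"
    unfolding bounded_iff using assms(3) by (intro exI[of _ B]) auto
  then show "(\<lambda>t. g t * f t) absolutely_integrable_on {a..b}"
    by (intro absolutely_integrable_bounded_measurable_product_real assms) auto
  then show "(\<lambda>t. f t * g t) absolutely_integrable_on {a..b}" by (simp add: mult.commute)
qed

lemma abs_int_mult_cont:
  fixes f g :: "real \<Rightarrow> real"
  assumes "f absolutely_integrable_on {a..b}" "continuous_on {a..b} g"
  shows "(\<lambda>t. f t * g t) absolutely_integrable_on {a..b}" "(\<lambda>t. g t * f t) absolutely_integrable_on {a..b}"
proof -
  have "bounded (g ` {a..b})"
    by (rule compact_imp_bounded[OF compact_continuous_image[OF assms(2) compact_Icc]])
  then obtain B where "\<forall>x\<in>g ` {a..b}. norm x \<le> B"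
    unfolding bounded_iff by blast
  then have B: "\<And>t. t \<in> {a..b} \<Longrightarrow> \<bar>g t\<bar> \<le> B" by simp
  have m: "g \<in> borel_measurable (lebesgue_on {a..b})"
    by (rule continuous_imp_measurable_on_sets_lebesgue[OF assms(2)]) simp
  show "(\<lambda>t. f t * g t) absolutely_integrable_on {a..b}" "(\<lambda>t. g t * f t) absolutely_integrable_on {a..b}"
    by (rule abs_int_mult_bounded[OF assms(1) m B]; assumption)+
qed

lemma abs_int_const: "(\<lambda>t. c::real) absolutely_integrable_on {a..b::real}"
  by (rule absolutely_integrable_continuous_real) auto

lemma abs_integral_le:
  fixes f g :: "real \<Rightarrow> real"
  assumes "f absolutely_integrable_on {a..b}" "g absolutely_integrable_on {a..b}"
    and "\<And>t. t \<in> {a..b} \<Longrightarrow> \<bar>f t\<bar> \<le> g t"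
  shows "\<bar>integral {a..b} f\<bar> \<le> integral {a..b} g"
proof -
  have "norm (integral {a..b} f) \<le> integral {a..b} g"
    by (rule integral_norm_bound_integral[OF abs_int_imp_int[OF assms(1)] abs_int_imp_int[OF assms(2)]])
      (simp add: assms(3))
  then show ?thesis by simp
qed

lemma integral_mono_abs:
  fixes f g :: "real \<Rightarrow> real"
  assumes "f absolutely_integrable_on {a..b}" "g absolutely_integrable_on {a..b}"
    and "\<And>t. t \<in> {a..b} \<Longrightarrow> f t \<le> g t"
  shows "integral {a..b} f \<le> integral {a..b} g"
  by (rule integral_le[OF abs_int_imp_int[OF assms(1)] abs_int_imp_int[OF assms(2)] assms(3)])

lemma integral_add_abs:
  fixes f g :: "real \<Rightarrow> real"
  assumes "f absolutely_integrable_on S" "g absolutely_integrable_on S"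
  shows "integral S (\<lambda>t. f t + g t) = integral S f + integral S g"
  by (rule integral_add[OF abs_int_imp_int[OF assms(1)] abs_int_imp_int[OF assms(2)]])

lemma integral_diff_abs:
  fixes f g :: "real \<Rightarrow> real"
  assumes "f absolutely_integrable_on S" "g absolutely_integrable_on S"
  shows "integral S (\<lambda>t. f t - g t) = integral S f - integral S g"
  by (rule integral_diff[OF abs_int_imp_int[OF assms(1)] abs_int_imp_int[OF assms(2)]])

lemma integral_split:
  fixes f :: "real \<Rightarrow> real"
  assumes "f absolutely_integrable_on {a..b}" "a \<le> c" "c \<le> b"
  shows "integral {a..b} f = integral {a..c} f + integral {c..b} f"
  by (rule Henstock_Kurzweil_Integration.integral_combine[OF assms(2,3) abs_int_imp_int[OF assms(1)], symmetric])

lemma indef_int_diff_eq: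
  assumes "indef_int a b F f" "a \<le> c" "c \<le> d" "d \<le> b"
  shows "F d = F c + integral {c..d} f"
proof -
  have "f absolutely_integrable_on {a..d}"
    by (rule abs_int_subinterval[OF indef_int_abs_int[OF assms(1)]]) (use assms(2-) in auto)
  then have "integral {a..d} f = integral {a..c} f + integral {c..d} f"
    by (rule integral_split) (use assms(2-) in auto)
  then show ?thesis
    using indef_intD[OF assms(1), of c] indef_intD[OF assms(1), of d] assms(2-4) by simp
qed

lemma indef_int_sub:
  assumes "indef_int a b F f" "a \<le> c" "d \<le> b"
  shows "indef_int c d F f"
proof (rule indef_intI)
  show "f absolutely_integrable_on {c..d}"
    by (rule abs_int_subinterval[OF indef_int_abs_int[OF assms(1)]]) (use assms(2-) in auto)
  fix t assume "t \<in> {c..d}"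
  then show "F t = F c + integral {c..t} f"
    by (intro indef_int_diff_eq[OF assms(1)]) (use assms in auto)
qed

lemma indef_int_cont:
  assumes "indef_int a b F f"
  shows "continuous_on {a..b} F"
proof -
  have "continuous_on {a..b} (\<lambda>t. F a + integral {a..t} f)"
    by (intro continuous_intros indefinite_integral_continuous_1 abs_int_imp_int)
      (use assms in \<open>auto simp: indef_int_def\<close>)
  then show ?thesis
    by (rule continuous_on_eq) (rule indef_intD[OF assms, symmetric])
qed

lemma indef_int_cong:
  assumes "indef_int a b F f" "\<And>t. t \<in> {a..b} \<Longrightarrow> F t = G t" "\<And>t. t \<in> {a..b} \<Longrightarrow> f t = g t"
  shows "indef_int a b G g"
proof -
  have 1: "g absolutely_integrable_on {a..b}"
    using absolutely_integrable_spike[OF indef_int_abs_int[OF assms(1)], of "{}" g] assms(3) by auto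
  have "G t = G a + integral {a..t} g" if "t \<in> {a..b}" for t
  proof -
    have "integral {a..t} f = integral {a..t} g"
      by (rule integral_cong) (use assms that in auto)
    moreover have "a \<in> {a..b}" using that by auto
    ultimately show ?thesis using indef_intD[OF assms(1) that] assms(2) that by metis
  qed
  then show ?thesis using 1 by (intro indef_intI)
qed

lemma indef_int_add:
  assumes "indef_int a b F f" "indef_int a b G g"
  shows "indef_int a b (\<lambda>t. F t + G t) (\<lambda>t. f t + g t)"
proof (rule indef_intI)
  show "(\<lambda>t. f t + g t) absolutely_integrable_on {a..b}"
    by (rule set_integral_add[OF indef_int_abs_int[OF assms(1)] indef_int_abs_int[OF assms(2)]])
  fix t assume t: "t \<in> {a..b}"
  have "f absolutely_integrable_on {a..t}"
    by (rule abs_int_subinterval[OF indef_int_abs_int[OF assms(1)]]) (use t in auto)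
  moreover have "g absolutely_integrable_on {a..t}"
    by (rule abs_int_subinterval[OF indef_int_abs_int[OF assms(2)]]) (use t in auto)
  ultimately have "integral {a..t} (\<lambda>t. f t + g t) = integral {a..t} f + integral {a..t} g"
    by (rule integral_add_abs)
  then show "F t + G t = F a + G a + integral {a..t} (\<lambda>t. f t + g t)"
    using indef_intD[OF assms(1) t] indef_intD[OF assms(2) t] by simp
qed

lemma indef_int_cmult:
  assumes "indef_int a b F f"
  shows "indef_int a b (\<lambda>t. c * F t) (\<lambda>t. c * f t)"
  using assms by (auto simp: indef_int_def right_diff_distrib)

lemma indef_int_const: "indef_int a b (\<lambda>t. c) (\<lambda>t. 0)"
  using abs_int_const[of 0] by (auto simp: indef_int_def)

lemma indef_int_diff:
  assumes "indef_int a b F f" "indef_int a b G g"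
  shows "indef_int a b (\<lambda>t. F t - G t) (\<lambda>t. f t - g t)"
  using indef_int_add[OF assms(1) indef_int_cmult[OF assms(2), of "-1"]] by simp

lemma indef_int_integral:
  assumes "f absolutely_integrable_on {a..b}"
  shows "indef_int a b (\<lambda>t. integral {a..t} f) f"
  using assms by (auto simp: indef_int_def)

lemma indef_int_C1:
  assumes "\<And>t. t \<in> {a..b} \<Longrightarrow> (F has_real_derivative f t) (at t within {a..b})" "continuous_on {a..b} f"
  shows "indef_int a b F f"
proof (rule indef_intI)
  show "f absolutely_integrable_on {a..b}" using assms absolutely_integrable_continuous_real by blast
  fix t assume t: "t \<in> {a..b}"
  have "(f has_integral F t - F a) {a..t}"
  proof (rule fundamental_theorem_of_calculus)
    show "a \<le> t" using t by auto
    fix x assume "x \<in> {a..t}"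
    then show "(F has_vector_derivative f x) (at x within {a..t})"
      using assms(1)[of x] t has_field_derivative_subset[of F "f x" x "{a..b}" "{a..t}"]
      by (auto simp: has_real_derivative_iff_has_vector_derivative[symmetric])
  qed
  then show "F t = F a + integral {a..t} f" by (simp add: integral_unique)
qed

text \<open>Substitute for "zero derivative implies constant" among absolutely continuous functions:
  on a subdivision finer than \<delta> the increments of \<open>K\<close> telescope, so the total
  change of \<open>\<Phi>\<close> is at most \<epsilon> (K b - K a) for every \<epsilon>.\<close>

lemma const_if_increments_small:
  fixes \<Phi> K :: "real \<Rightarrow> real"
  assumes "a \<le> b"
    and "\<And>\<epsilon>. \<epsilon> > 0 \<Longrightarrow> \<exists>\<delta>>0. \<forall>x y. a \<le> x \<and> x \<le> y \<and> y \<le> b \<and> y - x < \<delta> \<longrightarrow> \<bar>\<Phi> y - \<Phi> x\<bar> \<le> \<epsilon> * (K y - K x)"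
  shows "\<Phi> b = \<Phi> a"
proof (rule ccontr)
  assume ne: "\<Phi> b \<noteq> \<Phi> a"
  define L where "L = \<bar>\<Phi> b - \<Phi> a\<bar>"
  have L: "L > 0" using ne by (simp add: L_def)
  \<comment> \<open>Chosen so that the telescoped bound is at most L / 2; the added 1 keeps the
    denominator positive.\<close>
  define \<epsilon> where "\<epsilon> = L / (2 * (\<bar>K b - K a\<bar> + 1))"
  have "\<bar>K b - K a\<bar> + 1 > 0" by arith
  then have e: "\<epsilon> > 0" unfolding \<epsilon>_def using L by simp
  obtain \<delta> where d: "\<delta> > 0" and D: "\<And>x y. a \<le> x \<Longrightarrow> x \<le> y \<Longrightarrow> y \<le> b \<Longrightarrow> y - x < \<delta> \<Longrightarrow> \<bar>\<Phi> y - \<Phi> x\<bar> \<le> \<epsilon> * (K y - K x)"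
    using assms(2)[OF e] by metis
  obtain N :: nat where N: "(b - a) / \<delta> < N" using reals_Archimedean2 by blast
  have N0: "N > 0"
  proof (rule ccontr)
    assume "\<not> N > 0"
    then have "(b - a) / \<delta> < 0" using N by simp
    then show False using assms(1) d by (simp add: divide_less_0_iff)
  qed
  define p where "p i = a + (b - a) * real i / real N" for i
  have p0: "p 0 = a" "p N = b" using N0 by (auto simp: p_def)
  have step: "p (Suc i) - p i = (b - a) / N" for i
    using N0 by (simp add: p_def field_simps)
  have pm: "p i \<le> p (Suc i)" for i using step[of i] assms(1) N0 by (smt (verit) divide_nonneg_nonneg of_nat_0_le_iff)
  have stepd: "p (Suc i) - p i < \<delta>" for i
    using N N0 d by (simp add: step field_simps)
  have bnd: "a \<le> p i \<and> p i \<le> b" if "i \<le> N" for i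
  proof -
    have "(b - a) * real i \<le> (b - a) * real N" using that assms(1) by (intro mult_left_mono) auto
    then have "(b - a) * real i / real N \<le> b - a" using N0 by (simp add: pos_divide_le_eq)
    moreover have "(b - a) * real i / real N \<ge> 0" using assms(1) by simp
    ultimately show ?thesis by (simp add: p_def)
  qed
  have "\<bar>\<Phi> (p i) - \<Phi> a\<bar> \<le> \<epsilon> * (K (p i) - K a)" if "i \<le> N" for i
    using that
  proof (induction i)
    case 0 then show ?case by (simp add: p0)
  next
    case (Suc i)
    have "\<bar>\<Phi> (p (Suc i)) - \<Phi> (p i)\<bar> \<le> \<epsilon> * (K (p (Suc i)) - K (p i))"
      using D[of "p i" "p (Suc i)"] bnd[of i] bnd[of "Suc i"] pm[of i] stepd[of i] Suc by auto
    with Suc show ?case by (simp add: algebra_simps) 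
  qed
  from this[of N] have "L \<le> \<epsilon> * (K b - K a)" by (simp add: p0 L_def)
  also have "\<dots> \<le> \<epsilon> * (\<bar>K b - K a\<bar> + 1)" using e by (intro mult_left_mono) auto
  also have "\<dots> = L / 2" using \<open>\<bar>K b - K a\<bar> + 1 > 0\<close> unfolding \<epsilon>_def
    by (metis (no_types, lifting) divide_divide_eq_left less_irrefl nonzero_eq_divide_eq mult.commute)
  finally show False using L by simp
qed

text \<open>By the mean value theorem the increment of \<open>G \<circ> F\<close> over [x, y] is
  G'(F z) times the integral of f. Replacing the constant G'(F z) by G'(F t) costs at most the
  oscillation of \<open>G' \<circ> F\<close> times the integral of |f|; uniform continuity makes
  this small, with \<open>K\<close> the indefinite integral of |f|.\<close>

lemma indef_int_chain:
  fixes G G' :: "real \<Rightarrow> real"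
  assumes F: "indef_int a b F f"
    and G: "\<And>x. (G has_real_derivative G' x) (at x)" and G': "continuous_on UNIV G'"
  shows "indef_int a b (\<lambda>t. G (F t)) (\<lambda>t. G' (F t) * f t)"
proof (rule indef_intI)
  note Fc = indef_int_cont[OF F]
  have fa: "f absolutely_integrable_on {a..b}" using F by (simp add: indef_int_def)
  have GFc: "continuous_on {a..b} (\<lambda>t. G' (F t))"
    using continuous_on_compose2[OF G' Fc] by auto
  show ai: "(\<lambda>t. G' (F t) * f t) absolutely_integrable_on {a..b}"
    using abs_int_mult_cont[OF fa GFc] by simp
  fix t assume t: "t \<in> {a..b}"
  define \<Phi> where "\<Phi> s = G (F s) - integral {a..s} (\<lambda>t. G' (F t) * f t)" for s
  define K where "K s = integral {a..s} (\<lambda>t. \<bar>f t\<bar>)" for s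
  have "\<Phi> t = \<Phi> a"
  proof (rule const_if_increments_small[where \<Phi> = \<Phi> and K = K and a = a and b = t])
    show "a \<le> t" using t by auto
    fix \<epsilon> :: real assume e: "\<epsilon> > 0"
    have "uniformly_continuous_on {a..b} (\<lambda>t. G' (F t))"
      using GFc compact_uniformly_continuous by blast
    then obtain \<delta> where d: "\<delta> > 0" and
      D: "\<And>x y. x \<in> {a..b} \<Longrightarrow> y \<in> {a..b} \<Longrightarrow> \<bar>x - y\<bar> < \<delta> \<Longrightarrow> \<bar>G' (F x) - G' (F y)\<bar> < \<epsilon>"
      using e unfolding uniformly_continuous_on_def dist_real_def by metis
    have "\<bar>\<Phi> y - \<Phi> x\<bar> \<le> \<epsilon> * (K y - K x)" if xy: "a \<le> x" "x \<le> y" "y \<le> t" "y - x < \<delta>" for x y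
    proof -
      have fxy: "f absolutely_integrable_on {x..y}" by (rule abs_int_subinterval[OF fa]) (use xy t in auto)
      have gxy: "(\<lambda>t. G' (F t) * f t) absolutely_integrable_on {x..y}" by (rule abs_int_subinterval[OF ai]) (use xy t in auto)
      \<comment> \<open>The intermediate value between F x and F y is itself taken by F on [x, y],
        since a continuous function maps intervals to intervals.\<close>
      have "\<exists>z\<in>{x..y}. G (F y) - G (F x) = G' (F z) * (F y - F x)"
      proof -
        have cl: "\<exists>w. w \<in> closed_segment (F x) (F y) \<and> G (F y) - G (F x) = G' w * (F y - F x)"
        proof (cases "F x" "F y" rule: linorder_cases)
          case less
          obtain w where "F x < w" "w < F y" "G (F y) - G (F x) = (F y - F x) * G' w"
            using MVT2[of "F x" "F y" G G'] less G by auto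
          then show ?thesis by (intro exI[of _ w]) (auto simp: closed_segment_eq_real_ivl)
        next
          case equal then show ?thesis by (intro exI[of _ "F x"]) auto
        next
          case greater
          obtain w where "F y < w" "w < F x" "G (F x) - G (F y) = (F x - F y) * G' w"
            using MVT2[of "F y" "F x" G G'] greater G by auto
          then show ?thesis by (intro exI[of _ w]) (auto simp: closed_segment_eq_real_ivl algebra_simps)
        qed
        then obtain w where w: "w \<in> closed_segment (F x) (F y)" "G (F y) - G (F x) = G' w * (F y - F x)" by blast
        have "connected (F ` {x..y})"
          by (intro connected_continuous_image continuous_on_subset[OF Fc]) (use xy t in auto)
        then have "convex (F ` {x..y})" by (metis is_interval_connected_1 is_interval_convex)
        then have "closed_segment (F x) (F y) \<subseteq> F ` {x..y}"
          by (intro closed_segment_subset) (use xy in auto)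
        then show ?thesis using w by auto
      qed
      then obtain z where z: "z \<in> {x..y}" "G (F y) - G (F x) = G' (F z) * (F y - F x)" by blast
      have "\<Phi> y - \<Phi> x = G' (F z) * (F y - F x) - (integral {a..y} (\<lambda>t. G' (F t) * f t) - integral {a..x} (\<lambda>t. G' (F t) * f t))"
        using z by (simp add: \<Phi>_def)
      also have "F y - F x = integral {x..y} f"
        using indef_int_diff_eq[OF F, of x y] xy t by auto
      also have "integral {a..y} (\<lambda>t. G' (F t) * f t) - integral {a..x} (\<lambda>t. G' (F t) * f t) = integral {x..y} (\<lambda>t. G' (F t) * f t)"
        using integral_split[OF abs_int_subinterval[OF ai], of a y x] xy t by auto
      also have "G' (F z) * integral {x..y} f - integral {x..y} (\<lambda>t. G' (F t) * f t)
          = integral {x..y} (\<lambda>t. G' (F z) * f t - G' (F t) * f t)"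
        using gxy fxy by (subst integral_diff_abs) auto
      finally have eq: "\<Phi> y - \<Phi> x = integral {x..y} (\<lambda>t. G' (F z) * f t - G' (F t) * f t)" .
      have "\<bar>\<dots>\<bar> \<le> integral {x..y} (\<lambda>t. \<epsilon> * \<bar>f t\<bar>)"
      proof (rule abs_integral_le)
        show "(\<lambda>t. G' (F z) * f t - G' (F t) * f t) absolutely_integrable_on {x..y}"
          using gxy fxy by (intro set_integral_diff) auto
        show "(\<lambda>t. \<epsilon> * \<bar>f t\<bar>) absolutely_integrable_on {x..y}"
          using abs_int_imp_abs[OF fxy] by simp
        fix s assume s: "s \<in> {x..y}"
        have "\<bar>G' (F z) - G' (F s)\<bar> \<le> \<epsilon>"
        proof -
          have "\<bar>z - s\<bar> < \<delta>" using s z xy by (auto simp: abs_less_iff)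
          then show ?thesis using D[of z s] s z xy t by auto
        qed
        then show "\<bar>G' (F z) * f s - G' (F s) * f s\<bar> \<le> \<epsilon> * \<bar>f s\<bar>"
          by (simp add: left_diff_distrib[symmetric] abs_mult mult_right_mono)
      qed
      also have "\<dots> = \<epsilon> * (K y - K x)"
        using integral_split[OF abs_int_subinterval[OF abs_int_imp_abs[OF fa]], of a y x] xy t
        by (auto simp: K_def)
      finally show ?thesis by (simp add: eq)
    qed
    then show "\<exists>\<delta>>0. \<forall>x y. a \<le> x \<and> x \<le> y \<and> y \<le> t \<and> y - x < \<delta> \<longrightarrow> \<bar>\<Phi> y - \<Phi> x\<bar> \<le> \<epsilon> * (K y - K x)"
      using d by blast
  qed
  then show "G (F t) = G (F a) + integral {a..t} (\<lambda>t. G' (F t) * f t)"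
    by (simp add: \<Phi>_def)
qed

text \<open>Polarisation: a product is a quarter of a difference of two squares, and squares are
  covered by the chain rule.\<close>

lemma indef_int_mult:
  assumes "indef_int a b F f" "indef_int a b G g"
  shows "indef_int a b (\<lambda>t. F t * G t) (\<lambda>t. f t * G t + F t * g t)"
proof -
  have sq: "indef_int a b (\<lambda>t. (H t)\<^sup>2) (\<lambda>t. 2 * H t * h t)" if "indef_int a b H h" for H h
    by (rule indef_int_chain[OF that]) (auto intro!: derivative_eq_intros continuous_intros)
  have "indef_int a b (\<lambda>t. 1/4 * ((F t + G t)\<^sup>2 - (F t - G t)\<^sup>2))
     (\<lambda>t. 1/4 * (2 * (F t + G t) * (f t + g t) - 2 * (F t - G t) * (f t - g t)))"
    by (intro indef_int_cmult indef_int_diff sq indef_int_add assms)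
  then show ?thesis
    by (rule indef_int_cong) (auto simp: power2_eq_square algebra_simps)
qed

section \<open>Null sets and strict positivity of integrals\<close>

lemma nonneg_integral_zero_negligible:
  fixes f :: "real \<Rightarrow> real"
  assumes f: "f absolutely_integrable_on {a..b}" "\<And>t. t \<in> {a..b} \<Longrightarrow> f t \<ge> 0" and z: "integral {a..b} f = 0"
  shows "negligible {t \<in> {a..b}. f t \<noteq> 0}"
proof -
  have "integrable lebesgue (\<lambda>t. indicator {a..b} t *\<^sub>R f t)"
    using f(1) by (simp add: set_integrable_def)
  moreover have "integral\<^sup>L lebesgue (\<lambda>t. indicator {a..b} t *\<^sub>R f t) = 0"
    using z set_lebesgue_integral_eq_integral(2)[OF f(1)] by (simp add: set_lebesgue_integral_def)
  moreover have "AE t in lebesgue. 0 \<le> indicator {a..b} t *\<^sub>R f t"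
    using f(2) by (auto simp: indicator_def)
  ultimately have "AE t in lebesgue. indicator {a..b} t *\<^sub>R f t = 0"
    using integral_nonneg_eq_0_iff_AE by blast
  then have "negligible {t. indicator {a..b} t *\<^sub>R f t \<noteq> 0}"
    by (simp add: completion.AE_iff_null_sets negligible_iff_null_sets)
  moreover have "{t \<in> {a..b}. f t \<noteq> 0} \<subseteq> {t. indicator {a..b} t *\<^sub>R f t \<noteq> 0}"
    by auto
  ultimately show ?thesis using negligible_subset by blast
qed

lemma negligible_countable: "countable S \<Longrightarrow> negligible S" for S :: "real set"
  using countable_imp_null_set_lborel null_sets_completionI negligible_iff_null_sets by blast

text \<open>If the integral vanished, \<open>f * g\<close> would be zero almost everywhere; since
  \<open>g\<close> has only countably many zeros, so would \<open>f\<close>.\<close>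

lemma integral_pos_mult:
  fixes f g :: "real \<Rightarrow> real"
  assumes f: "f absolutely_integrable_on {a..b}" "\<And>t. t \<in> {a..b} \<Longrightarrow> f t \<ge> 0" "integral {a..b} f > 0"
    and g: "continuous_on {a..b} g" "\<And>t. t \<in> {a..b} \<Longrightarrow> g t \<ge> 0" "countable {t \<in> {a..b}. g t = 0}"
  shows "integral {a..b} (\<lambda>t. f t * g t) > 0"
proof (rule ccontr)
  assume "\<not> ?thesis"
  have fg: "(\<lambda>t. f t * g t) absolutely_integrable_on {a..b}" by (rule abs_int_mult_cont[OF f(1) g(1)])
  have "integral {a..b} (\<lambda>t. f t * g t) \<ge> 0"
    by (rule integral_nonneg) (use fg f g in \<open>auto intro: abs_int_imp_int\<close>)
  with \<open>\<not> ?thesis\<close> have z: "integral {a..b} (\<lambda>t. f t * g t) = 0" by simp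
  have "negligible {t \<in> {a..b}. f t * g t \<noteq> 0}"
    by (rule nonneg_integral_zero_negligible[OF fg _ z]) (use f g in auto)
  moreover have "negligible {t \<in> {a..b}. g t = 0}" using g(3) by (rule negligible_countable)
  ultimately have n: "negligible ({t \<in> {a..b}. f t * g t \<noteq> 0} \<union> {t \<in> {a..b}. g t = 0})" by (rule negligible_Un)
  have "integral {a..b} f = integral {a..b} (\<lambda>t. 0)"
    by (rule integral_spike[OF n]) auto
  then show False using f(3) by simp
qed

text \<open>Integrating factor for \<delta>' = c \<delta> + f. Comparisons of two angles go through
  it.\<close>

lemma linear_first_order:
  assumes d: "indef_int a b \<delta> (\<lambda>t. c t * \<delta> t + f t)" and c: "c absolutely_integrable_on {a..b}"
  shows "indef_int a b (\<lambda>t. exp (- integral {a..t} c) * \<delta> t) (\<lambda>t. exp (- integral {a..t} c) * f t)"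
proof -
  have "indef_int a b (\<lambda>t. exp (- integral {a..t} c)) (\<lambda>t. - exp (- integral {a..t} c) * c t)"
    by (rule indef_int_chain[OF indef_int_integral[OF c], where G = "\<lambda>x. exp (-x)" and G' = "\<lambda>x. - exp (-x)"])
      (auto intro!: derivative_eq_intros continuous_intros)
  from indef_int_mult[OF this d] show ?thesis
    by (rule indef_int_cong) (auto simp: algebra_simps)
qed

subsection \<open>The Pruefer angle\<close>

lemma sin_sq_diff: "(sin x)\<^sup>2 - (sin y)\<^sup>2 = sin (x - y) * sin (x + y)" for x y :: real
proof -
  have "sin (x - y) * sin (x + y) = (sin x)\<^sup>2 * (cos y)\<^sup>2 - (cos x)\<^sup>2 * (sin y)\<^sup>2"
    by (simp add: sin_diff sin_add power2_eq_square algebra_simps)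
  also have "\<dots> = (sin x)\<^sup>2 - (sin y)\<^sup>2" by (simp add: cos_squared_eq algebra_simps)
  finally show ?thesis by simp
qed

lemma sin_sq_lipschitz: "\<bar>(sin x)\<^sup>2 - (sin y)\<^sup>2\<bar> \<le> \<bar>x - y\<bar>" for x y :: real
proof -
  have "\<bar>sin (x - y) * sin (x + y)\<bar> \<le> \<bar>x - y\<bar> * 1"
    unfolding abs_mult by (intro mult_mono abs_sin_x_le_abs_x) auto
  then show ?thesis by (simp add: sin_sq_diff)
qed

text \<open>The angle \<open>\<theta>\<close> of the polar coordinates \<open>u = r sin \<theta>\<close>, \<open>u' = r cos \<theta>\<close> in the phase plane of
  \<open>u'' + q u = 0\<close> satisfies \<open>\<theta>' = cos\<^sup>2 \<theta> + q sin\<^sup>2 \<theta>\<close>.\<close>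

definition prufer :: "real \<Rightarrow> real \<Rightarrow> (real \<Rightarrow> real) \<Rightarrow> (real \<Rightarrow> real) \<Rightarrow> bool" where
  "prufer a b q \<theta> \<longleftrightarrow> indef_int a b \<theta> (\<lambda>t. 1 + (q t - 1) * (sin (\<theta> t))\<^sup>2)"

lemma prufer_sub: "prufer a b q \<theta> \<Longrightarrow> a \<le> c \<Longrightarrow> d \<le> b \<Longrightarrow> prufer c d q \<theta>"
  unfolding prufer_def by (rule indef_int_sub)

lemma prufer_cont: "prufer a b q \<theta> \<Longrightarrow> continuous_on {a..b} \<theta>"
  unfolding prufer_def by (rule indef_int_cont)

lemma abs_int_diff_const:
  fixes q :: "real \<Rightarrow> real"
  assumes "q absolutely_integrable_on {a..b}"
  shows "(\<lambda>t. q t - c) absolutely_integrable_on {a..b}"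
  by (rule set_integral_diff(1)[OF assms abs_int_const])

text \<open>The right-hand side is Lipschitz in \<theta> with constant |q - 1|, which is only
  integrable in t. In the unknown \<psi> = exp (-2 K) \<theta> with K' = |q - 1|, the integral
  operator contracts by 1/2 on the whole interval at once.\<close>

lemma prufer_exists:
  assumes q: "q absolutely_integrable_on {a..b}" and ab: "a \<le> b"
  shows "\<exists>\<theta>. prufer a b q \<theta> \<and> \<theta> a = \<alpha>"
proof -
  define k where "k t = \<bar>q t - 1\<bar>" for t
  define K where "K t = integral {a..t} k" for t
  \<comment> \<open>Clamping to [a, b] lets the fixed point theorem run in the complete space of
    bounded continuous functions on the whole line.\<close>
  define cl where "cl t = max a (min b t)" for t
  have q1: "(\<lambda>t. q t - 1) absolutely_integrable_on {a..b}" by (rule abs_int_diff_const[OF q])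
  have k: "k absolutely_integrable_on {a..b}" unfolding k_def by (rule abs_int_imp_abs[OF q1])
  have K: "indef_int a b K k" unfolding K_def by (rule indef_int_integral[OF k])
  note Kc = indef_int_cont[OF K]
  define F where "F \<psi> s = 1 + (q s - 1) * (sin (exp (2 * K s) * \<psi> s))\<^sup>2" for \<psi> :: "real \<Rightarrow> real" and s
  define g where "g \<psi> t = exp (- 2 * K t) * (\<alpha> + integral {a..t} (F \<psi>))" for \<psi> t
  have Fai: "F \<psi> absolutely_integrable_on {a..b}" if "continuous_on {a..b} \<psi>" for \<psi>
    unfolding F_def
    by (intro set_integral_add(1) abs_int_const abs_int_mult_cont(1)[OF q1] continuous_intros Kc that)
  have gc: "continuous_on {a..b} (g \<psi>)" if "continuous_on {a..b} \<psi>" for \<psi>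
    unfolding g_def by (intro continuous_intros Kc indef_int_cont[OF indef_int_integral[OF Fai[OF that]]])
  have clc: "continuous_on UNIV cl" unfolding cl_def by (intro continuous_intros)
  have cl_in: "cl t \<in> {a..b}" for t using ab by (auto simp: cl_def)
  have cl_id: "cl t = t" if "t \<in> {a..b}" for t using that by (auto simp: cl_def)
  have bc: "(\<lambda>t. g (apply_bcontfun \<psi>) (cl t)) \<in> bcontfun" for \<psi> :: "real \<Rightarrow>\<^sub>C real"
  proof -
    have c: "continuous_on {a..b} (g (apply_bcontfun \<psi>))" by (rule gc) simp
    have "bounded (g (apply_bcontfun \<psi>) ` {a..b})"
      by (rule compact_imp_bounded[OF compact_continuous_image[OF c compact_Icc]])
    then have "bounded (range (\<lambda>t. g (apply_bcontfun \<psi>) (cl t)))"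
      by (rule bounded_subset) (use cl_in in auto)
    moreover have "continuous_on UNIV (\<lambda>t. g (apply_bcontfun \<psi>) (cl t))"
      by (rule continuous_on_compose2[OF c clc]) (use cl_in in auto)
    ultimately show ?thesis by (simp add: bcontfun_def)
  qed
  define A where "A \<psi> = Bcontfun (\<lambda>t. g (apply_bcontfun \<psi>) (cl t))" for \<psi>
  have A: "apply_bcontfun (A \<psi>) t = g (apply_bcontfun \<psi>) (cl t)" for \<psi> t
    unfolding A_def using bc by (simp add: Bcontfun_inverse)
  \<comment> \<open>\<open>exp (2 * K s) * k s\<close> is the derivative of exp (2 K) / 2; this
    exact integral produces the contraction constant 1/2.\<close>
  have expK: "integral {a..t} (\<lambda>s. exp (2 * K s) * k s) = (exp (2 * K t) - 1) / 2" if "t \<in> {a..b}" for t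
  proof -
    have "indef_int a b (\<lambda>t. exp (2 * K t) / 2) (\<lambda>t. exp (2 * K t) * k t)"
      by (rule indef_int_chain[OF K, where G = "\<lambda>x. exp (2 * x) / 2" and G' = "\<lambda>x. exp (2 * x)"])
        (auto intro!: derivative_eq_intros continuous_intros)
    from indef_intD[OF this that] show ?thesis by (simp add: K_def field_simps)
  qed
  have contr: "dist (A \<psi>) (A \<phi>) \<le> 1/2 * dist \<psi> \<phi>" for \<psi> \<phi>
  proof (rule dist_bound)
    fix x
    define t where "t = cl x"
    have t: "t \<in> {a..b}" using cl_in by (simp add: t_def)
    let ?D = "dist \<psi> \<phi>"
    have ai: "F (apply_bcontfun \<xi>) absolutely_integrable_on {a..t}" for \<xi>
      by (rule abs_int_subinterval[OF Fai]) (use t in auto)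
    have kai: "(\<lambda>s. ?D * (exp (2 * K s) * k s)) absolutely_integrable_on {a..b}"
      by (intro set_integrable_mult_right abs_int_mult_cont(2)[OF k] continuous_intros Kc) 
    have "g (apply_bcontfun \<psi>) t - g (apply_bcontfun \<phi>) t
        = exp (- 2 * K t) * integral {a..t} (\<lambda>s. F (apply_bcontfun \<psi>) s - F (apply_bcontfun \<phi>) s)"
      unfolding integral_diff_abs[OF ai ai] g_def by (simp add: algebra_simps)
    moreover have "\<bar>integral {a..t} (\<lambda>s. F (apply_bcontfun \<psi>) s - F (apply_bcontfun \<phi>) s)\<bar>
        \<le> integral {a..t} (\<lambda>s. ?D * (exp (2 * K s) * k s))"
    proof (rule abs_integral_le)
      show "(\<lambda>s. F (apply_bcontfun \<psi>) s - F (apply_bcontfun \<phi>) s) absolutely_integrable_on {a..t}"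
        by (rule set_integral_diff(1)[OF ai ai])
      show "(\<lambda>s. ?D * (exp (2 * K s) * k s)) absolutely_integrable_on {a..t}"
        by (rule abs_int_subinterval[OF kai]) (use t in auto)
      fix s assume "s \<in> {a..t}"
      have "\<bar>F (apply_bcontfun \<psi>) s - F (apply_bcontfun \<phi>) s\<bar>
          = k s * \<bar>(sin (exp (2 * K s) * \<psi> s))\<^sup>2 - (sin (exp (2 * K s) * \<phi> s))\<^sup>2\<bar>"
        by (simp add: F_def k_def abs_mult[symmetric] algebra_simps)
      also have "\<dots> \<le> k s * \<bar>exp (2 * K s) * \<psi> s - exp (2 * K s) * \<phi> s\<bar>"
        by (intro mult_left_mono sin_sq_lipschitz) (simp add: k_def)
      also have "\<dots> = k s * (exp (2 * K s) * dist (\<psi> s) (\<phi> s))"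
        by (simp add: dist_real_def right_diff_distrib[symmetric] abs_mult)
      also have "\<dots> \<le> k s * (exp (2 * K s) * ?D)"
        by (intro mult_left_mono dist_bounded) (auto simp: k_def)
      finally show "\<bar>F (apply_bcontfun \<psi>) s - F (apply_bcontfun \<phi>) s\<bar> \<le> ?D * (exp (2 * K s) * k s)"
        by (simp add: algebra_simps)
    qed
    moreover have "integral {a..t} (\<lambda>s. ?D * (exp (2 * K s) * k s)) = ?D * ((exp (2 * K t) - 1) / 2)"
      using expK[OF t] by simp
    ultimately have "\<bar>g (apply_bcontfun \<psi>) t - g (apply_bcontfun \<phi>) t\<bar>
        \<le> exp (- 2 * K t) * (?D * ((exp (2 * K t) - 1) / 2))"
      unfolding abs_mult by (auto simp only: abs_mult abs_exp_cancel intro!: mult_left_mono exp_ge_zero)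
    also have "\<dots> = ?D * (1 - exp (- 2 * K t)) / 2"
      by (simp add: algebra_simps mult_exp_exp)
    also have "\<dots> \<le> ?D * 1 / 2" by (intro divide_right_mono mult_left_mono) auto
    finally show "dist (apply_bcontfun (A \<psi>) x) (apply_bcontfun (A \<phi>) x) \<le> 1/2 * ?D"
      by (simp add: A dist_real_def t_def)
  qed
  obtain \<psi> where fp: "A \<psi> = \<psi>"
    using banach_fix_type[of "1/2" A] contr by auto
  define \<theta> where "\<theta> t = exp (2 * K t) * \<psi> t" for t
  have \<theta>: "\<theta> t = \<alpha> + integral {a..t} (F (apply_bcontfun \<psi>))" if "t \<in> {a..b}" for t
  proof -
    have "\<psi> t = g (apply_bcontfun \<psi>) t" using A[of \<psi> t] fp cl_id[OF that] by simp
    then have "\<theta> t = exp (2 * K t) * exp (- 2 * K t) * (\<alpha> + integral {a..t} (F (apply_bcontfun \<psi>)))"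
      unfolding \<theta>_def g_def by simp
    then show ?thesis by (simp add: mult_exp_exp)
  qed
  have \<theta>a: "\<theta> a = \<alpha>" using \<theta>[of a] ab by simp
  have "prufer a b q \<theta>"
    unfolding prufer_def
  proof (rule indef_intI)
    have eq: "(\<lambda>t. 1 + (q t - 1) * (sin (\<theta> t))\<^sup>2) = F (apply_bcontfun \<psi>)"
      by (simp add: F_def \<theta>_def fun_eq_iff)
    show "(\<lambda>t. 1 + (q t - 1) * (sin (\<theta> t))\<^sup>2) absolutely_integrable_on {a..b}"
      unfolding eq by (rule Fai) simp
    show "\<theta> t = \<theta> a + integral {a..t} (\<lambda>t. 1 + (q t - 1) * (sin (\<theta> t))\<^sup>2)" if "t \<in> {a..b}" for t
      unfolding eq \<theta>a using \<theta>[OF that] .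
  qed
  with \<theta>a show ?thesis by blast
qed

text \<open>The difference of two Pruefer angles solves a linear equation, so it is controlled by
  an integrating factor.\<close>

lemma prufer_diff:
  assumes p1: "prufer a b q1 \<theta>1" and p2: "prufer a b q2 \<theta>2"
    and q1: "q1 absolutely_integrable_on {a..b}" and q2: "q2 absolutely_integrable_on {a..b}"
  obtains c where "c absolutely_integrable_on {a..b}" "\<forall>t. \<bar>c t\<bar> \<le> \<bar>q2 t - 1\<bar>"
    "indef_int a b (\<lambda>t. exp (- integral {a..t} c) * (\<theta>2 t - \<theta>1 t))
       (\<lambda>t. exp (- integral {a..t} c) * ((q2 t - q1 t) * (sin (\<theta>1 t))\<^sup>2))"
proof -
  \<comment> \<open>Difference quotient of sin^2, bounded by 1. Where both angles coincide, division
    by zero makes it 0, and its product with their difference is still correct.\<close>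
  define w where "w t = ((sin (\<theta>2 t))\<^sup>2 - (sin (\<theta>1 t))\<^sup>2) / (\<theta>2 t - \<theta>1 t)" for t
  define c where "c t = (q2 t - 1) * w t" for t
  have w1: "\<bar>w t\<bar> \<le> 1" for t
    using sin_sq_lipschitz[of "\<theta>2 t" "\<theta>1 t"] unfolding w_def abs_divide
    by (cases "\<theta>2 t = \<theta>1 t") (auto simp: divide_le_eq_1)
  have m: "f \<in> borel_measurable (lebesgue_on {a..b})" if "continuous_on {a..b} f" for f :: "real \<Rightarrow> real"
    by (rule continuous_imp_measurable_on_sets_lebesgue[OF that]) simp
  have wm: "w \<in> borel_measurable (lebesgue_on {a..b})"
    unfolding w_def
    by (intro borel_measurable_divide m continuous_intros prufer_cont[OF p1] prufer_cont[OF p2])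
  have c: "c absolutely_integrable_on {a..b}"
    unfolding c_def by (rule abs_int_mult_bounded(1)[OF abs_int_diff_const[OF q2] wm w1])
  have cb: "\<forall>t. \<bar>c t\<bar> \<le> \<bar>q2 t - 1\<bar>"
  proof
    show "\<bar>c t\<bar> \<le> \<bar>q2 t - 1\<bar>" for t
      using mult_left_mono[OF w1, of "\<bar>q2 t - 1\<bar>" t] by (simp add: c_def abs_mult)
  qed
  have "indef_int a b (\<lambda>t. \<theta>2 t - \<theta>1 t) (\<lambda>t. c t * (\<theta>2 t - \<theta>1 t) + (q2 t - q1 t) * (sin (\<theta>1 t))\<^sup>2)"
    using indef_int_diff[OF p2[unfolded prufer_def] p1[unfolded prufer_def]]
  proof (rule indef_int_cong)
    fix t
    have "w t * (\<theta>2 t - \<theta>1 t) = (sin (\<theta>2 t))\<^sup>2 - (sin (\<theta>1 t))\<^sup>2"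
      by (cases "\<theta>2 t = \<theta>1 t") (auto simp: w_def)
    then have "c t * (\<theta>2 t - \<theta>1 t) = (q2 t - 1) * ((sin (\<theta>2 t))\<^sup>2 - (sin (\<theta>1 t))\<^sup>2)"
      by (simp add: c_def mult.assoc)
    then show "1 + (q2 t - 1) * (sin (\<theta>2 t))\<^sup>2 - (1 + (q1 t - 1) * (sin (\<theta>1 t))\<^sup>2) =
        c t * (\<theta>2 t - \<theta>1 t) + (q2 t - q1 t) * (sin (\<theta>1 t))\<^sup>2"
      by (simp add: algebra_simps)
  qed auto
  from that[OF c cb linear_first_order[OF this c]] show thesis .
qed

text \<open>The integrating factor and its inverse are at most exp Q, where \<open>Q\<close> bounds
  the integral of |q2 - 1| alone; one factor for each gives exp (2 Q).\<close>

lemma prufer_lipschitz: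
  assumes p1: "prufer a b q1 \<theta>1" and p2: "prufer a b q2 \<theta>2" and ab: "a \<le> b"
    and q1: "q1 absolutely_integrable_on {a..b}" and q2: "q2 absolutely_integrable_on {a..b}"
    and Q: "integral {a..b} (\<lambda>t. \<bar>q2 t - 1\<bar>) \<le> Q"
  shows "\<bar>\<theta>2 b - \<theta>1 b\<bar> \<le> exp (2 * Q) * (\<bar>\<theta>2 a - \<theta>1 a\<bar> + integral {a..b} (\<lambda>t. \<bar>q2 t - q1 t\<bar>))"
proof -
  obtain c where c: "c absolutely_integrable_on {a..b}" and cb: "\<forall>t. \<bar>c t\<bar> \<le> \<bar>q2 t - 1\<bar>" and
    I: "indef_int a b (\<lambda>t. exp (- integral {a..t} c) * (\<theta>2 t - \<theta>1 t))
       (\<lambda>t. exp (- integral {a..t} c) * ((q2 t - q1 t) * (sin (\<theta>1 t))\<^sup>2))"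
    by (rule prufer_diff[OF p1 p2 q1 q2]) (rule that; assumption)
  have qk: "(\<lambda>t. \<bar>q2 t - 1\<bar>) absolutely_integrable_on {a..b}"
    by (rule abs_int_imp_abs[OF abs_int_diff_const[OF q2]])
  have CQ: "\<bar>integral {a..t} c\<bar> \<le> Q" if t: "t \<in> {a..b}" for t
  proof -
    have s: "c absolutely_integrable_on {a..t}" "(\<lambda>t. \<bar>q2 t - 1\<bar>) absolutely_integrable_on {a..t}"
      using abs_int_subinterval[OF c, of a t] abs_int_subinterval[OF qk, of a t] t by simp_all
    have "\<bar>integral {a..t} c\<bar> \<le> integral {a..t} (\<lambda>t. \<bar>q2 t - 1\<bar>)"
      by (rule abs_integral_le[OF s]) (simp add: cb)
    also have "\<dots> \<le> integral {a..b} (\<lambda>t. \<bar>q2 t - 1\<bar>)"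
      by (rule integral_subset_le[OF _ abs_int_imp_int[OF s(2)] abs_int_imp_int[OF qk]]) (use t in auto)
    finally show ?thesis using Q by simp
  qed
  let ?f = "\<lambda>t. exp (- integral {a..t} c) * ((q2 t - q1 t) * (sin (\<theta>1 t))\<^sup>2)"
  have d: "(\<lambda>t. exp Q * \<bar>q2 t - q1 t\<bar>) absolutely_integrable_on {a..b}"
    by (intro set_integrable_mult_right abs_int_imp_abs set_integral_diff(1)[OF q2 q1])
  have "\<bar>integral {a..b} ?f\<bar> \<le> integral {a..b} (\<lambda>t. exp Q * \<bar>q2 t - q1 t\<bar>)"
  proof (rule abs_integral_le[OF indef_int_abs_int[OF I] d])
    fix t assume t: "t \<in> {a..b}"
    have 1: "exp (- integral {a..t} c) \<le> exp Q" using CQ[OF t] by auto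
    have 2: "\<bar>q2 t - q1 t\<bar> * (sin (\<theta>1 t))\<^sup>2 \<le> \<bar>q2 t - q1 t\<bar> * 1"
      by (intro mult_left_mono) (auto simp: abs_square_le_1)
    show "\<bar>?f t\<bar> \<le> exp Q * \<bar>q2 t - q1 t\<bar>"
      using mult_mono[OF 1 2] by (simp add: abs_mult)
  qed
  then have i: "\<bar>integral {a..b} ?f\<bar> \<le> exp Q * integral {a..b} (\<lambda>t. \<bar>q2 t - q1 t\<bar>)" by simp
  have Q0: "Q \<ge> 0" using CQ[of a] ab by simp
  have e: "exp (- integral {a..b} c) * (\<theta>2 b - \<theta>1 b) = (\<theta>2 a - \<theta>1 a) + integral {a..b} ?f"
    using indef_intD[OF I, of b] ab by simp
  have "\<theta>2 b - \<theta>1 b = exp (integral {a..b} c) * (exp (- integral {a..b} c) * (\<theta>2 b - \<theta>1 b))"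
    by (simp add: exp_minus)
  then have "\<bar>\<theta>2 b - \<theta>1 b\<bar> = exp (integral {a..b} c) * \<bar>(\<theta>2 a - \<theta>1 a) + integral {a..b} ?f\<bar>"
    unfolding e by (simp add: abs_mult)
  also have "\<dots> \<le> exp Q * (\<bar>\<theta>2 a - \<theta>1 a\<bar> + \<bar>integral {a..b} ?f\<bar>)"
    using CQ[of b] ab by (intro mult_mono) auto
  also have "\<dots> \<le> exp Q * (exp Q * \<bar>\<theta>2 a - \<theta>1 a\<bar> + exp Q * integral {a..b} (\<lambda>t. \<bar>q2 t - q1 t\<bar>))"
    using i Q0 mult_right_mono[of 1 "exp Q" "\<bar>\<theta>2 a - \<theta>1 a\<bar>"] by (intro mult_left_mono add_mono) auto
  also have "\<dots> = exp (2 * Q) * (\<bar>\<theta>2 a - \<theta>1 a\<bar> + integral {a..b} (\<lambda>t. \<bar>q2 t - q1 t\<bar>))"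
  proof -
    have "exp (2 * Q) = exp Q * exp Q" by (simp add: mult_exp_exp)
    then show ?thesis by (simp only: distrib_left mult.assoc)
  qed
  finally show ?thesis .
qed

lemma prufer_unique:
  assumes "prufer a b q \<theta>1" "prufer a b q \<theta>2" "q absolutely_integrable_on {a..b}" "\<theta>1 a = \<theta>2 a" "t \<in> {a..b}"
  shows "\<theta>1 t = \<theta>2 t"
proof -
  have "\<bar>\<theta>2 t - \<theta>1 t\<bar> \<le> exp (2 * integral {a..t} (\<lambda>t. \<bar>q t - 1\<bar>)) * (\<bar>\<theta>2 a - \<theta>1 a\<bar> + integral {a..t} (\<lambda>t. \<bar>q t - q t\<bar>))"
    by (rule prufer_lipschitz[OF prufer_sub[OF assms(1)] prufer_sub[OF assms(2)] _
          abs_int_subinterval[OF assms(3)] abs_int_subinterval[OF assms(3)]])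
      (use assms(5) in auto)
  then show ?thesis using assms by simp
qed

text \<open>The source term (q2 - q1) sin^2 \<theta>1 is nonnegative, so the difference weighted by
  the integrating factor never falls below its initial value.\<close>

lemma prufer_mono:
  assumes p1: "prufer a b q1 \<theta>1" and p2: "prufer a b q2 \<theta>2" and ab: "a \<le> b"
    and q1: "q1 absolutely_integrable_on {a..b}" and q2: "q2 absolutely_integrable_on {a..b}"
    and q: "\<And>t. t \<in> {a..b} \<Longrightarrow> q1 t \<le> q2 t" and a: "\<theta>1 a \<le> \<theta>2 a"
  shows "\<theta>1 b \<le> \<theta>2 b" "\<theta>1 a < \<theta>2 a \<Longrightarrow> \<theta>1 b < \<theta>2 b"
proof -
  obtain c where c: "c absolutely_integrable_on {a..b}" and "\<forall>t. \<bar>c t\<bar> \<le> \<bar>q2 t - 1\<bar>" and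
    I: "indef_int a b (\<lambda>t. exp (- integral {a..t} c) * (\<theta>2 t - \<theta>1 t))
       (\<lambda>t. exp (- integral {a..t} c) * ((q2 t - q1 t) * (sin (\<theta>1 t))\<^sup>2))"
    by (rule prufer_diff[OF p1 p2 q1 q2]) (rule that; assumption)
  let ?f = "\<lambda>t. exp (- integral {a..t} c) * ((q2 t - q1 t) * (sin (\<theta>1 t))\<^sup>2)"
  have "integral {a..b} ?f \<ge> 0"
    by (rule integral_nonneg[OF abs_int_imp_int[OF indef_int_abs_int[OF I]]]) (use q in auto)
  moreover have "exp (- integral {a..b} c) * (\<theta>2 b - \<theta>1 b) = (\<theta>2 a - \<theta>1 a) + integral {a..b} ?f"
    using indef_intD[OF I, of b] ab by simp
  ultimately have "exp (- integral {a..b} c) * (\<theta>2 b - \<theta>1 b) \<ge> \<theta>2 a - \<theta>1 a" by simp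
  then have "0 \<le> exp (- integral {a..b} c) * (\<theta>2 b - \<theta>1 b)"
     "\<theta>1 a < \<theta>2 a \<Longrightarrow> 0 < exp (- integral {a..b} c) * (\<theta>2 b - \<theta>1 b)" using a by linarith+
  then show "\<theta>1 b \<le> \<theta>2 b" "\<theta>1 a < \<theta>2 a \<Longrightarrow> \<theta>1 b < \<theta>2 b"
    by (auto simp: zero_le_mult_iff zero_less_mult_iff)
qed

lemma prufer_add_pi:
  assumes "prufer a b q \<theta>"
  shows "prufer a b q (\<lambda>t. \<theta> t + of_int j * pi)"
proof -
  have s: "(sin (x + of_int j * pi))\<^sup>2 = (sin x)\<^sup>2" for x
    using sin_sq_diff[of "x + of_int j * pi" x] sin_zero_iff_int2[of "of_int j * pi"] by auto
  show ?thesis unfolding prufer_def s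
    using indef_int_add[OF assms[unfolded prufer_def] indef_int_const[of a b "of_int j * pi"]] by simp
qed

text \<open>The angle passes through a multiple of \<open>\<pi>\<close> with positive speed, because the term
  \<open>q sin\<^sup>2 \<theta>\<close> vanishes there to second order.\<close>

lemma prufer_cross_pi:
  assumes p: "prufer a b q \<theta>" and q: "q absolutely_integrable_on {a..b}"
    and st: "s \<in> {a..b}" "t \<in> {a..b}" "s < t" and ge: "\<theta> s \<ge> of_int j * pi"
  shows "\<theta> t > of_int j * pi"
proof -
  define \<phi> where "\<phi> t = \<theta> t + of_int (- j) * pi" for t
  have P: "prufer a b q \<phi>" unfolding \<phi>_def by (rule prufer_add_pi[OF p])
  note pc = prufer_cont[OF P]
  \<comment> \<open>The quotient by \<phi> itself turns the equation into \<phi>' = c \<phi> + 1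
    with integrable c. At a zero of \<phi> it is 0 by division by zero, which agrees with sin^2
    vanishing there.\<close>
  define w where "w t = (sin (\<phi> t))\<^sup>2 / \<phi> t" for t
  have w1: "\<bar>w t\<bar> \<le> 1" for t
    using sin_sq_lipschitz[of "\<phi> t" 0] unfolding w_def abs_divide
    by (cases "\<phi> t = 0") (auto simp: divide_le_eq_1)
  have m: "f \<in> borel_measurable (lebesgue_on {a..b})" if "continuous_on {a..b} f" for f :: "real \<Rightarrow> real"
    by (rule continuous_imp_measurable_on_sets_lebesgue[OF that]) simp
  have wm: "w \<in> borel_measurable (lebesgue_on {a..b})"
    unfolding w_def by (intro borel_measurable_divide m continuous_intros pc)
  define c where "c t = (q t - 1) * w t" for t
  have c: "c absolutely_integrable_on {a..b}"
    unfolding c_def by (rule abs_int_mult_bounded(1)[OF abs_int_diff_const[OF q] wm w1])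
  have "indef_int a b \<phi> (\<lambda>t. c t * \<phi> t + 1)"
    by (rule indef_int_cong[OF P[unfolded prufer_def]]) (auto simp: c_def w_def)
  note I = linear_first_order[OF this c]
  let ?E = "\<lambda>t. exp (- integral {a..t} c)"
  have Ec: "continuous_on {a..b} ?E"
    by (intro continuous_intros indef_int_cont[OF indef_int_integral[OF c]])
  have "integral {s..t} (\<lambda>t. 1 * ?E t) > 0"
    by (rule integral_pos_mult) (use st in \<open>auto intro!: abs_int_const continuous_on_subset[OF Ec]\<close>)
  moreover have "?E t * \<phi> t = ?E s * \<phi> s + integral {s..t} (\<lambda>t. ?E t * 1)"
    by (rule indef_int_diff_eq[OF I]) (use st in auto)
  moreover have "?E s * \<phi> s \<ge> 0" using ge by (auto simp: \<phi>_def)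
  ultimately have "?E t * \<phi> t > 0" by simp
  then show ?thesis by (auto simp: \<phi>_def zero_less_mult_iff)
qed

text \<open>Once a multiple of \<pi> is reached the angle stays strictly above it, so distinct zeros
  belong to distinct multiples and \<open>J\<close> injects them into the integers.\<close>

lemma prufer_countable_zeros:
  assumes p: "prufer a b q \<theta>" and q: "q absolutely_integrable_on {a..b}"
  shows "countable {t \<in> {a..b}. sin (\<theta> t) = 0}"
proof -
  define J where "J t = (SOME j. \<theta> t = of_int j * pi)" for t
  have J: "\<theta> t = of_int (J t) * pi" if "sin (\<theta> t) = 0" for t
    unfolding J_def by (rule someI_ex) (use that sin_zero_iff_int2 in auto)
  have "inj_on J {t \<in> {a..b}. sin (\<theta> t) = 0}"
  proof (rule linorder_inj_onI')
    fix s t assume "s \<in> {t \<in> {a..b}. sin (\<theta> t) = 0}" "t \<in> {t \<in> {a..b}. sin (\<theta> t) = 0}" "s < t"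
    then show "J s \<noteq> J t"
      using prufer_cross_pi[OF p q, of s t "J s"] J[of s] J[of t] by auto
  qed
  then show ?thesis by (rule countableI') 
qed

text \<open>The source term carries the factor sin^2 \<theta>1, whose zeros are countable, so an
  excess of q2 over q1 is felt wherever it sits.\<close>

lemma prufer_strict_mono_potential:
  assumes p1: "prufer a b q1 \<theta>1" and p2: "prufer a b q2 \<theta>2" and ab: "a \<le> b"
    and q1: "q1 absolutely_integrable_on {a..b}" and q2: "q2 absolutely_integrable_on {a..b}"
    and q: "\<And>t. t \<in> {a..b} \<Longrightarrow> q1 t \<le> q2 t" and a: "\<theta>1 a \<le> \<theta>2 a"
    and pos: "integral {a..b} (\<lambda>t. q2 t - q1 t) > 0"
  shows "\<theta>1 b < \<theta>2 b"
proof -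
  obtain c where c: "c absolutely_integrable_on {a..b}" and "\<forall>t. \<bar>c t\<bar> \<le> \<bar>q2 t - 1\<bar>" and
    I: "indef_int a b (\<lambda>t. exp (- integral {a..t} c) * (\<theta>2 t - \<theta>1 t))
       (\<lambda>t. exp (- integral {a..t} c) * ((q2 t - q1 t) * (sin (\<theta>1 t))\<^sup>2))"
    by (rule prufer_diff[OF p1 p2 q1 q2]) (rule that; assumption)
  let ?E = "\<lambda>t. exp (- integral {a..t} c)"
  have Ec: "continuous_on {a..b} ?E"
    by (intro continuous_intros indef_int_cont[OF indef_int_integral[OF c]])
  have "integral {a..b} (\<lambda>t. (q2 t - q1 t) * (?E t * (sin (\<theta>1 t))\<^sup>2)) > 0"
  proof (rule integral_pos_mult[OF set_integral_diff(1)[OF q2 q1] _ pos])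
    show "continuous_on {a..b} (\<lambda>t. ?E t * (sin (\<theta>1 t))\<^sup>2)"
      by (intro continuous_intros Ec prufer_cont[OF p1])
    show "countable {t \<in> {a..b}. ?E t * (sin (\<theta>1 t))\<^sup>2 = 0}"
      using prufer_countable_zeros[OF p1 q1] by simp
  qed (use q in auto)
  moreover have "?E b * (\<theta>2 b - \<theta>1 b) = (\<theta>2 a - \<theta>1 a) + integral {a..b} (\<lambda>t. ?E t * ((q2 t - q1 t) * (sin (\<theta>1 t))\<^sup>2))"
    using indef_intD[OF I, of b] ab by simp
  moreover have "(\<lambda>t. ?E t * ((q2 t - q1 t) * (sin (\<theta>1 t))\<^sup>2)) = (\<lambda>t. (q2 t - q1 t) * (?E t * (sin (\<theta>1 t))\<^sup>2))"
    by (auto simp: fun_eq_iff)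
  ultimately have "?E b * (\<theta>2 b - \<theta>1 b) > 0" using a by simp
  then show ?thesis by (auto simp: zero_less_mult_iff)
qed

subsection \<open>Hill's equation\<close>

definition hill_sol :: "real \<Rightarrow> real \<Rightarrow> (real \<Rightarrow> real) \<Rightarrow> (real \<Rightarrow> real) \<Rightarrow> (real \<Rightarrow> real) \<Rightarrow> bool" where
  "hill_sol a b q u v \<longleftrightarrow> indef_int a b u v \<and> indef_int a b v (\<lambda>t. - (q t * u t))"

lemma hill_sol_sub: "hill_sol a b q u v \<Longrightarrow> a \<le> c \<Longrightarrow> d \<le> b \<Longrightarrow> hill_sol c d q u v"
  unfolding hill_sol_def using indef_int_sub by auto

lemma hill_sol_wronskian:
  assumes "hill_sol a b q u1 v1" "hill_sol a b q u2 v2" "t \<in> {a..b}"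
  shows "u1 t * v2 t - u2 t * v1 t = u1 a * v2 a - u2 a * v1 a"
proof -
  note h = assms(1,2)[unfolded hill_sol_def]
  have "indef_int a b (\<lambda>t. u1 t * v2 t - u2 t * v1 t) (\<lambda>t. 0)"
    by (rule indef_int_cong[OF indef_int_diff[OF indef_int_mult[OF conjunct1[OF h(1)] conjunct2[OF h(2)]]
            indef_int_mult[OF conjunct1[OF h(2)] conjunct2[OF h(1)]]]])
      (auto simp: algebra_simps)
  from indef_intD[OF this assms(3)] show ?thesis by simp
qed

lemma hill_sol_comb:
  assumes "hill_sol a b q u1 v1" "hill_sol a b q u2 v2"
  shows "hill_sol a b q (\<lambda>t. x * u1 t + y * u2 t) (\<lambda>t. x * v1 t + y * v2 t)"
  unfolding hill_sol_def
proof
  note h = assms[unfolded hill_sol_def]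
  show "indef_int a b (\<lambda>t. x * u1 t + y * u2 t) (\<lambda>t. x * v1 t + y * v2 t)"
    using h by (intro indef_int_add indef_int_cmult) auto
  have "indef_int a b (\<lambda>t. x * v1 t + y * v2 t) (\<lambda>t. x * - (q t * u1 t) + y * - (q t * u2 t))"
    using h by (intro indef_int_add indef_int_cmult) auto
  then show "indef_int a b (\<lambda>t. x * v1 t + y * v2 t) (\<lambda>t. - (q t * (x * u1 t + y * u2 t)))"
    by (rule indef_int_cong) (auto simp: algebra_simps)
qed

text \<open>Given the angle, the radius solves the linear equation r' = - (q - 1) sin \<theta> cos
  \<theta> r and is an explicit exponential; thus existence for the scalar angle equation yields
  existence for the system.\<close>

lemma hill_sol_polar:
  assumes p: "prufer a b q \<theta>" and q: "q absolutely_integrable_on {a..b}"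
  obtains r where "\<forall>t. r t > 0" "r a = 1" "hill_sol a b q (\<lambda>t. r t * sin (\<theta> t)) (\<lambda>t. r t * cos (\<theta> t))"
proof -
  define g where "g t = - ((q t - 1) * (sin (\<theta> t) * cos (\<theta> t)))" for t
  have g: "g absolutely_integrable_on {a..b}"
    unfolding g_def set_integrable_def scaleR_minus_right
    by (intro integrable_minus, unfold set_integrable_def[symmetric], intro abs_int_mult_cont(1)[OF abs_int_diff_const[OF q]] continuous_intros prufer_cont[OF p])
  define r where "r t = exp (integral {a..t} g)" for t
  have r: "indef_int a b r (\<lambda>t. r t * g t)"
    unfolding r_def by (rule indef_int_chain[OF indef_int_integral[OF g]]) (auto intro!: continuous_intros)
  have s: "indef_int a b (\<lambda>t. sin (\<theta> t)) (\<lambda>t. cos (\<theta> t) * (1 + (q t - 1) * (sin (\<theta> t))\<^sup>2))"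
    by (rule indef_int_chain[OF p[unfolded prufer_def]]) (auto intro!: continuous_intros)
  have c: "indef_int a b (\<lambda>t. cos (\<theta> t)) (\<lambda>t. - sin (\<theta> t) * (1 + (q t - 1) * (sin (\<theta> t))\<^sup>2))"
    by (rule indef_int_chain[OF p[unfolded prufer_def]]) (auto intro!: continuous_intros)
  have 1: "indef_int a b (\<lambda>t. r t * sin (\<theta> t)) (\<lambda>t. r t * cos (\<theta> t))"
  proof (rule indef_int_cong[OF indef_int_mult[OF r s]])
    fix t
    have "r t * g t * sin (\<theta> t) + r t * (cos (\<theta> t) * (1 + (q t - 1) * (sin (\<theta> t))\<^sup>2)) = r t * cos (\<theta> t)"
      by (simp add: g_def power2_eq_square algebra_simps)
    then show "r t * g t * sin (\<theta> t) + r t * (cos (\<theta> t) * (1 + (q t - 1) * (sin (\<theta> t))\<^sup>2)) = r t * cos (\<theta> t)" .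
  qed auto
  have 2: "indef_int a b (\<lambda>t. r t * cos (\<theta> t)) (\<lambda>t. - (q t * (r t * sin (\<theta> t))))"
  proof (rule indef_int_cong[OF indef_int_mult[OF r c]])
    fix t
    have "(cos (\<theta> t))\<^sup>2 + (sin (\<theta> t))\<^sup>2 = 1" by simp
    then     show "r t * g t * cos (\<theta> t) + r t * (- sin (\<theta> t) * (1 + (q t - 1) * (sin (\<theta> t))\<^sup>2)) = - (q t * (r t * sin (\<theta> t)))"
      unfolding g_def by algebra
  qed auto
  show thesis by (rule that[of r]) (use 1 2 in \<open>auto simp: hill_sol_def r_def\<close>)
qed

lemma hill_sol_exists:
  assumes q: "q absolutely_integrable_on {a..b}" and ab: "a \<le> b"
  obtains u v where "hill_sol a b q u v" "u a = x" "v a = y"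
proof -
  have ex: "\<exists>u v. hill_sol a b q u v \<and> u a = sin \<alpha> \<and> v a = cos \<alpha>" for \<alpha>
  proof -
    obtain \<theta> where p: "prufer a b q \<theta>" "\<theta> a = \<alpha>" using prufer_exists[OF q ab] by blast
    obtain r where "r a = 1" "hill_sol a b q (\<lambda>t. r t * sin (\<theta> t)) (\<lambda>t. r t * cos (\<theta> t))"
      by (rule hill_sol_polar[OF p(1) q])
    with p(2) show ?thesis
      by (intro exI[of _ "\<lambda>t. r t * sin (\<theta> t)"] exI[of _ "\<lambda>t. r t * cos (\<theta> t)"]) simp
  qed
  obtain u0 v0 where 0: "hill_sol a b q u0 v0" "u0 a = 0" "v0 a = 1" using ex[of 0] by auto
  obtain u1 v1 where 1: "hill_sol a b q u1 v1" "u1 a = 1" "v1 a = 0" using ex[of "pi/2"] by auto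
  show thesis by (rule that[OF hill_sol_comb[OF 0(1) 1(1), of y x]]) (use 0 1 in auto)
qed

text \<open>Uniqueness without a Gronwall argument: the Wronskians of \<open>u\<close> with two
  solutions of mutual Wronskian -1 vanish identically, and these two linear equations leave only u t
  = v t = 0.\<close>

lemma hill_sol_zero:
  assumes h: "hill_sol a b q u v" and q: "q absolutely_integrable_on {a..b}"
    and z: "u a = 0" "v a = 0" and t: "t \<in> {a..b}"
  shows "u t = 0 \<and> v t = 0"
proof -
  have ab: "a \<le> b" using t by auto
  obtain u0 v0 where 0: "hill_sol a b q u0 v0" "u0 a = 0" "v0 a = 1" using hill_sol_exists[OF q ab] .
  obtain u1 v1 where 1: "hill_sol a b q u1 v1" "u1 a = 1" "v1 a = 0" using hill_sol_exists[OF q ab] .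
  have e0: "u t * v0 t = u0 t * v t" using hill_sol_wronskian[OF h 0(1) t] z by simp
  have e1: "u t * v1 t = u1 t * v t" using hill_sol_wronskian[OF h 1(1) t] z by simp
  have e2: "u0 t * v1 t - u1 t * v0 t = -1" using hill_sol_wronskian[OF 0(1) 1(1) t] 0 1 by simp
  have "u t * (u0 t * v1 t - u1 t * v0 t) = u0 t * (u t * v1 t) - u1 t * (u t * v0 t)" by (simp add: algebra_simps)
  also have "\<dots> = 0" unfolding e0 e1 by (simp add: algebra_simps)
  finally have "u t = 0" using e2 by simp
  have "v t * (u0 t * v1 t - u1 t * v0 t) = (u0 t * v t) * v1 t - (u1 t * v t) * v0 t" by (simp add: algebra_simps)
  also have "\<dots> = 0" unfolding e0[symmetric] e1[symmetric] by (simp add: algebra_simps)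
  finally have "v t = 0" using e2 by simp
  with \<open>u t = 0\<close> show ?thesis by simp
qed

lemma hill_sol_unique:
  assumes "hill_sol a b q u1 v1" "hill_sol a b q u2 v2" "q absolutely_integrable_on {a..b}"
    and "u1 a = u2 a" "v1 a = v2 a" "t \<in> {a..b}"
  shows "u1 t = u2 t" "v1 t = v2 t"
  using hill_sol_zero[OF hill_sol_comb[OF assms(1,2), of 1 "-1"] assms(3) _ _ assms(6)] assms(4,5) by auto

lemma hill_sol_eq_comb:
  assumes h: "hill_sol a b q u v" "hill_sol a b q u1 v1" "hill_sol a b q u2 v2"
    and q: "q absolutely_integrable_on {a..b}"
    and "u a = x * u1 a + y * u2 a" "v a = x * v1 a + y * v2 a" "t \<in> {a..b}"
  shows "u t = x * u1 t + y * u2 t" "v t = x * v1 t + y * v2 t"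
  using hill_sol_unique[OF h(1) hill_sol_comb[OF h(2,3)] q] assms(5-) by auto

subsection \<open>The rotation over one period\<close>

text \<open>Final angle as a function of the initial one: the lift to the real line of the action of
  the monodromy on directions. The choice is unambiguous because an angle is determined by its
  start.\<close>

definition pangle :: "real \<Rightarrow> (real \<Rightarrow> real) \<Rightarrow> real \<Rightarrow> real" where
  "pangle T q \<alpha> = (SOME x. \<exists>\<theta>. prufer 0 T q \<theta> \<and> \<theta> 0 = \<alpha> \<and> x = \<theta> T)"

definition rot :: "real \<Rightarrow> (real \<Rightarrow> real) \<Rightarrow> real \<Rightarrow> real" where
  "rot T q \<alpha> = pangle T q \<alpha> - \<alpha>"

text \<open>The boundary value problem of \<open>antiper_sol\<close> with the equation already in
  integrated form.\<close>

definition antisol :: "real \<Rightarrow> (real \<Rightarrow> real) \<Rightarrow> (real \<Rightarrow> real) \<Rightarrow> (real \<Rightarrow> real) \<Rightarrow> bool" where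
  "antisol T q u v \<longleftrightarrow> hill_sol 0 T q u v \<and> u 0 + u T = 0 \<and> v 0 + v T = 0"

text \<open>Shifting the initial angle by \<pi> only changes the sign of the solution, so [0, \<pi>]
  exhausts all rotations.\<close>

definition rmax :: "real \<Rightarrow> (real \<Rightarrow> real) \<Rightarrow> real" where
  "rmax T q = (SUP \<alpha>\<in>{0..pi}. rot T q \<alpha>)"

definition rmin :: "real \<Rightarrow> (real \<Rightarrow> real) \<Rightarrow> real" where
  "rmin T q = (INF \<alpha>\<in>{0..pi}. rot T q \<alpha>)"

lemma antisol_comb:
  assumes "antisol T q u1 v1" "antisol T q u2 v2"
  shows "antisol T q (\<lambda>t. x * u1 t + y * u2 t) (\<lambda>t. x * v1 t + y * v2 t)"
proof -
  have "u1 T = - u1 0" "u2 T = - u2 0" "v1 T = - v1 0" "v2 T = - v2 0"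
    using assms unfolding antisol_def by linarith+
  moreover have "hill_sol 0 T q (\<lambda>t. x * u1 t + y * u2 t) (\<lambda>t. x * v1 t + y * v2 t)"
    using assms by (intro hill_sol_comb) (auto simp: antisol_def)
  ultimately show ?thesis unfolding antisol_def by simp
qed

lemma sin_cos_add_odd_pi:
  assumes "odd (j::int)"
  shows "sin (x + of_int j * pi) = - sin x" "cos (x + of_int j * pi) = - cos x"
proof -
  obtain k where j: "j = 2 * k + 1" using assms oddE by blast
  have e: "x + of_int j * pi = (x + pi) + of_int k * (2 * pi)" by (simp add: j algebra_simps)
  show "sin (x + of_int j * pi) = - sin x" "cos (x + of_int j * pi) = - cos x"
    unfolding e sin_add[of "x + pi"] cos_add[of "x + pi"]
    using sin_int_2pin[of k] cos_int_2pin[of k] by (simp_all add: mult.commute)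
qed

lemma sin_cos_eq_neg_imp:
  assumes "sin y = - sin x" "cos y = - cos x"
  obtains j :: int where "odd j" "y = x + of_int j * pi"
proof -
  have "sin y = sin (x + pi) \<and> cos y = cos (x + pi)" using assms by simp
  then obtain n :: int where n: "y = (x + pi) + 2 * pi * of_int n"
    using sin_cos_eq_iff by blast
  show thesis by (rule that[of "2 * n + 1"]) (auto simp: n algebra_simps)
qed

lemma polar_coords:
  fixes x y :: real
  obtains c \<alpha> where "x = c * sin \<alpha>" "y = c * cos \<alpha>" "c \<ge> 0"
proof -
  obtain r a where "y = r * cos a" "x = r * sin a" "r \<ge> 0"
  proof -
    have "Complex y x = rcis (cmod (Complex y x)) (Arg (Complex y x))" by (simp add: rcis_cmod_Arg)
    then show thesis
      by (intro that[of "cmod (Complex y x)" "Arg (Complex y x)"]) (auto simp: complex_eq_iff)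
  qed
  then show thesis using that by blast
qed

lemma mod_pi:
  fixes \<alpha> \<beta> :: real
  obtains j :: int where "\<beta> \<le> \<alpha> + of_int j * pi" "\<alpha> + of_int j * pi < \<beta> + pi"
proof -
  let ?j = "- \<lfloor>(\<alpha> - \<beta>) / pi\<rfloor>"
  have "of_int \<lfloor>(\<alpha> - \<beta>) / pi\<rfloor> \<le> (\<alpha> - \<beta>) / pi" "(\<alpha> - \<beta>) / pi < of_int \<lfloor>(\<alpha> - \<beta>) / pi\<rfloor> + 1" by linarith+
  then have "of_int \<lfloor>(\<alpha> - \<beta>) / pi\<rfloor> * pi \<le> \<alpha> - \<beta>" "\<alpha> - \<beta> < (of_int \<lfloor>(\<alpha> - \<beta>) / pi\<rfloor> + 1) * pi"
    by (simp_all only: pos_le_divide_eq[OF pi_gt_zero] pos_divide_less_eq[OF pi_gt_zero])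
  then show thesis by (intro that[of ?j]) (simp_all add: algebra_simps)
qed

context
  fixes T :: real and q :: "real \<Rightarrow> real"
  assumes T: "T > 0" and q: "q absolutely_integrable_on {0..T}"
begin

lemma pangle_eq: "prufer 0 T q \<theta> \<Longrightarrow> pangle T q (\<theta> 0) = \<theta> T"
  unfolding pangle_def
proof (rule some_equality)
  fix x assume a: "prufer 0 T q \<theta>" "\<exists>\<theta>'. prufer 0 T q \<theta>' \<and> \<theta>' 0 = \<theta> 0 \<and> x = \<theta>' T"
  then obtain \<theta>' where "prufer 0 T q \<theta>'" "\<theta>' 0 = \<theta> 0" "x = \<theta>' T" by blast
  then show "x = \<theta> T" using prufer_unique[OF _ a(1) q, of \<theta>' T] T by simp
next
  show "\<exists>\<theta>'. prufer 0 T q \<theta>' \<and> \<theta>' 0 = \<theta> 0 \<and> \<theta> T = \<theta>' T" if "prufer 0 T q \<theta>"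
    using that by blast
qed

lemma pangle_ex:
  obtains \<theta> where "prufer 0 T q \<theta>" "\<theta> 0 = \<alpha>" "\<theta> T = pangle T q \<alpha>"
proof -
  obtain \<theta> where \<theta>: "prufer 0 T q \<theta>" "\<theta> 0 = \<alpha>"
    using prufer_exists[OF q less_imp_le[OF T], of \<alpha>] by auto
  show thesis by (rule that[OF \<theta>]) (use pangle_eq[OF \<theta>(1)] \<theta>(2) in simp)
qed

lemma pangle_shift: "pangle T q (\<alpha> + of_int j * pi) = pangle T q \<alpha> + of_int j * pi"
proof -
  obtain \<theta> where t: "prufer 0 T q \<theta>" "\<theta> 0 = \<alpha>" "\<theta> T = pangle T q \<alpha>" by (rule pangle_ex)
  from pangle_eq[OF prufer_add_pi[OF t(1), of j]] t show ?thesis by simp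
qed

lemma rot_shift: "rot T q (\<alpha> + of_int j * pi) = rot T q \<alpha>"
  by (simp add: rot_def pangle_shift)

lemma pangle_less:
  assumes "\<alpha> < \<beta>"
  shows "pangle T q \<alpha> < pangle T q \<beta>"
proof -
  obtain \<theta> where t: "prufer 0 T q \<theta>" "\<theta> 0 = \<alpha>" "\<theta> T = pangle T q \<alpha>" by (rule pangle_ex)
  obtain \<phi> where p: "prufer 0 T q \<phi>" "\<phi> 0 = \<beta>" "\<phi> T = pangle T q \<beta>" by (rule pangle_ex)
  show ?thesis using prufer_mono(2)[OF t(1) p(1) _ q q] t p T assms by simp
qed

lemma rot_cont: "continuous_on UNIV (rot T q)"
proof -
  have l: "\<bar>pangle T q \<beta> - pangle T q \<alpha>\<bar> \<le> exp (2 * integral {0..T} (\<lambda>t. \<bar>q t - 1\<bar>)) * \<bar>\<beta> - \<alpha>\<bar>" for \<alpha> \<beta>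
  proof -
    obtain \<theta> where t: "prufer 0 T q \<theta>" "\<theta> 0 = \<alpha>" "\<theta> T = pangle T q \<alpha>" by (rule pangle_ex)
    obtain \<phi> where p: "prufer 0 T q \<phi>" "\<phi> 0 = \<beta>" "\<phi> T = pangle T q \<beta>" by (rule pangle_ex)
    show ?thesis using prufer_lipschitz[OF t(1) p(1) _ q q order_refl] t p T by simp
  qed
  have "(exp (2 * integral {0..T} (\<lambda>t. \<bar>q t - 1\<bar>)))-lipschitz_on UNIV (pangle T q)"
    by (rule lipschitz_onI) (use l in \<open>auto simp: dist_real_def\<close>)
  then have "continuous_on UNIV (pangle T q)" by (rule lipschitz_on_continuous_on)
  then show ?thesis unfolding rot_def[abs_def] by (intro continuous_intros)
qed

text \<open>An increasing map that commutes with translation by \<pi> displaces any two points by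
  amounts less than \<pi> apart: after shifting \<beta> into [\<alpha>, \<alpha> + \<pi>), its image
  lies below that of \<alpha> + \<pi>.\<close>

lemma rot_less: "rot T q \<beta> < rot T q \<alpha> + pi"
proof -
  obtain j :: int where j: "\<alpha> \<le> \<beta> + of_int j * pi" "\<beta> + of_int j * pi < \<alpha> + pi" by (rule mod_pi)
  have "pangle T q (\<beta> + of_int j * pi) < pangle T q (\<alpha> + of_int 1 * pi)" by (rule pangle_less) (use j in simp)
  then have "rot T q (\<beta> + of_int j * pi) < rot T q \<alpha> + pi"
    using j unfolding pangle_shift[of \<alpha> 1] by (simp add: rot_def)
  then show ?thesis by (simp add: rot_shift)
qed

text \<open>Multiples of \<pi> are crossed upwards only, so a start in [0, \<pi>) ends above
  0.\<close>

lemma rot_gt: "rot T q \<alpha> > - pi"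
proof -
  obtain j :: int where j: "0 \<le> \<alpha> + of_int j * pi" "\<alpha> + of_int j * pi < 0 + pi" by (rule mod_pi)
  obtain \<theta> where t: "prufer 0 T q \<theta>" "\<theta> 0 = \<alpha> + of_int j * pi" "\<theta> T = pangle T q (\<alpha> + of_int j * pi)" by (rule pangle_ex)
  have "\<theta> T > 0" using prufer_cross_pi[OF t(1) q, of 0 T 0] T j t by simp
  then have "rot T q (\<alpha> + of_int j * pi) > - pi" using j t by (simp add: rot_def)
  then show ?thesis by (simp add: rot_shift)
qed

lemma rot_rmax: "rot T q \<alpha> \<le> rmax T q" and rmax_attained: "\<exists>\<alpha>. rot T q \<alpha> = rmax T q"
  and rot_rmin: "rmin T q \<le> rot T q \<alpha>" and rmin_attained: "\<exists>\<alpha>. rot T q \<alpha> = rmin T q"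
proof -
  have c: "continuous_on {0..pi} (rot T q)" by (rule continuous_on_subset[OF rot_cont]) simp
  have ne: "{0..pi} \<noteq> {}" by simp
  have red: "\<exists>\<beta>\<in>{0..pi}. rot T q \<alpha> = rot T q \<beta>" for \<alpha>
  proof -
    obtain j :: int where j: "0 \<le> \<alpha> + of_int j * pi" "\<alpha> + of_int j * pi < 0 + pi" by (rule mod_pi)
    then show ?thesis using rot_shift by (intro bexI[of _ "\<alpha> + of_int j * pi"]) auto
  qed
  obtain x where x: "x \<in> {0..pi}" "\<forall>y\<in>{0..pi}. rot T q y \<le> rot T q x"
    using continuous_attains_sup[OF compact_Icc ne c] by blast
  obtain z where z: "z \<in> {0..pi}" "\<forall>y\<in>{0..pi}. rot T q z \<le> rot T q y"
    using continuous_attains_inf[OF compact_Icc ne c] by blast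
  have "rmax T q = rot T q x" unfolding rmax_def
    by (rule cSup_eq_maximum) (use x in auto)
  moreover have "rmin T q = rot T q z" unfolding rmin_def
    by (rule cInf_eq_minimum) (use z in auto)
  ultimately show "rot T q \<alpha> \<le> rmax T q" "\<exists>\<alpha>. rot T q \<alpha> = rmax T q"
     "rmin T q \<le> rot T q \<alpha>" "\<exists>\<alpha>. rot T q \<alpha> = rmin T q"
    using x z red[of \<alpha>] by auto
qed

lemma rmax_less: "rmax T q < rmin T q + pi"
  using rmax_attained rmin_attained rot_less by metis

lemma rmin_le_rmax: "rmin T q \<le> rmax T q"
  using rot_rmax rot_rmin order_trans by blast

text \<open>\<rho> \<alpha> is the factor by which the monodromy stretches the direction \<alpha>.
  It is continuous as the norm of a linear image of (sin \<alpha>, cos \<alpha>), and the last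
  identity is conservation of the Wronskian, that is, determinant one.\<close>

lemma monodromy_polar:
  obtains \<rho> where "\<And>\<alpha>. \<rho> \<alpha> > 0" "continuous_on UNIV \<rho>"
    "\<And>\<alpha> c u v. hill_sol 0 T q u v \<Longrightarrow> u 0 = c * sin \<alpha> \<Longrightarrow> v 0 = c * cos \<alpha> \<Longrightarrow>
       u T = c * (\<rho> \<alpha> * sin (pangle T q \<alpha>)) \<and> v T = c * (\<rho> \<alpha> * cos (pangle T q \<alpha>))"
    "\<And>\<alpha> \<beta>. \<rho> \<alpha> * \<rho> \<beta> * sin (pangle T q \<alpha> - pangle T q \<beta>) = sin (\<alpha> - \<beta>)"
proof -
  have T0: "0 \<le> T" "T \<in> {0..T}" using T by auto
  have "\<exists>r u v. r > 0 \<and> hill_sol 0 T q u v \<and> u 0 = sin \<alpha> \<and> v 0 = cos \<alpha> \<and>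
      u T = r * sin (pangle T q \<alpha>) \<and> v T = r * cos (pangle T q \<alpha>)" for \<alpha>
  proof -
    obtain \<theta> where t: "prufer 0 T q \<theta>" "\<theta> 0 = \<alpha>" "\<theta> T = pangle T q \<alpha>" by (rule pangle_ex)
    obtain r where r: "\<forall>t. r t > 0" "r 0 = 1" "hill_sol 0 T q (\<lambda>t. r t * sin (\<theta> t)) (\<lambda>t. r t * cos (\<theta> t))"
      by (rule hill_sol_polar[OF t(1) q])
    show ?thesis using t r by (intro exI[of _ "r T"] exI[of _ "\<lambda>t. r t * sin (\<theta> t)"] exI[of _ "\<lambda>t. r t * cos (\<theta> t)"]) auto
  qed
  then obtain \<rho> U V where P: "\<And>\<alpha>. \<rho> \<alpha> > 0" "\<And>\<alpha>. hill_sol 0 T q (U \<alpha>) (V \<alpha>)"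
     "\<And>\<alpha>. U \<alpha> 0 = sin \<alpha>" "\<And>\<alpha>. V \<alpha> 0 = cos \<alpha>"
     "\<And>\<alpha>. U \<alpha> T = \<rho> \<alpha> * sin (pangle T q \<alpha>)" "\<And>\<alpha>. V \<alpha> T = \<rho> \<alpha> * cos (pangle T q \<alpha>)" by metis
  have comb: "U \<alpha> T = sin \<alpha> * U (pi/2) T + cos \<alpha> * U 0 T" "V \<alpha> T = sin \<alpha> * V (pi/2) T + cos \<alpha> * V 0 T" for \<alpha>
    using hill_sol_eq_comb[OF P(2)[of \<alpha>] P(2)[of "pi/2"] P(2)[of 0] q, of "sin \<alpha>" "cos \<alpha>" T] T0 by (auto simp: P(3,4))
  have sq: "\<rho> \<alpha> = sqrt ((U \<alpha> T)\<^sup>2 + (V \<alpha> T)\<^sup>2)" for \<alpha>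
  proof -
    have "(U \<alpha> T)\<^sup>2 + (V \<alpha> T)\<^sup>2 = (\<rho> \<alpha>)\<^sup>2 * ((sin (pangle T q \<alpha>))\<^sup>2 + (cos (pangle T q \<alpha>))\<^sup>2)"
      unfolding P(5,6) by (simp only: power_mult_distrib distrib_left)
    then show ?thesis using P(1)[of \<alpha>] by simp
  qed
  have "\<rho> = (\<lambda>\<alpha>. sqrt ((sin \<alpha> * U (pi/2) T + cos \<alpha> * U 0 T)\<^sup>2 + (sin \<alpha> * V (pi/2) T + cos \<alpha> * V 0 T)\<^sup>2))"
  proof
    show "\<rho> \<alpha> = sqrt ((sin \<alpha> * U (pi/2) T + cos \<alpha> * U 0 T)\<^sup>2 + (sin \<alpha> * V (pi/2) T + cos \<alpha> * V 0 T)\<^sup>2)" for \<alpha>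
      using sq[of \<alpha>] unfolding comb(1)[of \<alpha>] comb(2)[of \<alpha>] .
  qed
  note \<rho>_eq = this
  have c: "continuous_on UNIV \<rho>" by (subst \<rho>_eq) (intro continuous_intros)
  show thesis
  proof (rule that[OF P(1) c])
    fix \<alpha> c u v assume "hill_sol 0 T q u v" "u 0 = c * sin \<alpha>" "v 0 = c * cos \<alpha>"
    then show "u T = c * (\<rho> \<alpha> * sin (pangle T q \<alpha>)) \<and> v T = c * (\<rho> \<alpha> * cos (pangle T q \<alpha>))"
      using hill_sol_eq_comb[OF _ P(2)[of \<alpha>] P(2)[of \<alpha>] q, of u v c 0 T] T0 by (auto simp: P(3-6))
  next
    fix \<alpha> \<beta>
    have "U \<alpha> T * V \<beta> T - U \<beta> T * V \<alpha> T = sin (\<alpha> - \<beta>)"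
      using hill_sol_wronskian[OF P(2)[of \<alpha>] P(2)[of \<beta>] T0(2)] by (simp add: P(3,4) sin_diff mult.commute)
    then show "\<rho> \<alpha> * \<rho> \<beta> * sin (pangle T q \<alpha> - pangle T q \<beta>) = sin (\<alpha> - \<beta>)"
      unfolding P(5,6) by (simp add: sin_diff algebra_simps)
  qed
qed

text \<open>The rotation map \<open>\<alpha> \<mapsto> pangle \<alpha>\<close> has derivative \<open>1 / \<rho>\<^sup>2\<close>, because the flow preserves area,
  so \<open>\<rho> = 1\<close> at an extremum of \<open>rot\<close>.\<close>

lemma antisol_extremum:
  assumes odd: "odd (j::int)" "rot T q \<alpha> = of_int j * pi"
    and ext: "(\<forall>\<beta>. rot T q \<beta> \<le> rot T q \<alpha>) \<or> (\<forall>\<beta>. rot T q \<alpha> \<le> rot T q \<beta>)"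
  shows "\<exists>u v. antisol T q u v \<and> u 0 = sin \<alpha> \<and> v 0 = cos \<alpha>"
proof -
  obtain \<rho> where r: "\<And>\<alpha>. \<rho> \<alpha> > 0" "continuous_on UNIV \<rho>"
    and pol: "\<And>\<alpha> c u v. hill_sol 0 T q u v \<Longrightarrow> u 0 = c * sin \<alpha> \<Longrightarrow> v 0 = c * cos \<alpha> \<Longrightarrow>
       u T = c * (\<rho> \<alpha> * sin (pangle T q \<alpha>)) \<and> v T = c * (\<rho> \<alpha> * cos (pangle T q \<alpha>))"
    and w: "\<And>\<alpha> \<beta>. \<rho> \<alpha> * \<rho> \<beta> * sin (pangle T q \<alpha> - pangle T q \<beta>) = sin (\<alpha> - \<beta>)"
    by (rule monodromy_polar) (rule that; assumption)
  \<comment> \<open>By conservation of area f x = sin (x - \<alpha>) / sin (pangle x - pangle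
    \<alpha>) for x near \<alpha>. At a maximum of \<open>rot\<close> this is at least 1 on the
    right of \<alpha> and at most 1 on the left; at a minimum the sides are exchanged. Continuity
    gives \<rho>(\<alpha>)^2 = f \<alpha> = 1 without any differentiation.\<close>
  define f where "f x = \<rho> x * \<rho> \<alpha>" for x
  have fc: "isCont f \<alpha>" unfolding f_def
    using r(2) by (auto simp: continuous_on_eq_continuous_at intro!: continuous_intros)
  then have lim: "(f \<longlongrightarrow> f \<alpha>) (at_right \<alpha>)" "(f \<longlongrightarrow> f \<alpha>) (at_left \<alpha>)"
    by (auto simp: isCont_def filterlim_at_split)
  have P1: "f x * sin (pangle T q x - pangle T q \<alpha>) = sin (x - \<alpha>)" for x unfolding f_def by (rule w)
  have f0: "f x > 0" for x using r(1) by (simp add: f_def)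
  have near: "\<forall>\<^sub>F x in at \<alpha>. \<bar>pangle T q x - pangle T q \<alpha>\<bar> < pi/2"
  proof -
    have "isCont (\<lambda>x. rot T q x + x) \<alpha>"
      using rot_cont by (auto simp: continuous_on_eq_continuous_at intro!: continuous_intros)
    then have "((\<lambda>x. pangle T q x) \<longlongrightarrow> pangle T q \<alpha>) (at \<alpha>)" by (simp add: isCont_def rot_def)
    from tendstoD[OF this, of "pi/2"] show ?thesis by (simp add: dist_real_def)
  qed
  have key: "\<rho> \<alpha> = 1"
  proof -
    \<comment> \<open>Within a quarter turn sin is monotone, so inequalities between angle
      increments become inequalities between their sines.\<close>
    have mono: "sin x \<le> sin y \<longleftrightarrow> x \<le> y" if "\<bar>x\<bar> < pi/2" "\<bar>y\<bar> < pi/2" for x y :: real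
      by (rule sin_mono_le_eq) (use that in auto)
    have nr: "\<forall>\<^sub>F x in at \<alpha>. \<bar>x - \<alpha>\<bar> < pi/2"
      using eventually_at_ball[of "pi/2" \<alpha> UNIV] by (auto elim!: eventually_mono simp: dist_real_def abs_minus_commute)
    have rg: "pangle T q x - pangle T q \<alpha> = (x - \<alpha>) + (rot T q x - rot T q \<alpha>)" for x by (simp add: rot_def)
    have "\<forall>\<^sub>F x in at_right \<alpha>. \<alpha> < x" "\<forall>\<^sub>F x in at_left \<alpha>. x < \<alpha>"
      by (simp_all add: eventually_at_filter)
    moreover have "\<forall>\<^sub>F x in at_right \<alpha>. \<bar>x - \<alpha>\<bar> < pi/2" "\<forall>\<^sub>F x in at_left \<alpha>. \<bar>x - \<alpha>\<bar> < pi/2"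
      using nr unfolding eventually_at_split by simp_all
    moreover have "\<forall>\<^sub>F x in at_right \<alpha>. \<bar>pangle T q x - pangle T q \<alpha>\<bar> < pi/2"
      "\<forall>\<^sub>F x in at_left \<alpha>. \<bar>pangle T q x - pangle T q \<alpha>\<bar> < pi/2"
      using near unfolding eventually_at_split by simp_all
    ultimately have R: "\<forall>\<^sub>F x in at_right \<alpha>. \<bar>x - \<alpha>\<bar> < pi/2 \<and> \<bar>pangle T q x - pangle T q \<alpha>\<bar> < pi/2 \<and> \<alpha> < x"
      and L: "\<forall>\<^sub>F x in at_left \<alpha>. \<bar>x - \<alpha>\<bar> < pi/2 \<and> \<bar>pangle T q x - pangle T q \<alpha>\<bar> < pi/2 \<and> x < \<alpha>"
      by (simp_all add: eventually_conj_iff)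
    have ge: "f x \<ge> 1 \<longleftrightarrow> sin y \<le> sin d" if "f x * sin y = sin d" "sin d > 0" for x y d
      using that f0[of x] by (smt (verit, best) mult_le_cancel_right2 mult_less_cancel_right2 zero_less_mult_pos)
    have ge': "f x \<ge> 1 \<longleftrightarrow> sin d \<le> sin y" if "f x * sin y = sin d" "sin d < 0" for x y d
    proof -
      have "f x * (- sin y) = - sin d" using that by simp
      then have "f x * sin (-y) = sin (-d)" by simp
      from ge[OF this] that show ?thesis by simp
    qed
    have sp: "sin d > 0" if "0 < d" "\<bar>d\<bar> < pi/2" for d :: real using that by (intro sin_gt_zero) auto
    have sn: "sin d < 0" if "d < 0" "\<bar>d\<bar> < pi/2" for d :: real using sp[of "-d"] that by simp
    have "f \<alpha> = 1" using ext
    proof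
      assume M: "\<forall>\<beta>. rot T q \<beta> \<le> rot T q \<alpha>"
      have "\<forall>\<^sub>F x in at_right \<alpha>. 1 \<le> f x" using R
      proof eventually_elim
        case (elim x)
        then have "sin (pangle T q x - pangle T q \<alpha>) \<le> sin (x - \<alpha>)"
          using M[rule_format, of x] by (subst mono) (auto simp: rg)
        moreover have "sin (x - \<alpha>) > 0" by (rule sp) (use elim in auto)
        ultimately show ?case using ge[OF P1[of x]] by blast
      qed
      then have 1: "1 \<le> f \<alpha>" by (rule tendsto_lowerbound[OF lim(1)]) simp
      have "\<forall>\<^sub>F x in at_left \<alpha>. f x \<le> 1" using L
      proof eventually_elim
        case (elim x)
        then have "sin (pangle T q x - pangle T q \<alpha>) \<le> sin (x - \<alpha>)"
          using M[rule_format, of x] by (subst mono) (auto simp: rg)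
        then have "\<not> f x > 1" 
          using P1[of x] sn[of "x - \<alpha>"] elim f0[of x] 
          by (smt (verit, best) mult_le_cancel_right1 mult_less_cancel_right1)
        then show ?case by simp
      qed
      then have "f \<alpha> \<le> 1" by (rule tendsto_upperbound[OF lim(2)]) simp
      with 1 show ?thesis by simp
    next
      assume M: "\<forall>\<beta>. rot T q \<alpha> \<le> rot T q \<beta>"
      have "\<forall>\<^sub>F x in at_left \<alpha>. 1 \<le> f x" using L
      proof eventually_elim
        case (elim x)
        then have "sin (x - \<alpha>) \<le> sin (pangle T q x - pangle T q \<alpha>)"
          using M[rule_format, of x] by (subst mono) (auto simp: rg)
        moreover have "sin (x - \<alpha>) < 0" by (rule sn) (use elim in auto)
        ultimately show ?case using ge'[OF P1[of x]] by blast
      qed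
      then have 1: "1 \<le> f \<alpha>" by (rule tendsto_lowerbound[OF lim(2)]) simp
      have "\<forall>\<^sub>F x in at_right \<alpha>. f x \<le> 1" using R
      proof eventually_elim
        case (elim x)
        then have "sin (x - \<alpha>) \<le> sin (pangle T q x - pangle T q \<alpha>)"
          using M[rule_format, of x] by (subst mono) (auto simp: rg)
        then have "\<not> f x > 1" 
          using P1[of x] sp[of "x - \<alpha>"] elim f0[of x] 
          by (smt (verit, best) mult_le_cancel_right1 mult_less_cancel_right1)
        then show ?case by simp
      qed
      then have "f \<alpha> \<le> 1" by (rule tendsto_upperbound[OF lim(1)]) simp
      with 1 show ?thesis by simp
    qed
    then have "(\<rho> \<alpha> - 1) * (\<rho> \<alpha> + 1) = 0" by (simp add: f_def algebra_simps)
    then show ?thesis using r(1)[of \<alpha>] by simp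
  qed
  obtain u v where uv: "hill_sol 0 T q u v" "u 0 = sin \<alpha>" "v 0 = cos \<alpha>"
    using hill_sol_exists[OF q, of "sin \<alpha>" "cos \<alpha>"] T by auto
  have "pangle T q \<alpha> = \<alpha> + of_int j * pi" using odd(2) by (simp add: rot_def)
  then have "u T = - sin \<alpha> \<and> v T = - cos \<alpha>"
    using pol[OF uv(1), of 1 \<alpha>] uv key sin_cos_add_odd_pi[OF odd(1), of \<alpha>] by simp
  then show ?thesis using uv by (intro exI[of _ u] exI[of _ v]) (simp add: antisol_def)
qed

text \<open>Antiperiodicity says that the monodromy maps the direction \<alpha> to its opposite:
  comparing lengths gives \<rho> \<alpha> = 1, comparing directions gives an odd multiple of
  \<pi>.\<close>

lemma antisol_rot:
  assumes a: "antisol T q u v" and c: "u 0 = c * sin \<alpha>" "v 0 = c * cos \<alpha>" "c \<noteq> 0"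
  shows "\<exists>j::int. odd j \<and> rot T q \<alpha> = of_int j * pi"
proof -
  obtain \<rho> where r: "\<And>\<alpha>. \<rho> \<alpha> > 0" "continuous_on UNIV \<rho>"
    and pol: "\<And>\<alpha> c u v. hill_sol 0 T q u v \<Longrightarrow> u 0 = c * sin \<alpha> \<Longrightarrow> v 0 = c * cos \<alpha> \<Longrightarrow>
       u T = c * (\<rho> \<alpha> * sin (pangle T q \<alpha>)) \<and> v T = c * (\<rho> \<alpha> * cos (pangle T q \<alpha>))"
    and w: "\<And>\<alpha> \<beta>. \<rho> \<alpha> * \<rho> \<beta> * sin (pangle T q \<alpha> - pangle T q \<beta>) = sin (\<alpha> - \<beta>)"
    by (rule monodromy_polar) (rule that; assumption)
  have e: "u T = - u 0" "v T = - v 0" using a by (auto simp: antisol_def)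
  have 1: "\<rho> \<alpha> * sin (pangle T q \<alpha>) = - sin \<alpha>" "\<rho> \<alpha> * cos (pangle T q \<alpha>) = - cos \<alpha>"
  proof -
    have "u T = c * (\<rho> \<alpha> * sin (pangle T q \<alpha>)) \<and> v T = c * (\<rho> \<alpha> * cos (pangle T q \<alpha>))"
      by (rule pol) (use a c in \<open>auto simp: antisol_def\<close>)
    then have "c * (\<rho> \<alpha> * sin (pangle T q \<alpha>)) = c * (- sin \<alpha>)" "c * (\<rho> \<alpha> * cos (pangle T q \<alpha>)) = c * (- cos \<alpha>)"
      using e c(1,2) by simp_all
    then show "\<rho> \<alpha> * sin (pangle T q \<alpha>) = - sin \<alpha>" "\<rho> \<alpha> * cos (pangle T q \<alpha>) = - cos \<alpha>"
      using c(3) by (simp_all only: mult_cancel_left simp_thms)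
  qed
  have "(\<rho> \<alpha>)\<^sup>2 * ((sin (pangle T q \<alpha>))\<^sup>2 + (cos (pangle T q \<alpha>))\<^sup>2) = (\<rho> \<alpha> * sin (pangle T q \<alpha>))\<^sup>2 + (\<rho> \<alpha> * cos (pangle T q \<alpha>))\<^sup>2"
    by (simp only: power_mult_distrib distrib_left)
  also have "\<dots> = 1" unfolding 1 by simp
  finally have "\<rho> \<alpha> = 1" using r(1)[of \<alpha>] by (simp add: power2_eq_1_iff)
  then obtain j :: int where "odd j" "pangle T q \<alpha> = \<alpha> + of_int j * pi"
    using sin_cos_eq_neg_imp[of "pangle T q \<alpha>" \<alpha>] 1 by auto
  then show ?thesis by (auto simp: rot_def)
qed

text \<open>Two independent antiperiodic solutions make every rotation an odd multiple of \<open>\<pi>\<close>, and these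
  rotations differ by less than \<open>\<pi>\<close>.\<close>

lemma antisol_basis:
  assumes a: "antisol T q u1 v1" "antisol T q u2 v2" and d: "u1 0 * v2 0 - u2 0 * v1 0 \<noteq> 0"
  shows "rmin T q = rmax T q"
proof -
  have all: "\<exists>j::int. odd j \<and> rot T q \<alpha> = of_int j * pi" for \<alpha>
  proof -
    let ?D = "u1 0 * v2 0 - u2 0 * v1 0"
    \<comment> \<open>Coefficients by Cramer's rule for the initial vector (sin \<alpha>, cos
      \<alpha>), so that \<open>antisol_rot\<close> applies to every direction.\<close>
    define x where "x = (sin \<alpha> * v2 0 - u2 0 * cos \<alpha>) / ?D"
    define y where "y = (u1 0 * cos \<alpha> - sin \<alpha> * v1 0) / ?D"
    have "x * u1 0 + y * u2 0 = (sin \<alpha> * ?D) / ?D"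
      unfolding x_def y_def times_divide_eq_left add_divide_distrib[symmetric]
      by (rule arg_cong2[where f = "(/)"]) (auto simp: algebra_simps)
    moreover have "x * v1 0 + y * v2 0 = (cos \<alpha> * ?D) / ?D"
      unfolding x_def y_def times_divide_eq_left add_divide_distrib[symmetric]
      by (rule arg_cong2[where f = "(/)"]) (auto simp: algebra_simps)
    ultimately have "x * u1 0 + y * u2 0 = 1 * sin \<alpha>" "x * v1 0 + y * v2 0 = 1 * cos \<alpha>" using d by simp_all
    from antisol_rot[OF antisol_comb[OF a] this] show ?thesis by simp
  qed
  obtain \<alpha> where \<alpha>: "rot T q \<alpha> = rmax T q" using rmax_attained by blast
  obtain \<beta> where \<beta>: "rot T q \<beta> = rmin T q" using rmin_attained by blast
  obtain i :: int where i: "odd i" "rmax T q = of_int i * pi" using all[of \<alpha>] \<alpha> by auto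
  obtain j :: int where j: "odd j" "rmin T q = of_int j * pi" using all[of \<beta>] \<beta> by auto
  have "of_int i * pi < (of_int j + 1) * pi" "of_int j * pi \<le> of_int i * pi"
    using rmax_less rmin_le_rmax unfolding i j by (auto simp: algebra_simps)
  then have "i = j" by simp
  then show ?thesis using i j by simp
qed

text \<open>If rot \<alpha> were neither extreme, the intermediate value theorem on (\<alpha>,
  \<alpha> + \<pi>) would yield a second direction \<beta> with the same rotation. Determinant one
  then forces \<rho> \<beta> = 1, so \<beta> also starts an antiperiodic solution, and two
  independent ones make the rotation constant.\<close>

lemma antisol_imp_extremal:
  assumes a: "antisol T q u v" and nz: "u 0 \<noteq> 0 \<or> v 0 \<noteq> 0"
  shows "\<exists>i::nat. rmax T q = (2 * real i + 1) * pi \<or> rmin T q = (2 * real i + 1) * pi"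
proof -
  obtain c \<alpha> where c: "u 0 = c * sin \<alpha>" "v 0 = c * cos \<alpha>" by (rule polar_coords)
  then have c0: "c \<noteq> 0" using nz by auto
  obtain j :: int where j: "odd j" "rot T q \<alpha> = of_int j * pi" using antisol_rot[OF a c c0] by blast
  \<comment> \<open>An odd j above -1 is at least 1, hence of the form 2 i + 1 with a natural number
    i.\<close>
  have "of_int j * pi > (-1) * pi" using rot_gt[of \<alpha>] j by simp
  then have "j > -1" by (subst (asm) mult_less_cancel_right_pos) auto
  obtain k where k: "j = 2 * k + 1" using j(1) by (rule oddE)
  then have "k \<ge> 0" using \<open>j > -1\<close> by simp
  then obtain i :: nat where i: "j = 2 * int i + 1" using k nonneg_int_cases by blast
  have "rmax T q = rot T q \<alpha> \<or> rmin T q = rot T q \<alpha>"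
  proof (rule ccontr)
    assume n: "\<not> ?thesis"
    obtain b1 where b1: "rot T q b1 > rot T q \<alpha>"
      using n rmax_attained rot_rmax[of \<alpha>] by (metis order_less_le)
    obtain b2 where b2: "rot T q b2 < rot T q \<alpha>"
      using n rmin_attained rot_rmin[of \<alpha>] by (metis order_less_le)
    \<comment> \<open>Translation by a multiple of \<pi> moves any direction with a different
      rotation strictly inside (\<alpha>, \<alpha> + \<pi>).\<close>
    have shift: "\<exists>b'. \<alpha> < b' \<and> b' < \<alpha> + pi \<and> rot T q b' = rot T q b" if "rot T q b \<noteq> rot T q \<alpha>" for b
    proof -
      obtain k :: int where k: "\<alpha> \<le> b + of_int k * pi" "b + of_int k * pi < \<alpha> + pi" by (rule mod_pi)
      moreover have "b + of_int k * pi \<noteq> \<alpha>" using that rot_shift[of b k] by metis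
      ultimately show ?thesis using rot_shift[of b k] by (intro exI[of _ "b + of_int k * pi"]) auto
    qed
    obtain x where x: "\<alpha> < x" "x < \<alpha> + pi" "rot T q x > rot T q \<alpha>" using shift[of b1] b1 by auto
    obtain y where y: "\<alpha> < y" "y < \<alpha> + pi" "rot T q y < rot T q \<alpha>" using shift[of b2] b2 by auto
    have "rot T q \<alpha> \<in> rot T q ` {\<alpha><..<\<alpha> + pi}"
    proof -
      have "is_interval (rot T q ` {\<alpha><..<\<alpha> + pi})"
        unfolding is_interval_connected_1
        by (intro connected_continuous_image continuous_on_subset[OF rot_cont]) auto
      then show ?thesis
        unfolding is_interval_1 using x y
        by (meson greaterThanLessThan_iff imageI less_imp_le)
    qed
    then obtain \<beta> where \<beta>: "\<alpha> < \<beta>" "\<beta> < \<alpha> + pi" "rot T q \<beta> = rot T q \<alpha>" by auto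
    obtain \<rho> where r: "\<And>\<alpha>. \<rho> \<alpha> > 0" "continuous_on UNIV \<rho>"
      and pol: "\<And>\<alpha> c u v. hill_sol 0 T q u v \<Longrightarrow> u 0 = c * sin \<alpha> \<Longrightarrow> v 0 = c * cos \<alpha> \<Longrightarrow>
         u T = c * (\<rho> \<alpha> * sin (pangle T q \<alpha>)) \<and> v T = c * (\<rho> \<alpha> * cos (pangle T q \<alpha>))"
      and w: "\<And>\<alpha> \<beta>. \<rho> \<alpha> * \<rho> \<beta> * sin (pangle T q \<alpha> - pangle T q \<beta>) = sin (\<alpha> - \<beta>)"
      by (rule monodromy_polar) (rule that; assumption)
    have sb: "sin (\<beta> - \<alpha>) > 0" using \<beta> by (intro sin_gt_zero) auto
    have "pangle T q \<beta> - pangle T q \<alpha> = \<beta> - \<alpha>" using \<beta>(3) by (simp add: rot_def)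
    then have 1: "\<rho> \<beta> * \<rho> \<alpha> = 1" using w[of \<beta> \<alpha>] sb by simp
    have "u T = c * (\<rho> \<alpha> * sin (pangle T q \<alpha>)) \<and> v T = c * (\<rho> \<alpha> * cos (pangle T q \<alpha>))"
      using a c by (intro pol) (auto simp: antisol_def)
    moreover have p: "pangle T q \<alpha> = \<alpha> + of_int j * pi" "pangle T q \<beta> = \<beta> + of_int j * pi"
      using j \<beta>(3) by (auto simp: rot_def)
    ultimately have "c * sin \<alpha> * (1 - \<rho> \<alpha>) = 0" "c * cos \<alpha> * (1 - \<rho> \<alpha>) = 0"
      using a c sin_cos_add_odd_pi[OF j(1), of \<alpha>] by (auto simp: antisol_def algebra_simps)
    moreover have "sin \<alpha> \<noteq> 0 \<or> cos \<alpha> \<noteq> 0" using sin_zero_abs_cos_one[of \<alpha>] by auto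
    ultimately have "\<rho> \<alpha> = 1" using c0 by auto
    then have r1: "\<rho> \<beta> = 1" using 1 by simp
    obtain u2 v2 where uv: "hill_sol 0 T q u2 v2" "u2 0 = sin \<beta>" "v2 0 = cos \<beta>"
      using hill_sol_exists[OF q, of "sin \<beta>" "cos \<beta>"] T by auto
    have a2: "antisol T q u2 v2"
      using pol[OF uv(1), of 1 \<beta>] uv r1 sin_cos_add_odd_pi[OF j(1), of \<beta>] p by (simp add: antisol_def)
    have "u 0 * v2 0 - u2 0 * v 0 = - c * sin (\<beta> - \<alpha>)" by (simp add: c uv sin_diff algebra_simps)
    moreover have "- c * sin (\<beta> - \<alpha>) \<noteq> 0" using sb c0 by simp
    ultimately have "u 0 * v2 0 - u2 0 * v 0 \<noteq> 0" by (simp only: not_False_eq_True)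
    then have "rmin T q = rmax T q" by (rule antisol_basis[OF a a2])
    then show False using n rot_rmax[of \<alpha>] rot_rmin[of \<alpha>] by simp
  qed
  then show ?thesis using j(2) by (auto simp: i)
qed

lemma extremal_imp_antisol:
  assumes "rmax T q = (2 * real i + 1) * pi \<or> rmin T q = (2 * real i + 1) * pi"
  shows "\<exists>u v. antisol T q u v \<and> (u 0 \<noteq> 0 \<or> v 0 \<noteq> 0)"
proof -
  have "\<exists>\<alpha>. rot T q \<alpha> = (2 * real i + 1) * pi \<and> ((\<forall>\<beta>. rot T q \<beta> \<le> rot T q \<alpha>) \<or> (\<forall>\<beta>. rot T q \<alpha> \<le> rot T q \<beta>))"
    using assms rmax_attained rmin_attained rot_rmax rot_rmin by metis
  then obtain \<alpha> where \<alpha>: "rot T q \<alpha> = of_int (2 * int i + 1) * pi"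
    and e: "(\<forall>\<beta>. rot T q \<beta> \<le> rot T q \<alpha>) \<or> (\<forall>\<beta>. rot T q \<alpha> \<le> rot T q \<beta>)" by auto
  obtain u v where "antisol T q u v" "u 0 = sin \<alpha>" "v 0 = cos \<alpha>"
    using antisol_extremum[OF _ \<alpha> e] by auto
  moreover have "sin \<alpha> \<noteq> 0 \<or> cos \<alpha> \<noteq> 0" using sin_zero_abs_cos_one[of \<alpha>] by auto
  ultimately show ?thesis by metis
qed

text \<open>With constant rotation every direction is an extremum, so
  \<open>antisol_extremum\<close> applies to each.\<close>

lemma antisol_full:
  assumes e: "rmax T q = (2 * real i + 1) * pi" "rmin T q = rmax T q"
  shows "\<exists>u v. antisol T q u v \<and> u 0 = x \<and> v 0 = y"
proof -
  obtain c \<alpha> where c: "x = c * sin \<alpha>" "y = c * cos \<alpha>" by (rule polar_coords)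
  have const: "rot T q \<beta> = rmax T q" for \<beta> using rot_rmax[of \<beta>] rot_rmin[of \<beta>] e by simp
  have "rot T q \<alpha> = of_int (2 * int i + 1) * pi" using const e by simp
  then obtain u v where "antisol T q u v" "u 0 = sin \<alpha>" "v 0 = cos \<alpha>"
    using antisol_extremum[of "2 * int i + 1" \<alpha>] const by auto
  then show ?thesis using antisol_comb[of T q u v u v c 0] c by force
qed

end

subsection \<open>Dependence of the rotation on the potential\<close>

context
  fixes T :: real and q1 q2 :: "real \<Rightarrow> real"
  assumes T: "T > 0" and q1: "q1 absolutely_integrable_on {0..T}" and q2: "q2 absolutely_integrable_on {0..T}"
begin

lemma rot_diff_le:
  "\<bar>rot T q2 \<alpha> - rot T q1 \<alpha>\<bar> \<le> exp (2 * integral {0..T} (\<lambda>t. \<bar>q2 t - 1\<bar>)) * integral {0..T} (\<lambda>t. \<bar>q2 t - q1 t\<bar>)"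
proof -
  obtain \<theta> where t: "prufer 0 T q1 \<theta>" "\<theta> 0 = \<alpha>" "\<theta> T = pangle T q1 \<alpha>" by (rule pangle_ex[OF T q1])
  obtain \<phi> where p: "prufer 0 T q2 \<phi>" "\<phi> 0 = \<alpha>" "\<phi> T = pangle T q2 \<alpha>" by (rule pangle_ex[OF T q2])
  show ?thesis using prufer_lipschitz[OF t(1) p(1) _ q1 q2 order_refl] t p T by (simp add: rot_def)
qed

lemma rmax_diff_le:
  "\<bar>rmax T q2 - rmax T q1\<bar> \<le> exp (2 * integral {0..T} (\<lambda>t. \<bar>q2 t - 1\<bar>)) * integral {0..T} (\<lambda>t. \<bar>q2 t - q1 t\<bar>)"
proof -
  obtain x where x: "rot T q1 x = rmax T q1" using rmax_attained[OF T q1] by blast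
  obtain y where y: "rot T q2 y = rmax T q2" using rmax_attained[OF T q2] by blast
  show ?thesis
    using rot_diff_le[of x] rot_diff_le[of y] rot_rmax[OF T q1, of y] rot_rmax[OF T q2, of x] x y by linarith
qed

lemma rmin_diff_le:
  "\<bar>rmin T q2 - rmin T q1\<bar> \<le> exp (2 * integral {0..T} (\<lambda>t. \<bar>q2 t - 1\<bar>)) * integral {0..T} (\<lambda>t. \<bar>q2 t - q1 t\<bar>)"
proof -
  obtain x where x: "rot T q1 x = rmin T q1" using rmin_attained[OF T q1] by blast
  obtain y where y: "rot T q2 y = rmin T q2" using rmin_attained[OF T q2] by blast
  show ?thesis
    using rot_diff_le[of x] rot_diff_le[of y] rot_rmin[OF T q1, of y] rot_rmin[OF T q2, of x] x y by linarith
qed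

lemma rot_mono:
  assumes "\<And>t. t \<in> {0..T} \<Longrightarrow> q1 t \<le> q2 t"
  shows "rot T q1 \<alpha> \<le> rot T q2 \<alpha>"
    and "integral {0..T} (\<lambda>t. q2 t - q1 t) > 0 \<Longrightarrow> rot T q1 \<alpha> < rot T q2 \<alpha>"
proof -
  obtain \<theta> where t: "prufer 0 T q1 \<theta>" "\<theta> 0 = \<alpha>" "\<theta> T = pangle T q1 \<alpha>" by (rule pangle_ex[OF T q1])
  obtain \<phi> where p: "prufer 0 T q2 \<phi>" "\<phi> 0 = \<alpha>" "\<phi> T = pangle T q2 \<alpha>" by (rule pangle_ex[OF T q2])
  show "rot T q1 \<alpha> \<le> rot T q2 \<alpha>" 
    using prufer_mono(1)[OF t(1) p(1) _ q1 q2 assms] t p T by (simp add: rot_def)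
  show "integral {0..T} (\<lambda>t. q2 t - q1 t) > 0 \<Longrightarrow> rot T q1 \<alpha> < rot T q2 \<alpha>"
    using prufer_strict_mono_potential[OF t(1) p(1) _ q1 q2 assms] t p T by (simp add: rot_def)
qed

lemma rmax_mono:
  assumes "\<And>t. t \<in> {0..T} \<Longrightarrow> q1 t \<le> q2 t"
  shows "rmax T q1 \<le> rmax T q2"
    and "integral {0..T} (\<lambda>t. q2 t - q1 t) > 0 \<Longrightarrow> rmax T q1 < rmax T q2"
proof -
  obtain x where x: "rot T q1 x = rmax T q1" using rmax_attained[OF T q1] by blast
  show "rmax T q1 \<le> rmax T q2"
    using rot_mono(1)[OF assms, of x] x rot_rmax[OF T q2, of x] by simp
  show "integral {0..T} (\<lambda>t. q2 t - q1 t) > 0 \<Longrightarrow> rmax T q1 < rmax T q2"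
    using rot_mono(2)[OF assms, of x] x rot_rmax[OF T q2, of x] by simp
qed

lemma rmin_mono:
  assumes "\<And>t. t \<in> {0..T} \<Longrightarrow> q1 t \<le> q2 t"
  shows "rmin T q1 \<le> rmin T q2"
    and "integral {0..T} (\<lambda>t. q2 t - q1 t) > 0 \<Longrightarrow> rmin T q1 < rmin T q2"
proof -
  obtain x where x: "rot T q2 x = rmin T q2" using rmin_attained[OF T q2] by blast
  show "rmin T q1 \<le> rmin T q2"
    using rot_mono(1)[OF assms, of x] x rot_rmin[OF T q1, of x] by simp
  show "integral {0..T} (\<lambda>t. q2 t - q1 t) > 0 \<Longrightarrow> rmin T q1 < rmin T q2"
    using rot_mono(2)[OF assms, of x] x rot_rmin[OF T q1, of x] by simp
qed

end

section \<open>Continuity along segments of potentials\<close>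

text \<open>The constant may depend on the base point \<open>s\<close>, because the estimates for
  \<open>rmax\<close> and \<open>rmin\<close> involve the norm of one of the two potentials.\<close>

lemma continuous_if_lipschitz_at:
  fixes f :: "real \<Rightarrow> real"
  assumes "\<And>s x. \<bar>f s - f x\<bar> \<le> C s * \<bar>s - x\<bar>"
  shows "continuous_on UNIV f"
  unfolding continuous_on_eq_continuous_at[OF open_UNIV]
proof
  fix s
  have "((\<lambda>x. f x - f s) \<longlongrightarrow> 0) (at s)"
  proof (rule Lim_null_comparison)
    show "\<forall>\<^sub>F x in at s. norm (f x - f s) \<le> C s * \<bar>s - x\<bar>"
      using assms[of s] by (simp add: abs_minus_commute)
    have "((\<lambda>x. C s * \<bar>s - x\<bar>) \<longlongrightarrow> C s * \<bar>s - s\<bar>) (at s)" by (intro tendsto_intros)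
    then show "((\<lambda>x. C s * \<bar>s - x\<bar>) \<longlongrightarrow> 0) (at s)" by simp
  qed
  then show "isCont f s" unfolding isCont_def by (rule LIM_zero_cancel)
qed

context
  fixes T :: real and q d :: "real \<Rightarrow> real"
  assumes T: "T > 0" and q: "q absolutely_integrable_on {0..T}" and d: "d absolutely_integrable_on {0..T}"
begin

lemma path_abs_int: "(\<lambda>t. q t + s * d t) absolutely_integrable_on {0..T}"
  by (intro set_integral_add(1) q set_integrable_mult_right d)

lemma path_integral: "integral {0..T} (\<lambda>t. \<bar>(q t + s * d t) - (q t + x * d t)\<bar>) = integral {0..T} (\<lambda>t. \<bar>d t\<bar>) * \<bar>s - x\<bar>"
proof -
  have "\<bar>(q t + s * d t) - (q t + x * d t)\<bar> = \<bar>s - x\<bar> * \<bar>d t\<bar>" for t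
    by (simp add: abs_mult[symmetric] algebra_simps)
  then show ?thesis by (simp add: mult.commute)
qed

lemma rmax_path_cont: "continuous_on UNIV (\<lambda>s. rmax T (\<lambda>t. q t + s * d t))"
proof (rule continuous_if_lipschitz_at)
  fix s x
  show "\<bar>rmax T (\<lambda>t. q t + s * d t) - rmax T (\<lambda>t. q t + x * d t)\<bar>
    \<le> (exp (2 * integral {0..T} (\<lambda>t. \<bar>q t + s * d t - 1\<bar>)) * integral {0..T} (\<lambda>t. \<bar>d t\<bar>)) * \<bar>s - x\<bar>"
    using rmax_diff_le[OF T path_abs_int[of x] path_abs_int[of s]] unfolding path_integral by (simp add: mult.assoc)
qed

lemma rmin_path_cont: "continuous_on UNIV (\<lambda>s. rmin T (\<lambda>t. q t + s * d t))"
proof (rule continuous_if_lipschitz_at)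
  fix s x
  show "\<bar>rmin T (\<lambda>t. q t + s * d t) - rmin T (\<lambda>t. q t + x * d t)\<bar>
    \<le> (exp (2 * integral {0..T} (\<lambda>t. \<bar>q t + s * d t - 1\<bar>)) * integral {0..T} (\<lambda>t. \<bar>d t\<bar>)) * \<bar>s - x\<bar>"
    using rmin_diff_le[OF T path_abs_int[of x] path_abs_int[of s]] unfolding path_integral by (simp add: mult.assoc)
qed

end

section \<open>Absence of antiperiodic eigenvalues far below\<close>

text \<open>A vanishing \<open>u\<close> makes \<open>v\<close> constant and hence \<open>u\<close>
  affine with slope v 0, so both initial values are zero.\<close>

lemma hill_sol_nontrivial_iff:
  assumes h: "hill_sol 0 T q u v" and q: "q absolutely_integrable_on {0..T}" and T: "T > 0"
  shows "(\<exists>t\<in>{0..T}. u t \<noteq> 0) \<longleftrightarrow> u 0 \<noteq> 0 \<or> v 0 \<noteq> 0"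
proof
  show "\<exists>t\<in>{0..T}. u t \<noteq> 0 \<Longrightarrow> u 0 \<noteq> 0 \<or> v 0 \<noteq> 0" using hill_sol_zero[OF h q] by blast
  assume n: "u 0 \<noteq> 0 \<or> v 0 \<noteq> 0"
  show "\<exists>t\<in>{0..T}. u t \<noteq> 0"
  proof (rule ccontr)
    assume "\<not> ?thesis"
    then have z: "u t = 0" if "t \<in> {0..T}" for t using that by blast
    have iv: "indef_int 0 T v (\<lambda>t. 0)"
      by (rule indef_int_cong[OF conjunct2[OF h[unfolded hill_sol_def]]]) (auto simp: z)
    have vc: "v t = v 0" if "t \<in> {0..T}" for t using indef_intD[OF iv that] by simp
    have "indef_int 0 T u (\<lambda>t. v 0)"
      by (rule indef_int_cong[OF conjunct1[OF h[unfolded hill_sol_def]] refl]) (rule vc)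
    from indef_intD[OF this, of T] T have "u T = u 0 + T * v 0" by simp
    then have "v 0 = 0" using z[of 0] z[of T] T by simp
    then show False using n z[of 0] T by simp
  qed
qed

text \<open>Lower bound on the spectrum: multiply the equation by \<open>u\<close> and integrate; since \<open>u\<close> has a zero,
  \<open>B max u\<^sup>2 \<le> \<integral> 2 B \<bar>u u'\<bar> \<le> \<integral> u'\<^sup>2 + B\<^sup>2 u\<^sup>2\<close>.\<close>

lemma antisol_energy:
  assumes T: "T > 0" and b: "b absolutely_integrable_on {0..T}"
    and a: "antisol T (\<lambda>t. b t + \<mu>) u v" and nz: "u 0 \<noteq> 0 \<or> v 0 \<noteq> 0"
  shows "- \<mu> \<le> (integral {0..T} (\<lambda>t. \<bar>b t\<bar>))\<^sup>2"
proof (rule ccontr)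
  assume n: "\<not> ?thesis"
  define B where "B = integral {0..T} (\<lambda>t. \<bar>b t\<bar>)"
  have q: "(\<lambda>t. b t + \<mu>) absolutely_integrable_on {0..T}" by (intro set_integral_add(1) b abs_int_const)
  have ba: "(\<lambda>t. \<bar>b t\<bar>) absolutely_integrable_on {0..T}" by (rule abs_int_imp_abs[OF b])
  have B0: "B \<ge> 0" unfolding B_def by (rule integral_nonneg[OF abs_int_imp_int[OF ba]]) simp
  have h: "hill_sol 0 T (\<lambda>t. b t + \<mu>) u v" and bc: "u 0 + u T = 0" "v 0 + v T = 0" using a by (auto simp: antisol_def)
  have iu: "indef_int 0 T u v" and iv: "indef_int 0 T v (\<lambda>t. - ((b t + \<mu>) * u t))" using h by (auto simp: hill_sol_def)
  note uc = indef_int_cont[OF iu] and vc = indef_int_cont[OF iv]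
  have ai: "f absolutely_integrable_on {0..T}" if "continuous_on {0..T} f" for f :: "real \<Rightarrow> real"
    using that absolutely_integrable_continuous_real by blast
  have u2: "(\<lambda>t. (u t)\<^sup>2) absolutely_integrable_on {0..T}" and v2: "(\<lambda>t. (v t)\<^sup>2) absolutely_integrable_on {0..T}"
    by (intro ai continuous_intros uc vc)+
  have bu: "(\<lambda>t. b t * (u t)\<^sup>2) absolutely_integrable_on {0..T}"
    by (intro abs_int_mult_cont(1)[OF b] continuous_intros uc)
  \<comment> \<open>Integrates (u v)' over [0, T]; the boundary terms cancel because u and v both
    change sign.\<close>
  have e: "integral {0..T} (\<lambda>t. (v t)\<^sup>2) - integral {0..T} (\<lambda>t. b t * (u t)\<^sup>2) - \<mu> * integral {0..T} (\<lambda>t. (u t)\<^sup>2) = 0"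
  proof -
    have "indef_int 0 T (\<lambda>t. u t * v t) (\<lambda>t. (v t)\<^sup>2 - b t * (u t)\<^sup>2 - \<mu> * (u t)\<^sup>2)"
      by (rule indef_int_cong[OF indef_int_mult[OF iu iv]]) (auto simp: power2_eq_square algebra_simps)
    from indef_intD[OF this, of T] T
    have "u T * v T = u 0 * v 0 + integral {0..T} (\<lambda>t. (v t)\<^sup>2 - b t * (u t)\<^sup>2 - \<mu> * (u t)\<^sup>2)" by simp
    moreover have "u T * v T = u 0 * v 0"
    proof -
      have "u T = - u 0" "v T = - v 0" using bc by linarith+
      then show ?thesis by simp
    qed
    moreover have "integral {0..T} (\<lambda>t. (v t)\<^sup>2 - b t * (u t)\<^sup>2 - \<mu> * (u t)\<^sup>2)
      = integral {0..T} (\<lambda>t. (v t)\<^sup>2) - integral {0..T} (\<lambda>t. b t * (u t)\<^sup>2) - integral {0..T} (\<lambda>t. \<mu> * (u t)\<^sup>2)"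
      by (subst integral_diff_abs, (intro set_integral_diff(1) v2 bu set_integrable_mult_right u2)+)
        (subst integral_diff_abs, (intro v2 bu)+, simp)
    ultimately show ?thesis by simp
  qed
  \<comment> \<open>A zero exists because u T = - u 0.\<close>
  obtain z where z: "z \<in> {0..T}" "u z = 0"
  proof -
    have "\<exists>x\<ge>0. x \<le> T \<and> u x = 0"
    proof (cases "u 0 \<le> 0")
      case True
      then show ?thesis using IVT'[of u 0 0 T] uc bc T by auto
    next
      case False
      then show ?thesis using IVT2'[of u T 0 0] uc bc T by auto
    qed
    then show thesis using that by auto
  qed
  define W where "W = integral {0..T} (\<lambda>t. (v t)\<^sup>2) + B\<^sup>2 * integral {0..T} (\<lambda>t. (u t)\<^sup>2)"
  have bound: "B * (u x)\<^sup>2 \<le> W" if x: "x \<in> {0..T}" for x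
  proof -
    have i2: "indef_int 0 T (\<lambda>t. B * (u t * u t)) (\<lambda>t. B * (v t * u t + u t * v t))"
      by (intro indef_int_cmult indef_int_mult iu)
    have dom: "(\<lambda>t. (v t)\<^sup>2 + B\<^sup>2 * (u t)\<^sup>2) absolutely_integrable_on {0..T}"
      by (intro set_integral_add(1) v2 set_integrable_mult_right u2)
    have pt: "\<bar>B * (v t * u t + u t * v t)\<bar> \<le> (v t)\<^sup>2 + B\<^sup>2 * (u t)\<^sup>2" for t
    proof -
      have "0 \<le> (v t - B * u t)\<^sup>2" "0 \<le> (v t + B * u t)\<^sup>2" by simp_all
      then show ?thesis unfolding abs_le_iff power2_diff power2_sum by (simp add: power_mult_distrib algebra_simps)
    qed
    have "\<bar>integral {c..d} (\<lambda>t. B * (v t * u t + u t * v t))\<bar> \<le> W" if "0 \<le> c" "d \<le> T" for c d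
    proof -
      have "\<bar>integral {c..d} (\<lambda>t. B * (v t * u t + u t * v t))\<bar> \<le> integral {c..d} (\<lambda>t. (v t)\<^sup>2 + B\<^sup>2 * (u t)\<^sup>2)"
        by (rule abs_integral_le[OF abs_int_subinterval[OF indef_int_abs_int[OF i2] that] abs_int_subinterval[OF dom that] pt])
      also have "\<dots> \<le> integral {0..T} (\<lambda>t. (v t)\<^sup>2 + B\<^sup>2 * (u t)\<^sup>2)"
        by (rule integral_subset_le[OF _ abs_int_imp_int[OF abs_int_subinterval[OF dom that]] abs_int_imp_int[OF dom]]) (use that in auto)
      also have "\<dots> = W" unfolding W_def
        by (subst integral_add_abs[OF v2 set_integrable_mult_right[OF u2]]) simp
      finally show ?thesis .
    qed
    note ib = this
    show ?thesis
    proof (cases "z \<le> x")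
      case True
      have "B * (u x * u x) = B * (u z * u z) + integral {z..x} (\<lambda>t. B * (v t * u t + u t * v t))"
        by (rule indef_int_diff_eq[OF i2]) (use z x True in auto)
      moreover have "B * (u z * u z) = 0" using z by simp
      moreover have "\<bar>integral {z..x} (\<lambda>t. B * (v t * u t + u t * v t))\<bar> \<le> W" by (rule ib) (use z x in auto)
      ultimately show ?thesis unfolding power2_eq_square by linarith
    next
      case False
      have "B * (u z * u z) = B * (u x * u x) + integral {x..z} (\<lambda>t. B * (v t * u t + u t * v t))"
        by (rule indef_int_diff_eq[OF i2]) (use z x False in auto)
      moreover have "B * (u z * u z) = 0" using z by simp
      moreover have "\<bar>integral {x..z} (\<lambda>t. B * (v t * u t + u t * v t))\<bar> \<le> W" by (rule ib) (use z x in auto)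
      ultimately show ?thesis unfolding power2_eq_square by linarith
    qed
  qed
  have "integral {0..T} (\<lambda>t. b t * (u t)\<^sup>2) \<le> W"
  \<comment> \<open>The estimate divides by \<open>B\<close>; when B = 0, the crude bound by B times
    a bound of u^2 is already 0.\<close>
  proof (cases "B = 0")
    case False
    then have Bp: "B > 0" using B0 by simp
    have "b t * (u t)\<^sup>2 \<le> \<bar>b t\<bar> * (W / B)" if "t \<in> {0..T}" for t
    proof -
      have "b t * (u t)\<^sup>2 \<le> \<bar>b t\<bar> * (u t)\<^sup>2" by (intro mult_right_mono) auto
      also have "\<dots> \<le> \<bar>b t\<bar> * (W / B)"
        using bound[OF that] Bp by (intro mult_left_mono) (auto simp: pos_le_divide_eq mult.commute)
      finally show ?thesis .
    qed
    then have "integral {0..T} (\<lambda>t. b t * (u t)\<^sup>2) \<le> integral {0..T} (\<lambda>t. \<bar>b t\<bar> * (W / B))"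
      by (intro integral_mono_abs bu set_integrable_mult_left ba)
    also have "\<dots> = B * (W / B)" by (simp add: B_def)
    finally show ?thesis using Bp by simp
  next
    case True
    obtain M where M: "\<And>t. t \<in> {0..T} \<Longrightarrow> (u t)\<^sup>2 \<le> M"
    proof -
      have "bounded ((\<lambda>t. (u t)\<^sup>2) ` {0..T})"
        by (intro compact_imp_bounded compact_continuous_image continuous_intros uc) simp
      then obtain M where "\<forall>x\<in>(\<lambda>t. (u t)\<^sup>2) ` {0..T}. norm x \<le> M" unfolding bounded_iff by blast
      then show thesis by (intro that[of M]) auto
    qed
    have "b t * (u t)\<^sup>2 \<le> \<bar>b t\<bar> * M" if "t \<in> {0..T}" for t
    proof -
      have "b t * (u t)\<^sup>2 \<le> \<bar>b t\<bar> * (u t)\<^sup>2" by (intro mult_right_mono) auto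
      also have "\<dots> \<le> \<bar>b t\<bar> * M" by (intro mult_left_mono M that) simp
      finally show ?thesis .
    qed
    then have "integral {0..T} (\<lambda>t. b t * (u t)\<^sup>2) \<le> integral {0..T} (\<lambda>t. \<bar>b t\<bar> * M)"
      by (intro integral_mono_abs bu set_integrable_mult_left ba)
    also have "\<dots> = B * M" by (simp add: B_def)
    also have "\<dots> = 0" using True by simp
    also have "0 \<le> W" using bound[OF z(1)] z(2) by simp
    finally show ?thesis .
  qed
  \<comment> \<open>Together with the identity \<open>e\<close> the integrals of v^2 cancel, leaving
    a positive factor times the integral of u^2.\<close>
  then have "(- \<mu> - B\<^sup>2) * integral {0..T} (\<lambda>t. (u t)\<^sup>2) \<le> 0" using e by (simp add: W_def algebra_simps)
  moreover have "- \<mu> - B\<^sup>2 > 0" using n by (simp add: B_def)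
  ultimately have "integral {0..T} (\<lambda>t. (u t)\<^sup>2) \<le> 0" by (simp add: mult_le_0_iff)
  moreover have "integral {0..T} (\<lambda>t. (u t)\<^sup>2) \<ge> 0"
    by (rule integral_nonneg[OF abs_int_imp_int[OF u2]]) simp
  ultimately have "integral {0..T} (\<lambda>t. (u t)\<^sup>2) = 0" by simp
  then have "\<forall>t\<in>{0..T}. (u t)\<^sup>2 = 0"
    by (subst (asm) integral_eq_0_iff) (use T in \<open>auto intro!: continuous_intros uc\<close>)
  then have "\<not> (\<exists>t\<in>{0..T}. u t \<noteq> 0)" by simp
  then show False using hill_sol_nontrivial_iff[OF h q T] nz by simp
qed

text \<open>The angle of the constant solution u = 1; it serves as a barrier for negative
  potentials.\<close>

lemma prufer_half_pi: "prufer a b (\<lambda>t. 0) (\<lambda>t. pi / 2)"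
  unfolding prufer_def using indef_int_const[of a b "pi/2"] by simp

text \<open>An angle starting in [-\<pi>/2, \<pi>/2) cannot pass the barrier \<pi>/2, so it gains
  less than \<pi>.\<close>

lemma rmax_negative_const:
  assumes T: "T > 0" and c: "c < 0"
  shows "rmax T (\<lambda>t. c) < pi"
proof -
  have "rot T (\<lambda>t. c) \<alpha> < pi" for \<alpha>
  proof -
    obtain j :: int where j: "- pi/2 \<le> \<alpha> + of_int j * pi" "\<alpha> + of_int j * pi < - pi/2 + pi" by (rule mod_pi)
    obtain \<theta> where t: "prufer 0 T (\<lambda>t. c) \<theta>" "\<theta> 0 = \<alpha> + of_int j * pi" "\<theta> T = pangle T (\<lambda>t. c) (\<alpha> + of_int j * pi)"
      by (rule pangle_ex[OF T abs_int_const])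
    have "\<theta> T < pi / 2"
      using prufer_mono(2)[OF t(1) prufer_half_pi _ abs_int_const abs_int_const] c j t T by simp
    then have "rot T (\<lambda>t. c) (\<alpha> + of_int j * pi) < pi" using j t by (simp add: rot_def)
    then show ?thesis by (simp add: rot_shift[OF T abs_int_const])
  qed
  moreover obtain \<alpha> where "rot T (\<lambda>t. c) \<alpha> = rmax T (\<lambda>t. c)" using rmax_attained[OF T abs_int_const] by blast
  ultimately show ?thesis by metis
qed

text \<open>The constant \<mu> is joined to \<open>a + \<mu>\<close> by scaling \<open>a\<close>
  with s in [0, 1]. If the maximal rotation went from below \<pi> to \<pi> or more, some s would
  give an antiperiodic solution, against the energy bound, which is uniform in s.\<close>

lemma rmax_low:
  assumes T: "T > 0" and a: "a absolutely_integrable_on {0..T}"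
  obtains \<mu> where "rmax T (\<lambda>t. a t + \<mu>) < pi"
proof -
  define A where "A = integral {0..T} (\<lambda>t. \<bar>a t\<bar>)"
  \<comment> \<open>One below the threshold - A^2 of the energy estimate, and negative even for A =
    0.\<close>
  define \<mu> where "\<mu> = - A\<^sup>2 - 1"
  have \<mu>0: "\<mu> < 0" unfolding \<mu>_def using zero_le_power2[of A] by linarith
  have aa: "(\<lambda>t. \<bar>a t\<bar>) absolutely_integrable_on {0..T}" by (rule abs_int_imp_abs[OF a])
  have A0: "A \<ge> 0" unfolding A_def by (rule integral_nonneg[OF abs_int_imp_int[OF aa]]) simp
  have "rmax T (\<lambda>t. a t + \<mu>) < pi"
  proof (rule ccontr)
    assume n: "\<not> ?thesis"
    let ?R = "\<lambda>s. rmax T (\<lambda>t. \<mu> + s * a t)"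
    have "\<exists>s\<ge>0. s \<le> 1 \<and> ?R s = pi"
    proof (rule IVT')
      show "?R 0 \<le> pi" using rmax_negative_const[OF T \<mu>0] by simp
      show "pi \<le> ?R 1" using n by (simp add: add.commute)
      show "continuous_on {0..1} ?R"
        by (rule continuous_on_subset[OF rmax_path_cont[OF T abs_int_const a]]) simp
    qed simp
    then obtain s where s: "0 \<le> s" "s \<le> 1" "?R s = pi" by blast
    have "\<exists>u v. antisol T (\<lambda>t. \<mu> + s * a t) u v \<and> (u 0 \<noteq> 0 \<or> v 0 \<noteq> 0)"
      by (rule extremal_imp_antisol[OF T path_abs_int[OF T abs_int_const a], where i = 0]) (simp add: s)
    then obtain u v where uv: "antisol T (\<lambda>t. s * a t + \<mu>) u v" "u 0 \<noteq> 0 \<or> v 0 \<noteq> 0" by (auto simp: add.commute)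
    have "- \<mu> \<le> (integral {0..T} (\<lambda>t. \<bar>s * a t\<bar>))\<^sup>2"
      by (rule antisol_energy[OF T _ uv]) (intro set_integrable_mult_right a)
    also have "integral {0..T} (\<lambda>t. \<bar>s * a t\<bar>) = s * A" using s by (simp add: abs_mult A_def)
    also have "(s * A)\<^sup>2 \<le> A\<^sup>2"
      using s A0 mult_left_le_one_le[of A s] by (intro power_mono) auto
    finally show False by (simp add: \<mu>_def)
  qed
  then show thesis by (rule that)
qed

subsection \<open>Counting antiperiodic eigenvalues\<close>

text \<open>The definition prescribes u'' only almost everywhere in the open interval; integrals
  ignore null sets, so u'' may be replaced by - q u. Conversely v is continuous, so u is
  differentiable at every point, one-sidedly at the ends.\<close>

lemma antiper_sol_iff_antisol:
  assumes T: "T > 0" and q: "q absolutely_integrable_on {0..T}"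
  shows "antiper_sol T q u v \<longleftrightarrow> antisol T q u v"
proof
  assume "antiper_sol T q u v"
  note A = this[unfolded antiper_sol_def]
  note d = A[THEN conjunct1] and bc = A[THEN conjunct2, THEN conjunct2, THEN conjunct1] A[THEN conjunct2, THEN conjunct2, THEN conjunct2]
  obtain w where W: "w absolutely_integrable_on {0..T} \<and> (\<forall>t\<in>{0..T}. v t = v 0 + integral {0..t} w) \<and>
      (AE t in lebesgue. t \<in> {0<..<T} \<longrightarrow> w t + q t * u t = 0)"
    by (rule A[THEN conjunct2, THEN conjunct1, THEN exE]) (rule that)
  note w = W[THEN conjunct1] W[THEN conjunct2, THEN conjunct1] and ae = W[THEN conjunct2, THEN conjunct2]
  have iw: "indef_int 0 T v w" by (rule indef_intI[OF w(1)]) (use w(2) in blast)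
  have iu: "indef_int 0 T u v" by (rule indef_int_C1) (use d indef_int_cont[OF iw] in auto)
  have qu: "(\<lambda>t. - (q t * u t)) absolutely_integrable_on {0..T}"
    using abs_int_mult_cont(1)[OF q indef_int_cont[OF iu]] by (simp add: set_integrable_def)
  have "negligible {t. \<not> (t \<in> {0<..<T} \<longrightarrow> w t + q t * u t = 0)}"
    using ae by (simp add: completion.AE_iff_null_sets negligible_iff_null_sets)
  then have N: "negligible ({t. \<not> (t \<in> {0<..<T} \<longrightarrow> w t + q t * u t = 0)} \<union> {0, T})" (is "negligible ?N")
    by (rule negligible_Un) simp
  have "v t = v 0 + integral {0..t} (\<lambda>t. - (q t * u t))" if t: "t \<in> {0..T}" for t
  proof -
    have "integral {0..t} w = integral {0..t} (\<lambda>t. - (q t * u t))"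
    proof (rule integral_spike[OF N])
      fix s assume "s \<in> {0..t} - ?N"
      then have "w s + q s * u s = 0" using t by auto
      then show "- (q s * u s) = w s" by linarith
    qed
    then show ?thesis using w(2) t by metis
  qed
  then have "indef_int 0 T v (\<lambda>t. - (q t * u t))" by (rule indef_intI[OF qu])
  then show "antisol T q u v" using iu bc by (simp add: antisol_def hill_sol_def)
next
  assume "antisol T q u v"
  then have iu: "indef_int 0 T u v" and iv: "indef_int 0 T v (\<lambda>t. - (q t * u t))"
    and bc: "u 0 + u T = 0" "v 0 + v T = 0" by (auto simp: antisol_def hill_sol_def)
  have d: "(u has_real_derivative v t) (at t within {0..T})" if t: "t \<in> {0..T}" for t
  proof -
    have "((\<lambda>x. u 0 + integral {0..x} v) has_real_derivative v t) (at t within {0..T})"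
      using integral_has_real_derivative[OF indef_int_cont[OF iv] t] by (auto intro!: derivative_eq_intros)
    moreover have "\<And>x. x \<in> {0..T} \<Longrightarrow> u x = u 0 + integral {0..x} v" by (rule indef_intD[OF iu])
    ultimately show ?thesis using t has_field_derivative_transform_within[of "\<lambda>x. u 0 + integral {0..x} v" "v t" t "{0..T}" 1 u]
      by (metis zero_less_one)
  qed
  show "antiper_sol T q u v" unfolding antiper_sol_def
  proof (intro conjI ballI exI)
    show "v t = v 0 + integral {0..t} (\<lambda>t. - (q t * u t))" if "t \<in> {0..T}" for t
      by (rule indef_intD[OF iv that])
  qed (use d bc indef_int_abs_int[OF iv] in auto)
qed

lemma nontriv_antiper_sol_iff:
  assumes T: "T > 0" and q: "q absolutely_integrable_on {0..T}"
  shows "nontriv_antiper_sol T q u v \<longleftrightarrow> antisol T q u v \<and> (u 0 \<noteq> 0 \<or> v 0 \<noteq> 0)"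
  using hill_sol_nontrivial_iff[OF _ q T, where u = u and v = v]
  unfolding nontriv_antiper_sol_def antiper_sol_iff_antisol[OF T q] by (auto simp: antisol_def)

lemma antisol_sum:
  fixes k :: nat
  assumes "\<And>i. i < k \<Longrightarrow> antisol T q (u i) (v i)" and T: "T > 0"
  shows "antisol T q (\<lambda>t. \<Sum>i<k. c i * u i t) (\<lambda>t. \<Sum>i<k. c i * v i t)"
  using assms(1)
proof (induction k)
  case 0
  have "indef_int 0 T (\<lambda>t. 0) (\<lambda>t. 0)" by (rule indef_int_const)
  then show ?case by (simp add: antisol_def hill_sol_def)
next
  case (Suc k)
  have "antisol T q (\<lambda>t. \<Sum>i<k. c i * u i t) (\<lambda>t. \<Sum>i<k. c i * v i t)" "antisol T q (u k) (v k)"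
    using Suc by auto
  from antisol_comb[OF this, of 1 "c k"] show ?case by simp
qed

section \<open>Linear dependence of initial vectors\<close>

lemma sum_supported:
  fixes k :: nat and f :: "nat \<Rightarrow> real"
  assumes "m \<le> k" "\<And>i. i \<ge> m \<Longrightarrow> f i = 0"
  shows "(\<Sum>i<k. f i) = (\<Sum>i<m. f i)"
  by (rule sum.mono_neutral_right) (use assms in auto)

lemma two_vectors_dependent:
  fixes x0 y0 x1 y1 :: real
  assumes "x0 * y1 - x1 * y0 = 0"
  shows "\<exists>p r. (p \<noteq> 0 \<or> r \<noteq> 0) \<and> p * x0 + r * x1 = 0 \<and> p * y0 + r * y1 = 0"
proof (cases "x0 = 0 \<and> y0 = 0")
  case True then show ?thesis by (intro exI[of _ 1] exI[of _ 0]) auto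
next
  case False
  show ?thesis
  proof (cases "x0 = 0")
    case True
    then show ?thesis using False assms by (intro exI[of _ y1] exI[of _ "-y0"]) (auto simp: algebra_simps)
  next
    case False
    then show ?thesis using assms by (intro exI[of _ x1] exI[of _ "-x0"]) (auto simp: algebra_simps)
  qed
qed

text \<open>If the first two vectors are independent, the coefficients are the 2 x 2 minors, i.e.
  the cross product of x and y. They are zero from index 3 on so that they also serve as
  coefficients for longer families.\<close>

lemma three_vectors_dependent:
  fixes x y :: "nat \<Rightarrow> real"
  shows "\<exists>c. (\<exists>i<3. c i \<noteq> 0) \<and> (\<forall>i\<ge>3. c i = 0) \<and> (\<Sum>i<3. c i * x i) = 0 \<and> (\<Sum>i<3. c i * y i) = 0"
proof -
  have e: "(\<Sum>i<3. f i) = f 0 + f 1 + f (2::nat)" for f :: "nat \<Rightarrow> real"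
    by (simp add: eval_nat_numeral)
  define c where "c p q r i = (if i = 0 then p else if i = 1 then q else if i = 2 then r else 0)" for p q r :: real and i :: nat
  have cz: "\<forall>i\<ge>3. c p q r i = 0" for p q r by (auto simp: c_def)
  have cv: "c p q r 0 = p" "c p q r 1 = q" "c p q r 2 = r" for p q r by (auto simp: c_def)
  show ?thesis
  proof (cases "x 0 * y 1 - x 1 * y 0 = 0")
    case True
    from two_vectors_dependent[OF this] obtain p r where pr: "p \<noteq> 0 \<or> r \<noteq> 0" "p * x 0 + r * x 1 = 0" "p * y 0 + r * y 1 = 0"
      by blast
    have "\<exists>i<3. c p r 0 i \<noteq> 0"
    proof (cases "p = 0")
      case True then show ?thesis using pr(1) by (intro exI[of _ 1]) (simp add: cv(2)[unfolded One_nat_def])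
    next
      case False then show ?thesis by (intro exI[of _ 0]) (simp add: cv)
    qed
    then show ?thesis using pr cz by (intro exI[of _ "c p r 0"]) (auto simp: e cv simp del: One_nat_def)
  next
    case False
    let ?c = "c (x 1 * y 2 - x 2 * y 1) (x 2 * y 0 - x 0 * y 2) (x 0 * y 1 - x 1 * y 0)"
    have "?c 2 \<noteq> 0" using False by (simp add: cv)
    then have "\<exists>i<3. ?c i \<noteq> 0" by (intro exI[of _ 2] conjI) simp_all
    then show ?thesis using cz by (intro exI[of _ ?c]) (auto simp: e cv algebra_simps simp del: One_nat_def)
  qed
qed

context
  fixes T :: real and a :: "real \<Rightarrow> real"
  assumes T: "T > 0" and a: "a absolutely_integrable_on {0..T}"
begin

lemma shifted_abs_int: "(\<lambda>t. \<mu> + a t) absolutely_integrable_on {0..T}"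
  by (intro set_integral_add(1) a abs_int_const)

lemma antiper_eigenvalue_iff:
  "antiper_eigenvalue T a \<mu> \<longleftrightarrow>
     (\<exists>i::nat. rmax T (\<lambda>t. \<mu> + a t) = (2 * real i + 1) * pi \<or> rmin T (\<lambda>t. \<mu> + a t) = (2 * real i + 1) * pi)"
proof
  assume "antiper_eigenvalue T a \<mu>"
  then obtain u v where "antisol T (\<lambda>t. \<mu> + a t) u v" "u 0 \<noteq> 0 \<or> v 0 \<noteq> 0"
    unfolding antiper_eigenvalue_def nontriv_antiper_sol_iff[OF T shifted_abs_int] by blast
  then show "\<exists>i::nat. rmax T (\<lambda>t. \<mu> + a t) = (2 * real i + 1) * pi \<or> rmin T (\<lambda>t. \<mu> + a t) = (2 * real i + 1) * pi"
    by (rule antisol_imp_extremal[OF T shifted_abs_int])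
next
  assume "\<exists>i::nat. rmax T (\<lambda>t. \<mu> + a t) = (2 * real i + 1) * pi \<or> rmin T (\<lambda>t. \<mu> + a t) = (2 * real i + 1) * pi"
  then obtain i :: nat where "rmax T (\<lambda>t. \<mu> + a t) = (2 * real i + 1) * pi \<or> rmin T (\<lambda>t. \<mu> + a t) = (2 * real i + 1) * pi" by blast
  from extremal_imp_antisol[OF T shifted_abs_int this]
  show "antiper_eigenvalue T a \<mu>"
    unfolding antiper_eigenvalue_def nontriv_antiper_sol_iff[OF T shifted_abs_int] .
qed

text \<open>The upper bound for \<open>GREATEST\<close>: a combination with vanishing initial data
  vanishes on [0, T], so m + 1 solutions with dependent initial vectors are dependent, and any
  longer family contains such m + 1.\<close>

lemma antiper_mult_eqI:
  fixes m :: nat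
  assumes ex: "\<exists>u v. (\<forall>i<m. antisol T (\<lambda>t. \<mu> + a t) (u i) (v i)) \<and>
      (\<forall>c :: nat \<Rightarrow> real. (\<forall>t\<in>{0..T}. (\<Sum>i<m. c i * u i t) = 0) \<longrightarrow> (\<forall>i<m. c i = 0))"
    and dep: "\<And>u v. (\<forall>i<Suc m. antisol T (\<lambda>t. \<mu> + a t) (u i) (v i)) \<Longrightarrow>
      \<exists>c. (\<exists>i<Suc m. c i \<noteq> 0) \<and> (\<forall>i\<ge>Suc m. c i = 0) \<and> (\<Sum>i<Suc m. c i * u i 0) = 0 \<and> (\<Sum>i<Suc m. c i * v i 0) = 0"
  shows "antiper_mult T a \<mu> = m"
  unfolding antiper_mult_def antiper_sol_iff_antisol[OF T shifted_abs_int]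
proof (rule Greatest_equality)
  show "\<exists>u v. (\<forall>i<m. antisol T (\<lambda>t. \<mu> + a t) (u i) (v i)) \<and>
      (\<forall>c :: nat \<Rightarrow> real. (\<forall>t\<in>{0..T}. (\<Sum>i<m. c i * u i t) = 0) \<longrightarrow> (\<forall>i<m. c i = 0))"
    by (rule ex)
next
  fix k :: nat
  assume "\<exists>u v. (\<forall>i<k. antisol T (\<lambda>t. \<mu> + a t) (u i) (v i)) \<and>
      (\<forall>c :: nat \<Rightarrow> real. (\<forall>t\<in>{0..T}. (\<Sum>i<k. c i * u i t) = 0) \<longrightarrow> (\<forall>i<k. c i = 0))"
  then obtain u v where uv: "\<And>i. i < k \<Longrightarrow> antisol T (\<lambda>t. \<mu> + a t) (u i) (v i)"
    and ind: "\<And>c :: nat \<Rightarrow> real. (\<forall>t\<in>{0..T}. (\<Sum>i<k. c i * u i t) = 0) \<Longrightarrow> (\<forall>i<k. c i = 0)" by blast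
  show "k \<le> m"
  proof (rule ccontr)
    assume "\<not> k \<le> m"
    then have km: "Suc m \<le> k" by simp
    then obtain c where c: "\<exists>i<Suc m. c i \<noteq> 0" "\<forall>i\<ge>Suc m. c i = 0" "(\<Sum>i<Suc m. c i * u i 0) = 0" "(\<Sum>i<Suc m. c i * v i 0) = 0"
      using dep[of u v] uv by auto
    have s: "(\<Sum>i<k. c i * f i) = (\<Sum>i<Suc m. c i * f i)" for f :: "nat \<Rightarrow> real"
      by (rule sum_supported[OF km]) (use c(2) in auto)
    have h: "hill_sol 0 T (\<lambda>t. \<mu> + a t) (\<lambda>t. \<Sum>i<k. c i * u i t) (\<lambda>t. \<Sum>i<k. c i * v i t)"
      using antisol_sum[OF uv T] by (simp add: antisol_def)
    have "(\<Sum>i<k. c i * u i t) = 0" if "t \<in> {0..T}" for t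
      using hill_sol_zero[OF h shifted_abs_int _ _ that] c(3,4) by (simp only: s)
    then have "\<forall>i<k. c i = 0" by (intro ind) blast
    then show False using c(1) km by auto
  qed
qed

lemma antiper_mult_double:
  assumes e: "rmax T (\<lambda>t. \<mu> + a t) = (2 * real i + 1) * pi" "rmin T (\<lambda>t. \<mu> + a t) = rmax T (\<lambda>t. \<mu> + a t)"
  shows "antiper_mult T a \<mu> = 2"
proof (rule antiper_mult_eqI)
  obtain u0 v0 where 0: "antisol T (\<lambda>t. \<mu> + a t) u0 v0" "u0 0 = 1" "v0 0 = 0"
    using antisol_full[OF T shifted_abs_int e, of 1 0] by blast
  obtain u1 v1 where 1: "antisol T (\<lambda>t. \<mu> + a t) u1 v1" "u1 0 = 0" "v1 0 = 1"
    using antisol_full[OF T shifted_abs_int e, of 0 1] by blast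
  obtain z where z: "z \<in> {0..T}" "u1 z \<noteq> 0"
    using hill_sol_nontrivial_iff[OF _ shifted_abs_int[of \<mu>] T, where u = u1 and v = v1] 1 by (auto simp: antisol_def)
  have e2: "(\<Sum>i<2. f i) = f 0 + f (1::nat)" for f :: "nat \<Rightarrow> real" by (simp add: eval_nat_numeral)
  show "\<exists>u v. (\<forall>i<2. antisol T (\<lambda>t. \<mu> + a t) (u i) (v i)) \<and>
      (\<forall>c :: nat \<Rightarrow> real. (\<forall>t\<in>{0..T}. (\<Sum>i<2. c i * u i t) = 0) \<longrightarrow> (\<forall>i<2. c i = 0))"
  proof (intro exI conjI allI impI)
    let ?u = "\<lambda>i::nat. if i = 0 then u0 else u1" and ?v = "\<lambda>i::nat. if i = 0 then v0 else v1"
    show "antisol T (\<lambda>t. \<mu> + a t) (?u i) (?v i)" for i using 0 1 by simp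
    fix c :: "nat \<Rightarrow> real" and i :: nat assume c: "\<forall>t\<in>{0..T}. (\<Sum>i<2. c i * ?u i t) = 0" and "i < 2"
    have c': "c 0 * u0 t + c 1 * u1 t = 0" if "t \<in> {0..T}" for t using c[rule_format, OF that] by (simp add: e2)
    \<comment> \<open>Evaluation at 0 isolates the first coefficient, evaluation at a point where u1
      is nonzero the second.\<close>
    have "c 0 = 0" using c'[of 0] 0 1 T by simp
    moreover have "c 1 = 0" using c'[OF z(1)] z(2) \<open>c 0 = 0\<close> by simp
    ultimately show "c i = 0" using \<open>i < 2\<close> by (auto simp: less_2_cases_iff)
  qed
next
  show "\<exists>c. (\<exists>i<Suc 2. c i \<noteq> 0) \<and> (\<forall>i\<ge>Suc 2. c i = 0) \<and> (\<Sum>i<Suc 2. c i * u i 0) = 0 \<and> (\<Sum>i<Suc 2. c i * v i 0) = 0"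
    for u v :: "nat \<Rightarrow> real \<Rightarrow> real"
    using three_vectors_dependent[of "\<lambda>i. u i 0" "\<lambda>i. v i 0"] by (simp add: numeral_3_eq_3 numeral_2_eq_2)
qed

text \<open>Two independent antiperiodic solutions would make the rotation constant, so here the
  initial vectors of any two have determinant zero.\<close>

lemma antiper_mult_simple:
  assumes e: "rmax T (\<lambda>t. \<mu> + a t) = (2 * real i + 1) * pi \<or> rmin T (\<lambda>t. \<mu> + a t) = (2 * real i + 1) * pi"
    and ne: "rmin T (\<lambda>t. \<mu> + a t) \<noteq> rmax T (\<lambda>t. \<mu> + a t)"
  shows "antiper_mult T a \<mu> = 1"
proof (rule antiper_mult_eqI)
  obtain u v where uv: "antisol T (\<lambda>t. \<mu> + a t) u v" "u 0 \<noteq> 0 \<or> v 0 \<noteq> 0"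
    using extremal_imp_antisol[OF T shifted_abs_int e] by blast
  obtain z where z: "z \<in> {0..T}" "u z \<noteq> 0"
    using hill_sol_nontrivial_iff[OF _ shifted_abs_int[of \<mu>] T, where u = u and v = v] uv by (auto simp: antisol_def)
  show "\<exists>u v. (\<forall>i<1. antisol T (\<lambda>t. \<mu> + a t) (u i) (v i)) \<and>
      (\<forall>c :: nat \<Rightarrow> real. (\<forall>t\<in>{0..T}. (\<Sum>i<1. c i * u i t) = 0) \<longrightarrow> (\<forall>i<1. c i = 0))"
    using uv z by (intro exI[of _ "\<lambda>i. u"] exI[of _ "\<lambda>i. v"]) auto
next
  fix u v :: "nat \<Rightarrow> real \<Rightarrow> real"
  assume A: "\<forall>i<Suc 1. antisol T (\<lambda>t. \<mu> + a t) (u i) (v i)"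
  have "u 0 0 * v 1 0 - u 1 0 * v 0 0 = 0"
    using antisol_basis[OF T shifted_abs_int, of \<mu> "u 0" "v 0" "u 1" "v 1"] A ne by fastforce
  from two_vectors_dependent[OF this] obtain p r
    where pr: "p \<noteq> 0 \<or> r \<noteq> 0" "p * u 0 0 + r * u 1 0 = 0" "p * v 0 0 + r * v 1 0 = 0" by blast
  have e2: "(\<Sum>i<Suc 1. f i) = f 0 + f (1::nat)" for f :: "nat \<Rightarrow> real" by simp
  show "\<exists>c. (\<exists>i<Suc 1. c i \<noteq> 0) \<and> (\<forall>i\<ge>Suc 1. c i = 0) \<and> (\<Sum>i<Suc 1. c i * u i 0) = 0 \<and> (\<Sum>i<Suc 1. c i * v i 0) = 0"
    unfolding e2 by (rule exI[of _ "\<lambda>i. if i = 0 then p else if i = 1 then r else 0"]) (use pr in auto)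
qed

end

section \<open>Counting the levels of an increasing function\<close>

text \<open>The indices form an initial segment of the natural numbers, so the count exceeds k
  exactly when the level with index k, counted from 0, does not exceed x.\<close>

lemma odd_multiples_below:
  fixes x :: real
  shows "finite {i::nat. (2 * real i + 1) * pi \<le> x}" and
    "k < card {i::nat. (2 * real i + 1) * pi \<le> x} \<longleftrightarrow> (2 * real k + 1) * pi \<le> x"
proof -
  define M where "M = (LEAST i. \<not> (2 * real i + 1) * pi \<le> x)"
  have "\<exists>i. \<not> (2 * real i + 1) * pi \<le> x"
  proof -
    obtain i :: nat where "x / pi < real i" using reals_Archimedean2 by blast
    then have "x < real i * pi" by (simp add: pos_divide_less_eq)
    also have "\<dots> \<le> (2 * real i + 1) * pi" by (intro mult_right_mono) auto
    finally show ?thesis by (intro exI[of _ i]) simp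
  qed
  then have M: "\<not> (2 * real M + 1) * pi \<le> x" unfolding M_def by (rule LeastI_ex)
  have "i < M \<longleftrightarrow> (2 * real i + 1) * pi \<le> x" for i
  proof
    show "i < M \<Longrightarrow> (2 * real i + 1) * pi \<le> x" unfolding M_def using not_less_Least by blast
    assume h: "(2 * real i + 1) * pi \<le> x"
    show "i < M"
    proof (rule ccontr)
      assume "\<not> i < M"
      then have "(2 * real M + 1) * pi \<le> (2 * real i + 1) * pi" by (intro mult_right_mono) auto
      then show False using M h by linarith
    qed
  qed
  then have *: "{i::nat. (2 * real i + 1) * pi \<le> x} = {..<M}" "k < M \<longleftrightarrow> (2 * real k + 1) * pi \<le> x" by auto
  then show "finite {i::nat. (2 * real i + 1) * pi \<le> x}"
    "k < card {i::nat. (2 * real i + 1) * pi \<le> x} \<longleftrightarrow> (2 * real k + 1) * pi \<le> x" by simp_all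
qed

text \<open>Starting below the first level \<pi>, a continuous strictly increasing function takes
  each level up to R \<mu> exactly once, and it does so at points up to \<mu>.\<close>

lemma card_levels:
  fixes R :: "real \<Rightarrow> real"
  assumes c: "continuous_on UNIV R" and s: "strict_mono R" and low: "R \<mu>0 < pi"
  shows "finite {\<nu>. (\<exists>i::nat. R \<nu> = (2 * real i + 1) * pi) \<and> \<nu> \<le> \<mu>}"
    and "card {\<nu>. (\<exists>i::nat. R \<nu> = (2 * real i + 1) * pi) \<and> \<nu> \<le> \<mu>} = card {i::nat. (2 * real i + 1) * pi \<le> R \<mu>}"
proof -
  let ?I = "{i::nat. (2 * real i + 1) * pi \<le> R \<mu>}"
  define g where "g i = (THE \<nu>. R \<nu> = (2 * real i + 1) * pi)" for i :: nat
  have g: "g i = \<nu>" if "R \<nu> = (2 * real i + 1) * pi" for i \<nu>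
    unfolding g_def
  proof (rule the_equality)
    show "R \<nu> = (2 * real i + 1) * pi" by (rule that)
    fix x assume "R x = (2 * real i + 1) * pi"
    then have "R x = R \<nu>" using that by simp
    then show "x = \<nu>" by (simp only: strict_mono_eq[OF s])
  qed
  have ex: "\<exists>\<nu>. R \<nu> = (2 * real i + 1) * pi" if "i \<in> ?I" for i
  proof -
    have "\<mu>0 \<le> \<mu>"
    proof (rule ccontr)
      assume "\<not> \<mu>0 \<le> \<mu>"
      then have "R \<mu> < R \<mu>0" using s by (auto simp: strict_mono_def)
      moreover have "pi \<le> (2 * real i + 1) * pi" using mult_right_mono[of 1 "2 * real i + 1" pi] by simp
      moreover have "(2 * real i + 1) * pi \<le> R \<mu>" using that by simp
      ultimately show False using low by linarith
    qed
    moreover have "pi \<le> (2 * real i + 1) * pi" using mult_right_mono[of 1 "2 * real i + 1" pi] by simp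
    moreover have "(2 * real i + 1) * pi \<le> R \<mu>" using that by simp
    ultimately have "\<exists>x\<ge>\<mu>0. x \<le> \<mu> \<and> R x = (2 * real i + 1) * pi"
      using low by (intro IVT' continuous_on_subset[OF c]) (linarith | simp)+
    then show ?thesis by blast
  qed
  have "bij_betw g ?I {\<nu>. (\<exists>i::nat. R \<nu> = (2 * real i + 1) * pi) \<and> \<nu> \<le> \<mu>}"
    unfolding bij_betw_def
  proof
    show "inj_on g ?I"
    proof (rule inj_onI)
      fix i j assume "i \<in> ?I" "j \<in> ?I" and e: "g i = g j"
      obtain x where x: "R x = (2 * real i + 1) * pi" using ex[OF \<open>i \<in> ?I\<close>] by blast
      obtain y where y: "R y = (2 * real j + 1) * pi" using ex[OF \<open>j \<in> ?I\<close>] by blast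
      have "x = y" using g[OF x] g[OF y] e by simp
      then have "(2 * real i + 1) * pi = (2 * real j + 1) * pi" using x y by simp
      then show "i = j" by simp
    qed
    show "g ` ?I = {\<nu>. (\<exists>i::nat. R \<nu> = (2 * real i + 1) * pi) \<and> \<nu> \<le> \<mu>}"
    proof (intro equalityI subsetI)
      fix x assume "x \<in> g ` ?I"
      then obtain i where i: "i \<in> ?I" "x = g i" by blast
      then obtain \<nu> where \<nu>: "R \<nu> = (2 * real i + 1) * pi" using ex by blast
      then have "R \<nu> \<le> R \<mu>" using i by simp
      then have "\<nu> \<le> \<mu>" using strict_mono_less_eq[OF s] by simp
      then show "x \<in> {\<nu>. (\<exists>i::nat. R \<nu> = (2 * real i + 1) * pi) \<and> \<nu> \<le> \<mu>}" using i \<nu> g[OF \<nu>] by blast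
    next
      fix x assume "x \<in> {\<nu>. (\<exists>i::nat. R \<nu> = (2 * real i + 1) * pi) \<and> \<nu> \<le> \<mu>}"
      then obtain i :: nat where i: "R x = (2 * real i + 1) * pi" "x \<le> \<mu>" by blast
      have "R x \<le> R \<mu>" using i(2) by (simp only: strict_mono_less_eq[OF s])
      then have "i \<in> ?I" using i(1) by simp
      then show "x \<in> g ` ?I" using g[OF i(1)] by (intro image_eqI[of _ _ i]) simp_all
    qed
  qed
  then show "finite {\<nu>. (\<exists>i::nat. R \<nu> = (2 * real i + 1) * pi) \<and> \<nu> \<le> \<mu>}"
    "card {\<nu>. (\<exists>i::nat. R \<nu> = (2 * real i + 1) * pi) \<and> \<nu> \<le> \<mu>} = card ?I"
    using odd_multiples_below(1)[of "R \<mu>"] bij_betw_finite[of g ?I] bij_betw_same_card[of g ?I] by simp_all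
qed

section \<open>The ordered antiperiodic eigenvalues\<close>

context
  fixes T :: real and a :: "real \<Rightarrow> real"
  assumes T: "T > 0" and a: "a absolutely_integrable_on {0..T}"
begin

lemma shift_cont:
  "continuous_on UNIV (\<lambda>\<mu>. rmax T (\<lambda>t. \<mu> + a t))" "continuous_on UNIV (\<lambda>\<mu>. rmin T (\<lambda>t. \<mu> + a t))"
  using rmax_path_cont[OF T a abs_int_const[where c = 1]] rmin_path_cont[OF T a abs_int_const[where c = 1]]
  by (simp_all add: add.commute)

lemma shift_strict_mono:
  "strict_mono (\<lambda>\<mu>. rmax T (\<lambda>t. \<mu> + a t))" "strict_mono (\<lambda>\<mu>. rmin T (\<lambda>t. \<mu> + a t))"
  using rmax_mono(2)[OF T shifted_abs_int[OF T a] shifted_abs_int[OF T a]]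
    rmin_mono(2)[OF T shifted_abs_int[OF T a] shifted_abs_int[OF T a]] T
  by (auto simp: strict_mono_def)

lemma shift_low:
  obtains \<mu> where "rmax T (\<lambda>t. \<mu> + a t) < pi" "rmin T (\<lambda>t. \<mu> + a t) < pi"
proof -
  obtain \<mu> where "rmax T (\<lambda>t. a t + \<mu>) < pi" by (rule rmax_low[OF T a])
  then show thesis using rmin_le_rmax[OF T shifted_abs_int[OF T a], of \<mu>]
    by (intro that[of \<mu>]) (simp_all add: add.commute)
qed

text \<open>The multiplicity at \<nu> is the number of functions among \<open>rmax\<close> and
  \<open>rmin\<close> that meet an odd multiple of \<pi> there, so the sum splits into two level
  counts.\<close>

lemma sum_mult_eq:
  "(\<Sum>\<nu> | antiper_eigenvalue T a \<nu> \<and> \<nu> \<le> \<mu>. antiper_mult T a \<nu>) =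
     card {i::nat. (2 * real i + 1) * pi \<le> rmax T (\<lambda>t. \<mu> + a t)} +
     card {i::nat. (2 * real i + 1) * pi \<le> rmin T (\<lambda>t. \<mu> + a t)}"
proof -
  let ?R = "\<lambda>\<mu>. rmax T (\<lambda>t. \<mu> + a t)" and ?r = "\<lambda>\<mu>. rmin T (\<lambda>t. \<mu> + a t)"
  let ?S1 = "{\<nu>. (\<exists>i::nat. ?R \<nu> = (2 * real i + 1) * pi) \<and> \<nu> \<le> \<mu>}"
  let ?S2 = "{\<nu>. (\<exists>i::nat. ?r \<nu> = (2 * real i + 1) * pi) \<and> \<nu> \<le> \<mu>}"
  obtain \<mu>0 where low: "?R \<mu>0 < pi" "?r \<mu>0 < pi" by (rule shift_low)
  note c1 = card_levels[OF shift_cont(1) shift_strict_mono(1) low(1), of \<mu>]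
  note c2 = card_levels[OF shift_cont(2) shift_strict_mono(2) low(2), of \<mu>]
  have E: "{\<nu>. antiper_eigenvalue T a \<nu> \<and> \<nu> \<le> \<mu>} = ?S1 \<union> ?S2"
    unfolding antiper_eigenvalue_iff[OF T a] by blast
  have m: "antiper_mult T a \<nu> = (if \<nu> \<in> ?S1 then 1 else 0) + (if \<nu> \<in> ?S2 then 1 else 0)" if \<nu>: "\<nu> \<in> ?S1 \<union> ?S2" for \<nu>
  proof (cases "?r \<nu> = ?R \<nu>")
    case True
    then obtain i :: nat where i: "?R \<nu> = (2 * real i + 1) * pi" using \<nu> by auto
    then have "\<nu> \<in> ?S1" "\<nu> \<in> ?S2" using True \<nu> by auto
    then show ?thesis using antiper_mult_double[OF T a i True] by simp
  next
    case False
    \<comment> \<open>Different odd multiples of \<pi> are at least 2 \<pi> apart, while the two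
      rotations differ by less than \<pi>.\<close>
    have "\<not> (\<nu> \<in> ?S1 \<and> \<nu> \<in> ?S2)"
    proof
      assume "\<nu> \<in> ?S1 \<and> \<nu> \<in> ?S2"
      then obtain i j :: nat where i: "?R \<nu> = (2 * real i + 1) * pi" "?r \<nu> = (2 * real j + 1) * pi" by auto
      have "(2 * real i + 1) * pi < (2 * real j + 1) * pi + pi" "(2 * real j + 1) * pi \<le> (2 * real i + 1) * pi"
        using rmax_less[OF T shifted_abs_int[OF T a], of \<nu>] rmin_le_rmax[OF T shifted_abs_int[OF T a], of \<nu>] i by simp_all
      then have "(2 * real i + 1) * pi < (2 * real j + 2) * pi" "(2 * real j + 1) * pi \<le> (2 * real i + 1) * pi"
        by (simp_all add: algebra_simps)
      then have "2 * real i + 1 < 2 * real j + 2" "2 * real j + 1 \<le> 2 * real i + 1"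
        by (simp_all only: mult_less_cancel_right_pos[OF pi_gt_zero] mult_le_cancel_right_pos[OF pi_gt_zero])
      then have "i = j" by linarith
      then show False using False i by simp
    qed
    moreover obtain i :: nat where "?R \<nu> = (2 * real i + 1) * pi \<or> ?r \<nu> = (2 * real i + 1) * pi" using \<nu> by auto
    from antiper_mult_simple[OF T a this False] have "antiper_mult T a \<nu> = 1" .
    ultimately show ?thesis using \<nu> by auto
  qed
  have "(\<Sum>\<nu> | antiper_eigenvalue T a \<nu> \<and> \<nu> \<le> \<mu>. antiper_mult T a \<nu>)
      = (\<Sum>\<nu>\<in>?S1 \<union> ?S2. (if \<nu> \<in> ?S1 then 1 else 0) + (if \<nu> \<in> ?S2 then 1 else 0))"
    unfolding E by (rule sum.cong[OF refl m])
  also have "\<dots> = (\<Sum>\<nu>\<in>?S1 \<union> ?S2. if \<nu> \<in> ?S1 then 1 else 0) + (\<Sum>\<nu>\<in>?S1 \<union> ?S2. if \<nu> \<in> ?S2 then 1 else 0)"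
    by (rule sum.distrib)
  also have "(\<Sum>\<nu>\<in>?S1 \<union> ?S2. if \<nu> \<in> ?S1 then 1 else 0) = card ((?S1 \<union> ?S2) \<inter> ?S1)"
    using c1(1) c2(1) by (subst sum.inter_restrict[symmetric]) simp_all
  also have "(?S1 \<union> ?S2) \<inter> ?S1 = ?S1" by blast
  also have "(\<Sum>\<nu>\<in>?S1 \<union> ?S2. if \<nu> \<in> ?S2 then 1 else 0) = card ((?S1 \<union> ?S2) \<inter> ?S2)"
    using c1(1) c2(1) by (subst sum.inter_restrict[symmetric]) simp_all
  also have "(?S1 \<union> ?S2) \<inter> ?S2 = ?S2" by blast
  finally show ?thesis using c1(2) c2(2) by simp
qed

text \<open>With counts A for \<open>rmax\<close> and B for \<open>rmin\<close> one has B \<le> A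
  \<le> B + 1, whence A + B \<ge> 2 i + 1 iff A > i, and A + B \<ge> 2 i + 2 iff B > i.\<close>

lemma sum_mult_ge:
  fixes i :: nat
  shows "2 * i + 1 \<le> (\<Sum>\<nu> | antiper_eigenvalue T a \<nu> \<and> \<nu> \<le> \<mu>. antiper_mult T a \<nu>) \<longleftrightarrow>
      (2 * real i + 1) * pi \<le> rmax T (\<lambda>t. \<mu> + a t)" (is ?odd)
    and "2 * i + 2 \<le> (\<Sum>\<nu> | antiper_eigenvalue T a \<nu> \<and> \<nu> \<le> \<mu>. antiper_mult T a \<nu>) \<longleftrightarrow>
      (2 * real i + 1) * pi \<le> rmin T (\<lambda>t. \<mu> + a t)" (is ?even)
proof -
  let ?R = "rmax T (\<lambda>t. \<mu> + a t)" and ?r = "rmin T (\<lambda>t. \<mu> + a t)"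
  let ?A = "card {i::nat. (2 * real i + 1) * pi \<le> ?R}" and ?B = "card {i::nat. (2 * real i + 1) * pi \<le> ?r}"
  have BA: "?B \<le> ?A"
    by (rule card_mono[OF odd_multiples_below(1)]) (use rmin_le_rmax[OF T shifted_abs_int[OF T a], of \<mu>] in auto)
  have AB: "?A \<le> ?B + 1"
  proof (rule ccontr)
    assume "\<not> ?A \<le> ?B + 1"
    then have "?B + 1 < ?A" by simp
    then have "(2 * real (?B + 1) + 1) * pi \<le> ?R" using odd_multiples_below(2) by blast
    then have "(2 * real ?B + 1) * pi + 2 * pi \<le> ?R" by (simp add: algebra_simps)
    then have "(2 * real ?B + 1) * pi \<le> ?r"
      using rmax_less[OF T shifted_abs_int[OF T a], of \<mu>] pi_gt_zero by linarith
    then show False using odd_multiples_below(2)[of ?B ?r] by simp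
  qed
  show ?odd unfolding sum_mult_eq using odd_multiples_below(2)[of i ?R] BA AB by linarith
  show ?even unfolding sum_mult_eq using odd_multiples_below(2)[of i ?r] BA AB by linarith
qed

lemma antiper_eig_odd:
  assumes "rmax T (\<lambda>t. \<nu> + a t) = (2 * real i + 1) * pi"
  shows "antiper_eig T a (2 * i + 1) = \<nu>"
  unfolding antiper_eig_def sum_mult_ge(1)
proof (rule Least_equality)
  fix y assume "(2 * real i + 1) * pi \<le> rmax T (\<lambda>t. y + a t)"
  then show "\<nu> \<le> y" using strict_mono_less_eq[OF shift_strict_mono(1), of \<nu> y] assms by simp
qed (simp add: assms)

lemma antiper_eig_even:
  assumes "rmin T (\<lambda>t. \<nu> + a t) = (2 * real i + 1) * pi"
  shows "antiper_eig T a (2 * i + 2) = \<nu>"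
  unfolding antiper_eig_def sum_mult_ge(2)
proof (rule Least_equality)
  fix y assume "(2 * real i + 1) * pi \<le> rmin T (\<lambda>t. y + a t)"
  then show "\<nu> \<le> y" using strict_mono_less_eq[OF shift_strict_mono(2), of \<nu> y] assms by simp
qed (simp add: assms)

text \<open>The shift \<mu> supplies a point where the level is reached, so the intermediate value
  theorem locates the eigenvalue in (0, \<mu>].\<close>

lemma antiper_eig_odd_pos:
  assumes "rmax T a < (2 * real i + 1) * pi" "(2 * real i + 1) * pi \<le> rmax T (\<lambda>t. \<mu> + a t)" "\<mu> \<ge> 0"
  shows "antiper_eig T a (2 * i + 1) > 0"
proof -
  have "rmax T (\<lambda>t. 0 + a t) \<le> (2 * real i + 1) * pi" using assms by simp
  then have "\<exists>\<nu>\<ge>0. \<nu> \<le> \<mu> \<and> rmax T (\<lambda>t. \<nu> + a t) = (2 * real i + 1) * pi"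
    using assms by (intro IVT' continuous_on_subset[OF shift_cont(1)]) (assumption | simp)+
  then obtain \<nu> where \<nu>: "0 \<le> \<nu>" "rmax T (\<lambda>t. \<nu> + a t) = (2 * real i + 1) * pi" by blast
  moreover have "\<nu> \<noteq> 0" using \<nu>(2) assms(1) by auto
  ultimately show ?thesis using antiper_eig_odd[OF \<nu>(2)] by simp
qed

text \<open>Lowering the potential far enough brings \<open>rmin\<close> below \<pi>, so the level
  is met at a negative shift.\<close>

lemma antiper_eig_even_neg:
  assumes "(2 * real i + 1) * pi < rmin T a"
  shows "antiper_eig T a (2 * i + 2) < 0"
proof -
  have p: "pi \<le> (2 * real i + 1) * pi" using mult_right_mono[of 1 "2 * real i + 1" pi] by simp
  obtain \<mu> where \<mu>: "rmin T (\<lambda>t. \<mu> + a t) < pi" by (rule shift_low)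
  have "\<mu> \<le> 0"
  proof (rule ccontr)
    assume "\<not> \<mu> \<le> 0"
    then have "rmin T (\<lambda>t. 0 + a t) < rmin T (\<lambda>t. \<mu> + a t)"
      using strict_monoD[OF shift_strict_mono(2), of 0 \<mu>] by simp
    then show False using assms \<mu> p by (simp only: add_0)
  qed
  moreover have "rmin T (\<lambda>t. 0 + a t) \<ge> (2 * real i + 1) * pi" using assms by simp
  ultimately have "\<exists>\<nu>\<ge>\<mu>. \<nu> \<le> 0 \<and> rmin T (\<lambda>t. \<nu> + a t) = (2 * real i + 1) * pi"
    using \<mu> p by (intro IVT' continuous_on_subset[OF shift_cont(2)]) (linarith | simp)+
  then obtain \<nu> where \<nu>: "\<nu> \<le> 0" "rmin T (\<lambda>t. \<nu> + a t) = (2 * real i + 1) * pi" by blast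
  have "\<nu> \<noteq> 0" using \<nu>(2) assms(1) by auto
  then show ?thesis using antiper_eig_even[OF \<nu>(2)] \<nu>(1) by simp
qed

end

subsection \<open>Quarter waves\<close>

text \<open>Convexity of cot on (0, \<pi>/2] in tangent form: cot z + z / sin^2 y has derivative 1 /
  sin^2 y - 1 / sin^2 z, which changes sign at z = y, so its minimum is there.\<close>

lemma cot_tangent_le:
  fixes x y :: real
  assumes "0 < x" "x \<le> pi/2" "0 < y" "y \<le> pi/2"
  shows "cot y - (x - y) / (sin y)\<^sup>2 \<le> cot x"
proof -
  have sp: "sin z > 0" if "0 < z" "z \<le> pi/2" for z using that by (intro sin_gt_zero) auto
  have d: "((\<lambda>x. cot x + x / (sin y)\<^sup>2) has_real_derivative (1 / (sin y)\<^sup>2 - inverse ((sin z)\<^sup>2))) (at z)" if "0 < z" "z \<le> pi/2" for z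
  proof -
    have "sin z \<noteq> 0" using sp[OF that] by simp
    from DERIV_add[OF DERIV_cot[OF this] DERIV_cdivide[OF DERIV_ident, of "(sin y)\<^sup>2" z UNIV]]
    show ?thesis by simp
  qed
  have ms: "sin a \<le> sin b" if "0 < a" "a \<le> b" "b \<le> pi/2" for a b using that by (subst sin_mono_le_eq) auto
  have "cot y + y / (sin y)\<^sup>2 \<le> cot x + x / (sin y)\<^sup>2"
  proof (cases "y \<le> x")
    case True
    show ?thesis
    proof (rule DERIV_nonneg_imp_nondecreasing[OF True])
      fix z assume z: "y \<le> z" "z \<le> x"
      have "(sin y)\<^sup>2 \<le> (sin z)\<^sup>2" using ms[of y z] sp[of y] z assms by (intro power_mono) auto
      then have "inverse ((sin z)\<^sup>2) \<le> 1 / (sin y)\<^sup>2"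
        using sp[of y] assms by (simp add: inverse_eq_divide frac_le)
      then show "\<exists>D. ((\<lambda>x. cot x + x / (sin y)\<^sup>2) has_real_derivative D) (at z) \<and> 0 \<le> D"
        using d[of z] z assms by (intro exI[of _ "1 / (sin y)\<^sup>2 - inverse ((sin z)\<^sup>2)"]) auto
    qed
  next
    case False
    then have "x \<le> y" by simp
    then show ?thesis
    proof (rule DERIV_nonpos_imp_nonincreasing)
      fix z assume z: "x \<le> z" "z \<le> y"
      have "(sin z)\<^sup>2 \<le> (sin y)\<^sup>2" using ms[of z y] sp[of z] z assms by (intro power_mono) auto
      moreover have "0 < (sin z)\<^sup>2" using sp[of z] z assms by simp
      ultimately have "1 / (sin y)\<^sup>2 \<le> inverse ((sin z)\<^sup>2)" by (simp add: inverse_eq_divide frac_le)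
      then show "\<exists>D. ((\<lambda>x. cot x + x / (sin y)\<^sup>2) has_real_derivative D) (at z) \<and> D \<le> 0"
        using d[of z] z assms by (intro exI[of _ "1 / (sin y)\<^sup>2 - inverse ((sin z)\<^sup>2)"]) auto
    qed
  qed
  then show ?thesis by (simp add: diff_divide_distrib)
qed

text \<open>Wronskian identity (v y - u y')' = - (q - \<omega>^2) u y for a solution y of the
  equation with constant potential \<omega>^2, integrated over [c, d].\<close>

lemma hill_sol_comparison:
  assumes h: "hill_sol c d q u v" and cd: "c \<le> d" and q: "q absolutely_integrable_on {c..d}"
    and y: "\<And>t. (y has_real_derivative y' t) (at t)" "\<And>t. (y' has_real_derivative - \<omega>\<^sup>2 * y t) (at t)"
  shows "(v d * y d - u d * y' d) - (v c * y c - u c * y' c) = - integral {c..d} (\<lambda>t. (q t - \<omega>\<^sup>2) * (u t * y t))"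
proof -
  have yc: "continuous_on {c..d} y" "continuous_on {c..d} y'" using y by (meson DERIV_continuous_on DERIV_subset subset_UNIV has_field_derivative_at_within)+
  have iy: "indef_int c d y y'" by (rule indef_int_C1[OF has_field_derivative_at_within[OF y(1)] yc(2)])
  have iy': "indef_int c d y' (\<lambda>t. - \<omega>\<^sup>2 * y t)"
    by (rule indef_int_C1[OF has_field_derivative_at_within[OF y(2)]]) (intro continuous_intros yc)
  have iu: "indef_int c d u v" "indef_int c d v (\<lambda>t. - (q t * u t))" using h by (auto simp: hill_sol_def)
  have "indef_int c d (\<lambda>t. v t * y t - u t * y' t) (\<lambda>t. - ((q t - \<omega>\<^sup>2) * (u t * y t)))"
    by (rule indef_int_cong[OF indef_int_diff[OF indef_int_mult[OF iu(2) iy] indef_int_mult[OF iu(1) iy']]])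
      (auto simp: algebra_simps)
  from indef_intD[OF this, of d] cd show ?thesis by simp
qed

text \<open>\<open>u\<close> has a zero at one end of a quarter wave and \<open>u'\<close> at the other; \<open>s\<close> is the distance from the zero of \<open>u\<close>.\<close>

lemma quarter_wave_integral:
  fixes \<omega> :: real
  assumes cd: "c < d" and w: "\<omega> > 0" "\<omega> * (d - c) \<le> pi / 2"
    and q: "q absolutely_integrable_on {c..d}" "\<And>t. q t \<ge> \<omega>\<^sup>2"
    and uc: "continuous_on {c..d} u" and ub: "\<And>t. t \<in> {c..d} \<Longrightarrow> 0 \<le> u t \<and> u t \<le> U" and U: "U > 0"
    and s: "\<And>t. t \<in> {c..d} \<Longrightarrow> 0 \<le> s t \<and> s t \<le> d - c" "continuous_on {c..d} s" "\<And>t. t \<in> {c..d} \<Longrightarrow> s t = d - c \<Longrightarrow> t = c \<or> t = d"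
    and I: "U * \<omega> * cos (\<omega> * (d - c)) = integral {c..d} (\<lambda>t. (q t - \<omega>\<^sup>2) * (u t * sin (\<omega> * s t)))"
  shows "integral {c..d} (\<lambda>t. q t - \<omega>\<^sup>2) \<ge> \<omega> * cot (\<omega> * (d - c))"
    and "integral {c..d} (\<lambda>t. q t - \<omega>\<^sup>2) > 0 \<Longrightarrow> integral {c..d} (\<lambda>t. q t - \<omega>\<^sup>2) > \<omega> * cot (\<omega> * (d - c))"
proof -
  let ?S = "sin (\<omega> * (d - c))"
  let ?J = "integral {c..d} (\<lambda>t. q t - \<omega>\<^sup>2)"
  have Sp: "?S > 0" 
  proof (rule sin_gt_zero)
    show "0 < \<omega> * (d - c)" using w cd by simp
    show "\<omega> * (d - c) < pi" using w(2) pi_gt_zero by linarith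
  qed
  have qm: "(\<lambda>t. q t - \<omega>\<^sup>2) absolutely_integrable_on {c..d}" by (rule abs_int_diff_const[OF q(1)])
  have sb: "0 \<le> sin (\<omega> * s t) \<and> sin (\<omega> * s t) \<le> ?S" if "t \<in> {c..d}" for t
  proof -
    have "0 \<le> \<omega> * s t" "\<omega> * s t \<le> \<omega> * (d - c)" using s(1)[OF that] w by (auto intro: mult_left_mono)
    then show ?thesis using w(2) by (auto intro!: sin_ge_zero simp: sin_mono_le_eq)
  qed
  have gc: "continuous_on {c..d} (\<lambda>t. u t * sin (\<omega> * s t))" by (intro continuous_intros uc s(2))
  have g: "0 \<le> U * ?S - u t * sin (\<omega> * s t)" if "t \<in> {c..d}" for t
    using mult_mono[of "u t" U "sin (\<omega> * s t)" ?S] ub[OF that] sb[OF that] U by auto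
  \<comment> \<open>The gap between the two sides of the claim, scaled by U S, becomes the integral
    of a nonnegative function: u and sin (\<omega> s) stay below their largest values U and
    S.\<close>
  have D: "integral {c..d} (\<lambda>t. (q t - \<omega>\<^sup>2) * (U * ?S - u t * sin (\<omega> * s t))) = ?J * (U * ?S) - U * \<omega> * cos (\<omega> * (d - c))"
  proof -
    have "integral {c..d} (\<lambda>t. (q t - \<omega>\<^sup>2) * (U * ?S) - (q t - \<omega>\<^sup>2) * (u t * sin (\<omega> * s t)))
      = integral {c..d} (\<lambda>t. (q t - \<omega>\<^sup>2) * (U * ?S)) - integral {c..d} (\<lambda>t. (q t - \<omega>\<^sup>2) * (u t * sin (\<omega> * s t)))"
      by (rule integral_diff_abs[OF set_integrable_mult_left[OF qm] abs_int_mult_cont(1)[OF qm gc]])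
    moreover have "integral {c..d} (\<lambda>t. (q t - \<omega>\<^sup>2) * (U * ?S)) = ?J * (U * ?S)" by simp
    ultimately show ?thesis
      unfolding I right_diff_distrib[of "q _ - \<omega>\<^sup>2" "U * ?S"] by (simp only:)
  qed
  have fin: "x \<le> y \<longleftrightarrow> U * \<omega> * cos (\<omega> * (d - c)) \<le> y * (U * ?S)" if "x = \<omega> * cot (\<omega> * (d - c))" for x y
  proof -
    have "x = U * \<omega> * cos (\<omega> * (d - c)) / (U * ?S)" using U by (simp add: that cot_def)
    moreover have "U * ?S > 0" using U Sp by simp
    ultimately show ?thesis by (simp only: pos_divide_le_eq)
  qed
  have fin': "x < y \<longleftrightarrow> U * \<omega> * cos (\<omega> * (d - c)) < y * (U * ?S)" if "x = \<omega> * cot (\<omega> * (d - c))" for x y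
  proof -
    have "x = U * \<omega> * cos (\<omega> * (d - c)) / (U * ?S)" using U by (simp add: that cot_def)
    moreover have "U * ?S > 0" using U Sp by simp
    ultimately show ?thesis by (simp only: pos_divide_less_eq)
  qed
  have Dai: "(\<lambda>t. (q t - \<omega>\<^sup>2) * (U * ?S - u t * sin (\<omega> * s t))) absolutely_integrable_on {c..d}"
    by (intro abs_int_mult_cont(1)[OF qm] continuous_intros gc)
  have "integral {c..d} (\<lambda>t. (q t - \<omega>\<^sup>2) * (U * ?S - u t * sin (\<omega> * s t))) \<ge> 0"
    by (rule integral_nonneg[OF abs_int_imp_int[OF Dai]]) (use g q in auto)
  then show "?J \<ge> \<omega> * cot (\<omega> * (d - c))" using D fin by simp
  assume J: "?J > 0"
  have "integral {c..d} (\<lambda>t. (q t - \<omega>\<^sup>2) * (U * ?S - u t * sin (\<omega> * s t))) > 0"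
  proof (rule integral_pos_mult[OF qm _ J])
    show "continuous_on {c..d} (\<lambda>t. U * ?S - u t * sin (\<omega> * s t))" by (intro continuous_intros gc)
    \<comment> \<open>The product attains its bound U S only where s is largest, so the weight
      vanishes at most at the two endpoints and any excess of q counts strictly.\<close>
    have "{t \<in> {c..d}. U * ?S - u t * sin (\<omega> * s t) = 0} \<subseteq> {c, d}"
    proof
      fix t assume t: "t \<in> {t \<in> {c..d}. U * ?S - u t * sin (\<omega> * s t) = 0}"
      have "s t = d - c"
      proof (rule ccontr)
        assume "s t \<noteq> d - c"
        then have "s t < d - c" using s(1)[of t] t by auto
        then have "\<omega> * s t < \<omega> * (d - c)" using w by simp
        moreover have "0 \<le> \<omega> * s t" using s(1)[of t] t w by auto
        ultimately have "sin (\<omega> * s t) < ?S" using w(2) by (subst sin_mono_less_eq) auto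
        moreover have "u t * sin (\<omega> * s t) \<le> U * sin (\<omega> * s t)" using ub[of t] sb[of t] t by (intro mult_right_mono) auto
        moreover have "U * sin (\<omega> * s t) < U * ?S" using U calculation(1) by simp
        ultimately show False using t by auto
      qed
      then show "t \<in> {c, d}" using s(3)[of t] t by auto
    qed
    then show "countable {t \<in> {c..d}. U * ?S - u t * sin (\<omega> * s t) = 0}"
      by (rule countable_subset) simp
  qed (use q g in auto)
  then show "?J > \<omega> * cot (\<omega> * (d - c))" using D fin' by simp
qed


text \<open>\<theta>' = cos^2 \<theta> + q sin^2 \<theta> is at least min 1 m.\<close>

lemma prufer_strict_increasing:
  assumes p: "prufer a b q \<theta>" and q: "\<And>t. q t \<ge> m" "m > 0" and st: "a \<le> s" "s < t" "t \<le> b"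
  shows "\<theta> s < \<theta> t"
proof -
  let ?f = "\<lambda>t. 1 + (q t - 1) * (sin (\<theta> t))\<^sup>2"
  have f: "min 1 m \<le> ?f t" for t
  proof -
    have "min 1 m * ((cos (\<theta> t))\<^sup>2 + (sin (\<theta> t))\<^sup>2) \<le> 1 * (cos (\<theta> t))\<^sup>2 + q t * (sin (\<theta> t))\<^sup>2"
      unfolding distrib_left using q(1)[of t] by (intro add_mono mult_right_mono) auto
    then show ?thesis by (simp add: cos_squared_eq algebra_simps)
  qed
  have "integral {s..t} (\<lambda>t. min 1 m) \<le> integral {s..t} ?f"
    by (rule integral_mono_abs[OF abs_int_const indef_int_abs_int[OF prufer_sub[OF p, unfolded prufer_def]] f])
      (use st in auto)
  moreover have "integral {s..t} (\<lambda>t. min 1 m) > 0" using st q(2) by simp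
  moreover have "\<theta> t = \<theta> s + integral {s..t} ?f"
    by (rule indef_int_diff_eq[OF p[unfolded prufer_def]]) (use st in auto)
  ultimately show ?thesis by simp
qed

text \<open>The comparison function sin (\<omega> (t - c)) vanishes together with u at c. If the
  wave were longer than \<pi> / (2 \<omega>), the Wronskian at the crest of that function would make
  u' nonpositive there, although u' > 0 before d. At d, where u' = 0, the Wronskian gives the
  identity required by \<open>quarter_wave_integral\<close>.\<close>

lemma quarter_wave_rising:
  fixes \<omega> :: real
  assumes p: "prufer c d q \<theta>" and q: "q absolutely_integrable_on {c..d}" "\<And>t. q t \<ge> \<omega>\<^sup>2" and cd: "c < d" and w: "\<omega> > 0"
    and t: "\<theta> c = 0" "\<theta> d = pi / 2"
  shows "\<omega> * (d - c) \<le> pi / 2"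
    and "integral {c..d} (\<lambda>t. q t - \<omega>\<^sup>2) \<ge> \<omega> * cot (\<omega> * (d - c))"
    and "integral {c..d} (\<lambda>t. q t - \<omega>\<^sup>2) > 0 \<Longrightarrow> integral {c..d} (\<lambda>t. q t - \<omega>\<^sup>2) > \<omega> * cot (\<omega> * (d - c))"
proof -
  obtain r where r: "\<forall>t. r t > 0" and h: "hill_sol c d q (\<lambda>t. r t * sin (\<theta> t)) (\<lambda>t. r t * cos (\<theta> t))"
    by (rule hill_sol_polar[OF p q(1)]) (rule that; assumption)
  define u where "u t = r t * sin (\<theta> t)" for t
  define v where "v t = r t * cos (\<theta> t)" for t
  have h: "hill_sol c d q u v" using h by (simp add: u_def[abs_def] v_def[abs_def])
  have iu: "indef_int c d u v" using h by (simp add: hill_sol_def)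
  have w2: "\<omega>\<^sup>2 > 0" using w by simp
  have th: "0 \<le> \<theta> t \<and> \<theta> t \<le> pi/2 \<and> (c < t \<longrightarrow> 0 < \<theta> t) \<and> (t < d \<longrightarrow> \<theta> t < pi/2)" if "t \<in> {c..d}" for t
  proof -
    have "c < t \<Longrightarrow> 0 < \<theta> t" "t < d \<Longrightarrow> \<theta> t < pi / 2"
      using prufer_strict_increasing[OF p q(2) w2, of c t] prufer_strict_increasing[OF p q(2) w2, of t d] that unfolding t by auto
    then show ?thesis using that t cd pi_gt_zero by (smt (verit) atLeastAtMost_iff field_sum_of_halves)
  qed
  have u0: "u t \<ge> 0" if "t \<in> {c..d}" for t
    unfolding u_def using th[OF that] r by (intro mult_nonneg_nonneg sin_ge_zero) (auto intro: less_imp_le)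
  have v0: "v t \<ge> 0" if "t \<in> {c..d}" for t
    unfolding v_def using th[OF that] r by (intro mult_nonneg_nonneg cos_ge_zero) (auto intro: less_imp_le)
  have vp: "v t > 0" if "t \<in> {c..d}" "t < d" for t
    unfolding v_def using th[OF that(1)] that r by (intro mult_pos_pos cos_gt_zero_pi) auto
  have uU: "u t \<le> u d" if tt: "t \<in> {c..d}" for t
  proof -
    have "u d = u t + integral {t..d} v" by (rule indef_int_diff_eq[OF iu]) (use tt in auto)
    moreover have "integral {t..d} v \<ge> 0"
      by (rule integral_nonneg[OF abs_int_imp_int[OF abs_int_subinterval[OF indef_int_abs_int[OF iu]]]]) (use tt v0 in auto)
    ultimately show ?thesis by simp
  qed
  let ?y = "\<lambda>t. sin (\<omega> * (t - c))" and ?y' = "\<lambda>t. \<omega> * cos (\<omega> * (t - c))"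
  have y: "(?y has_real_derivative ?y' t) (at t)" "(?y' has_real_derivative - \<omega>\<^sup>2 * ?y t) (at t)" for t
    by (auto intro!: derivative_eq_intros simp: power2_eq_square)
  have uc0: "u c = 0" "v d = 0" "u d > 0" unfolding u_def v_def t using r by simp_all
  show le: "\<omega> * (d - c) \<le> pi / 2"
  proof (rule ccontr)
    assume n: "\<not> ?thesis"
    \<comment> \<open>Crest of the comparison function, where its derivative vanishes and only u'
      remains in the boundary term.\<close>
    define e where "e = c + pi / (2 * \<omega>)"
    have e: "c < e" "e < d" "\<omega> * (e - c) = pi / 2" using n w by (auto simp: e_def field_simps)
    have ai: "q absolutely_integrable_on {c..e}" by (rule abs_int_subinterval[OF q(1)]) (use e in auto)
    have y0: "0 \<le> ?y t" if "t \<in> {c..e}" for t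
    proof -
      have "\<omega> * (t - c) \<le> \<omega> * (e - c)" "0 \<le> \<omega> * (t - c)" using that w by (auto intro!: mult_left_mono)
      then show ?thesis using e by (intro sin_ge_zero) auto
    qed
    have "(v e * ?y e - u e * ?y' e) - (v c * ?y c - u c * ?y' c) = - integral {c..e} (\<lambda>t. (q t - \<omega>\<^sup>2) * (u t * ?y t))"
      by (rule hill_sol_comparison[OF hill_sol_sub[OF h] _ ai y]) (use e in auto)
    then have "v e = - integral {c..e} (\<lambda>t. (q t - \<omega>\<^sup>2) * (u t * ?y t))" using uc0 unfolding e(3) by simp
    moreover have "integral {c..e} (\<lambda>t. (q t - \<omega>\<^sup>2) * (u t * ?y t)) \<ge> 0"
    proof (rule integral_nonneg)
      have "continuous_on {c..e} u" by (rule continuous_on_subset[OF indef_int_cont[OF iu]]) (use e in auto)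
      then show "(\<lambda>t. (q t - \<omega>\<^sup>2) * (u t * ?y t)) integrable_on {c..e}"
        by (intro abs_int_imp_int abs_int_mult_cont(1)[OF abs_int_diff_const[OF ai]] continuous_intros)
      show "0 \<le> (q t - \<omega>\<^sup>2) * (u t * ?y t)" if "t \<in> {c..e}" for t
        using q(2)[of t] y0[OF that] u0[of t] that e by (intro mult_nonneg_nonneg) auto
    qed
    moreover have "v e > 0" using vp[of e] e by auto
    ultimately show False by simp
  qed
  have I: "u d * \<omega> * cos (\<omega> * (d - c)) = integral {c..d} (\<lambda>t. (q t - \<omega>\<^sup>2) * (u t * sin (\<omega> * (t - c))))"
    using hill_sol_comparison[OF h less_imp_le[OF cd] q(1) y] uc0 by (simp add: mult.assoc)
  have sc: "continuous_on {c..d} (\<lambda>t. t - c)" by (intro continuous_intros)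
  have s1: "0 \<le> t - c \<and> t - c \<le> d - c" if "t \<in> {c..d}" for t using that by auto
  have s2: "t = c \<or> t = d" if "t \<in> {c..d}" "t - c = d - c" for t using that by auto
  have ub: "0 \<le> u t \<and> u t \<le> u d" if "t \<in> {c..d}" for t using u0[OF that] uU[OF that] by simp
  note Q = quarter_wave_integral[OF cd w le q indef_int_cont[OF iu] ub uc0(3) s1 sc s2 I]
  show "integral {c..d} (\<lambda>t. q t - \<omega>\<^sup>2) \<ge> \<omega> * cot (\<omega> * (d - c))" by (rule Q(1))
  show "integral {c..d} (\<lambda>t. q t - \<omega>\<^sup>2) > 0 \<Longrightarrow> integral {c..d} (\<lambda>t. q t - \<omega>\<^sup>2) > \<omega> * cot (\<omega> * (d - c))" by (rule Q(2))
qed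

text \<open>Mirror image of the rising case: the comparison function is sin (\<omega> (d - t)),
  vanishing with u at the right end.\<close>

lemma quarter_wave_falling:
  fixes \<omega> :: real
  assumes p: "prufer c d q \<theta>" and q: "q absolutely_integrable_on {c..d}" "\<And>t. q t \<ge> \<omega>\<^sup>2" and cd: "c < d" and w: "\<omega> > 0"
    and t: "\<theta> c = pi / 2" "\<theta> d = pi"
  shows "\<omega> * (d - c) \<le> pi / 2"
    and "integral {c..d} (\<lambda>t. q t - \<omega>\<^sup>2) \<ge> \<omega> * cot (\<omega> * (d - c))"
    and "integral {c..d} (\<lambda>t. q t - \<omega>\<^sup>2) > 0 \<Longrightarrow> integral {c..d} (\<lambda>t. q t - \<omega>\<^sup>2) > \<omega> * cot (\<omega> * (d - c))"
proof -
  obtain r where r: "\<forall>t. r t > 0" and h: "hill_sol c d q (\<lambda>t. r t * sin (\<theta> t)) (\<lambda>t. r t * cos (\<theta> t))"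
    by (rule hill_sol_polar[OF p q(1)]) (rule that; assumption)
  define u where "u t = r t * sin (\<theta> t)" for t
  define v where "v t = r t * cos (\<theta> t)" for t
  have h: "hill_sol c d q u v" using h by (simp add: u_def[abs_def] v_def[abs_def])
  have iu: "indef_int c d u v" using h by (simp add: hill_sol_def)
  have w2: "\<omega>\<^sup>2 > 0" using w by simp
  have th: "pi/2 \<le> \<theta> t \<and> \<theta> t \<le> pi \<and> (c < t \<longrightarrow> pi/2 < \<theta> t) \<and> (t < d \<longrightarrow> \<theta> t < pi)" if "t \<in> {c..d}" for t
  proof -
    have "c < t \<Longrightarrow> pi / 2 < \<theta> t" "t < d \<Longrightarrow> \<theta> t < pi"
      using prufer_strict_increasing[OF p q(2) w2, of c t] prufer_strict_increasing[OF p q(2) w2, of t d] that unfolding t by auto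
    then show ?thesis using that t cd pi_gt_zero by (smt (verit) atLeastAtMost_iff field_sum_of_halves)
  qed
  have u0: "u t \<ge> 0" if "t \<in> {c..d}" for t
    unfolding u_def using th[OF that] r pi_gt_zero by (intro mult_nonneg_nonneg sin_ge_zero) (auto intro: less_imp_le)
  have vp: "v t < 0" if "t \<in> {c..d}" "c < t" for t
  proof -
    have "cos (pi - \<theta> t) > 0" using th[OF that(1)] that by (intro cos_gt_zero_pi) auto
    then show ?thesis using r by (simp add: v_def mult_pos_neg)
  qed
  have uc0: "v c = 0" "u d = 0" "u c > 0" unfolding u_def v_def t using r by simp_all
  have v0: "v t \<le> 0" if "t \<in> {c..d}" for t
    using vp[OF that] uc0 that by (cases "t = c") auto
  have uU: "u t \<le> u c" if tt: "t \<in> {c..d}" for t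
  proof -
    have "u t = u c + integral {c..t} v" by (rule indef_int_diff_eq[OF iu]) (use tt in auto)
    moreover have "integral {c..t} v \<le> integral {c..t} (\<lambda>t. 0)"
      by (rule integral_mono_abs[OF abs_int_subinterval[OF indef_int_abs_int[OF iu]] abs_int_const]) (use tt v0 in auto)
    ultimately show ?thesis by simp
  qed
  let ?y = "\<lambda>t. sin (\<omega> * (d - t))" and ?y' = "\<lambda>t. - (\<omega> * cos (\<omega> * (d - t)))"
  have y: "(?y has_real_derivative ?y' t) (at t)" "(?y' has_real_derivative - \<omega>\<^sup>2 * ?y t) (at t)" for t
    by (auto intro!: derivative_eq_intros simp: power2_eq_square)
  show le: "\<omega> * (d - c) \<le> pi / 2"
  proof (rule ccontr)
    assume n: "\<not> ?thesis"
    define e where "e = d - pi / (2 * \<omega>)"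
    have e: "c < e" "e < d" "\<omega> * (d - e) = pi / 2" using n w by (auto simp: e_def field_simps)
    have ai: "q absolutely_integrable_on {e..d}" by (rule abs_int_subinterval[OF q(1)]) (use e in auto)
    have y0: "0 \<le> ?y t" if "t \<in> {e..d}" for t
    proof -
      have "\<omega> * (d - t) \<le> \<omega> * (d - e)" "0 \<le> \<omega> * (d - t)" using that w by (auto intro!: mult_left_mono)
      then show ?thesis using e by (intro sin_ge_zero) auto
    qed
    have "(v d * ?y d - u d * ?y' d) - (v e * ?y e - u e * ?y' e) = - integral {e..d} (\<lambda>t. (q t - \<omega>\<^sup>2) * (u t * ?y t))"
      by (rule hill_sol_comparison[OF hill_sol_sub[OF h] _ ai y]) (use e in auto)
    then have "v e = integral {e..d} (\<lambda>t. (q t - \<omega>\<^sup>2) * (u t * ?y t))" using uc0 unfolding e(3) by simp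
    moreover have "integral {e..d} (\<lambda>t. (q t - \<omega>\<^sup>2) * (u t * ?y t)) \<ge> 0"
    proof (rule integral_nonneg)
      have "continuous_on {e..d} u" by (rule continuous_on_subset[OF indef_int_cont[OF iu]]) (use e in auto)
      then show "(\<lambda>t. (q t - \<omega>\<^sup>2) * (u t * ?y t)) integrable_on {e..d}"
        by (intro abs_int_imp_int abs_int_mult_cont(1)[OF abs_int_diff_const[OF ai]] continuous_intros)
      show "0 \<le> (q t - \<omega>\<^sup>2) * (u t * ?y t)" if "t \<in> {e..d}" for t
        using q(2)[of t] y0[OF that] u0[of t] that e by (intro mult_nonneg_nonneg) auto
    qed
    moreover have "v e < 0" using vp[of e] e by auto
    ultimately show False by simp
  qed
  have I: "u c * \<omega> * cos (\<omega> * (d - c)) = integral {c..d} (\<lambda>t. (q t - \<omega>\<^sup>2) * (u t * sin (\<omega> * (d - t))))"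
    using hill_sol_comparison[OF h less_imp_le[OF cd] q(1) y] uc0 by (simp add: mult.assoc)
  have sc: "continuous_on {c..d} (\<lambda>t. d - t)" by (intro continuous_intros)
  have s1: "0 \<le> d - t \<and> d - t \<le> d - c" if "t \<in> {c..d}" for t using that by auto
  have s2: "t = c \<or> t = d" if "t \<in> {c..d}" "d - t = d - c" for t using that by auto
  have ub: "0 \<le> u t \<and> u t \<le> u c" if "t \<in> {c..d}" for t using u0[OF that] uU[OF that] by simp
  note Q = quarter_wave_integral[OF cd w le q indef_int_cont[OF iu] ub uc0(3) s1 sc s2 I]
  show "integral {c..d} (\<lambda>t. q t - \<omega>\<^sup>2) \<ge> \<omega> * cot (\<omega> * (d - c))" by (rule Q(1))
  show "integral {c..d} (\<lambda>t. q t - \<omega>\<^sup>2) > 0 \<Longrightarrow> integral {c..d} (\<lambda>t. q t - \<omega>\<^sup>2) > \<omega> * cot (\<omega> * (d - c))" by (rule Q(2))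
qed

text \<open>Subtracting a multiple of \<pi> from the angle brings every quarter wave to the rising
  case (even i) or the falling case (odd i).\<close>

lemma prufer_quarter_wave:
  fixes \<omega> :: real and i :: nat
  assumes p: "prufer c d q \<theta>" and q: "q absolutely_integrable_on {c..d}" "\<And>t. q t \<ge> \<omega>\<^sup>2" and cd: "c < d" and w: "\<omega> > 0"
    and t: "\<theta> c = real i * (pi / 2)" "\<theta> d = real (i + 1) * (pi / 2)"
  shows "\<omega> * (d - c) \<le> pi / 2"
    and "integral {c..d} (\<lambda>t. q t - \<omega>\<^sup>2) \<ge> \<omega> * cot (\<omega> * (d - c))"
    and "integral {c..d} (\<lambda>t. q t - \<omega>\<^sup>2) > 0 \<Longrightarrow> integral {c..d} (\<lambda>t. q t - \<omega>\<^sup>2) > \<omega> * cot (\<omega> * (d - c))"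
proof -
  define k where "k = i div 2"
  have P: "prufer c d q (\<lambda>t. \<theta> t + of_int (- int k) * pi)" by (rule prufer_add_pi[OF p])
  have "\<omega> * (d - c) \<le> pi / 2 \<and> integral {c..d} (\<lambda>t. q t - \<omega>\<^sup>2) \<ge> \<omega> * cot (\<omega> * (d - c)) \<and>
      (integral {c..d} (\<lambda>t. q t - \<omega>\<^sup>2) > 0 \<longrightarrow> integral {c..d} (\<lambda>t. q t - \<omega>\<^sup>2) > \<omega> * cot (\<omega> * (d - c)))"
  proof (cases "even i")
    case True
    then have i: "real i = 2 * real k" by (auto simp: k_def elim!: evenE)
    have "\<theta> c + of_int (- int k) * pi = 0" "\<theta> d + of_int (- int k) * pi = pi / 2"
      using t i by (simp_all add: algebra_simps)
    from quarter_wave_rising[OF P q cd w this] show ?thesis by blast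
  next
    case False
    then have i: "real i = 2 * real k + 1" by (auto simp: k_def elim!: oddE)
    have "\<theta> c + of_int (- int k) * pi = pi / 2" "\<theta> d + of_int (- int k) * pi = pi"
      using t i by (simp_all add: algebra_simps)
    from quarter_wave_falling[OF P q cd w this] show ?thesis by blast
  qed
  then show "\<omega> * (d - c) \<le> pi / 2"
    and "integral {c..d} (\<lambda>t. q t - \<omega>\<^sup>2) \<ge> \<omega> * cot (\<omega> * (d - c))"
    and "integral {c..d} (\<lambda>t. q t - \<omega>\<^sup>2) > 0 \<Longrightarrow> integral {c..d} (\<lambda>t. q t - \<omega>\<^sup>2) > \<omega> * cot (\<omega> * (d - c))"
    by blast+
qed

text \<open>The angle is strictly increasing, so it passes each multiple of \<pi>/2 exactly once;
  these instants are the zeros of u and u' in turn.\<close>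

lemma prufer_partition:
  fixes \<omega> :: real and m :: nat
  assumes p: "prufer c d q \<theta>" and q: "\<And>t. q t \<ge> \<omega>\<^sup>2" and cd: "c < d" and w: "\<omega> > 0"
    and t: "\<theta> c = 0" "\<theta> d = real m * pi"
  obtains z :: "nat \<Rightarrow> real" where "z 0 = c" "z (2 * m) = d" "\<And>i. i \<le> 2 * m \<Longrightarrow> z i \<in> {c..d}"
    "\<And>i. i \<le> 2 * m \<Longrightarrow> \<theta> (z i) = real i * (pi / 2)" "\<And>i. i < 2 * m \<Longrightarrow> z i < z (i + 1)"
proof -
  have w2: "\<omega>\<^sup>2 > 0" using w by simp
  note inc = prufer_strict_increasing[OF p q w2]
  have ex: "\<exists>s\<in>{c..d}. \<theta> s = real i * (pi / 2)" if "i \<le> 2 * m" for i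
  proof -
    have "real i * (pi / 2) \<le> real (2 * m) * (pi / 2)" using that by (intro mult_right_mono) auto
    then have "\<exists>s\<ge>c. s \<le> d \<and> \<theta> s = real i * (pi / 2)"
      using t cd by (intro IVT' prufer_cont[OF p]) auto
    then show ?thesis by auto
  qed
  define z where "z i = (SOME s. s \<in> {c..d} \<and> \<theta> s = real i * (pi / 2))" for i
  have z: "z i \<in> {c..d} \<and> \<theta> (z i) = real i * (pi / 2)" if "i \<le> 2 * m" for i
    unfolding z_def by (rule someI_ex) (use ex[OF that] in blast)
  have inj: "x = y" if "x \<in> {c..d}" "y \<in> {c..d}" "\<theta> x = \<theta> y" for x y
    using inc[of x y] inc[of y x] that by (cases x y rule: linorder_cases) auto
  show thesis
  proof (rule that)
    show "z 0 = c" by (rule inj) (use z[of 0] t cd in auto)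
    show "z (2 * m) = d" by (rule inj) (use z[of "2 * m"] t cd in auto)
    show "z i \<in> {c..d}" "\<theta> (z i) = real i * (pi / 2)" if "i \<le> 2 * m" for i using z[OF that] by auto
    show "z i < z (i + 1)" if i: "i < 2 * m" for i
    proof (rule ccontr)
      assume n: "\<not> z i < z (i + 1)"
      have zi: "z i \<in> {c..d}" "\<theta> (z i) = real i * (pi / 2)" "z (i + 1) \<in> {c..d}" "\<theta> (z (i + 1)) = real (i + 1) * (pi / 2)"
        using z[of i] z[of "i + 1"] i by auto
      have "\<theta> (z (i + 1)) \<le> \<theta> (z i)"
        using inc[of "z (i + 1)" "z i"] n zi by (cases "z (i + 1) = z i") auto
      then have "real (i + 1) * (pi / 2) \<le> real i * (pi / 2)" unfolding zi(2,4) .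
      then show False by (simp only: mult_le_cancel_right_pos[OF pi_half_gt_zero] of_nat_le_iff)
    qed
  qed
qed

lemma integral_partition:
  fixes f :: "real \<Rightarrow> real" and z :: "nat \<Rightarrow> real"
  assumes f: "f absolutely_integrable_on {c..d}" and z: "z 0 = c" "\<And>i. i \<le> N \<Longrightarrow> z i \<in> {c..d}" "\<And>i. i < N \<Longrightarrow> z i < z (i + 1)"
  shows "(\<Sum>i<N. integral {z i..z (i + 1)} f) = integral {c..z N} f"
  using z(2,3)
proof (induction N)
  case 0 then show ?case by (simp add: z(1))
next
  case (Suc N)
  have "integral {c..z (Suc N)} f = integral {c..z N} f + integral {z N..z (Suc N)} f"
    by (rule integral_split[OF abs_int_subinterval[OF f]])
      (use Suc.prems(1)[of N] Suc.prems(1)[of "Suc N"] Suc.prems(2)[of N] in auto)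
  then show ?case using Suc by simp
qed

text \<open>Summing the quarter wave estimates over the tangent line of \<open>cot\<close> at \<open>k \<pi> / (2 (k + 2))\<close>, the
  abscissa reached when all \<open>2 (k + 2)\<close> quarter waves have equal length.\<close>

lemma prufer_integral_lower_bound:
  fixes \<omega> :: real and k m :: nat
  assumes p: "prufer c d q \<theta>" and q: "q absolutely_integrable_on {c..d}" "\<And>t. q t \<ge> \<omega>\<^sup>2" and cd: "c < d" and w: "\<omega> > 0"
    and t: "\<theta> c = 0" "\<theta> d = real m * pi" and k: "k \<ge> 1" "\<omega> * (d - c) = real k * pi" and m: "m \<ge> k + 2"
    and pos: "integral {c..d} (\<lambda>t. q t - \<omega>\<^sup>2) > 0"
  shows "integral {c..d} (\<lambda>t. q t - \<omega>\<^sup>2) > \<omega> * (2 * (real k + 2) * cot (real k * pi / (2 * (real k + 2))))"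
proof -
  obtain z :: "nat \<Rightarrow> real" where z: "z 0 = c" "z (2 * m) = d" "\<And>i. i \<le> 2 * m \<Longrightarrow> z i \<in> {c..d}"
    "\<And>i. i \<le> 2 * m \<Longrightarrow> \<theta> (z i) = real i * (pi / 2)" "\<And>i. i < 2 * m \<Longrightarrow> z i < z (i + 1)"
    by (rule prufer_partition[OF p q(2) cd w t]) (rule that; assumption)
  define J where "J i = integral {z i..z (i + 1)} (\<lambda>t. q t - \<omega>\<^sup>2)" for i
  define g where "g i = \<omega> * (z (i + 1) - z i)" for i
  define y where "y = real k * pi / (2 * (real k + 2))"
  have y: "0 < y" "y < pi / 2" using k by (auto simp: y_def field_simps)
  have qi: "q absolutely_integrable_on {z i..z (i + 1)}" if "i < 2 * m" for i
    by (rule abs_int_subinterval[OF q(1)]) (use z(3)[of i] z(3)[of "i + 1"] that in auto)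
  have Q: "g i \<le> pi / 2" "J i \<ge> \<omega> * cot (g i)" "J i > 0 \<Longrightarrow> J i > \<omega> * cot (g i)" if i: "i < 2 * m" for i
  proof -
    have P: "prufer (z i) (z (i + 1)) q \<theta>"
      by (rule prufer_sub[OF p]) (use z(3)[of i] z(3)[of "i + 1"] i in auto)
    have e: "\<theta> (z i) = real i * (pi / 2)" "\<theta> (z (i + 1)) = real (i + 1) * (pi / 2)" using z(4) i by auto
    note QW = prufer_quarter_wave[OF P qi[OF i] q(2) z(5)[OF i] w e]
    show "g i \<le> pi / 2" "J i \<ge> \<omega> * cot (g i)" "J i > 0 \<Longrightarrow> J i > \<omega> * cot (g i)"
      unfolding g_def J_def by (rule QW(1), rule QW(2), rule QW(3))
  qed
  have g0: "g i > 0" if "i < 2 * m" for i using z(5)[OF that] w by (simp add: g_def)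
  have Jsum: "(\<Sum>i<2 * m. J i) = integral {c..d} (\<lambda>t. q t - \<omega>\<^sup>2)"
    unfolding J_def z(2)[symmetric]
    by (rule integral_partition[OF abs_int_diff_const[OF q(1)] z(1,3,5)])
  have gsum: "(\<Sum>i<2 * m. g i) = real k * pi"
  proof -
    have "(\<Sum>i<2 * m. g i) = \<omega> * (\<Sum>i<2 * m. z (Suc i) - z i)" by (simp add: g_def sum_distrib_left)
    also have "(\<Sum>i<2 * m. z (Suc i) - z i) = d - c" by (simp add: sum_lessThan_telescope z)
    finally show ?thesis using k(2) by simp
  qed
  define S where "S = 1 / (sin y)\<^sup>2"
  have S0: "S > 0" using sin_gt_zero[of y] y by (simp add: S_def)
  have tan: "cot y - (g i - y) * S \<le> cot (g i)" if "i < 2 * m" for i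
    using cot_tangent_le[of "g i" y] g0[OF that] Q(1)[OF that] y by (simp add: S_def)
  \<comment> \<open>Strict because the total excess is positive: at least one quarter wave has J i >
    0, and there the strict estimate holds.\<close>
  have "(\<Sum>i<2 * m. \<omega> * (cot y - (g i - y) * S)) < (\<Sum>i<2 * m. J i)"
  proof (rule sum_strict_mono_ex1)
    show "\<forall>i\<in>{..<2 * m}. \<omega> * (cot y - (g i - y) * S) \<le> J i"
      using Q(2) tan w by (meson lessThan_iff mult_left_mono order_trans less_imp_le)
    obtain i where i: "i < 2 * m" "J i > 0"
      using pos unfolding Jsum[symmetric] by (metis (no_types, lifting) lessThan_iff not_less sum_nonpos)
    have "\<omega> * (cot y - (g i - y) * S) \<le> \<omega> * cot (g i)" using tan[OF i(1)] w by simp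
    then show "\<exists>i\<in>{..<2 * m}. \<omega> * (cot y - (g i - y) * S) < J i"
      using Q(3)[OF i] i(1) by (intro bexI[of _ i]) auto
  qed simp
  also have "(\<Sum>i<2 * m. \<omega> * (cot y - (g i - y) * S)) = \<omega> * (real (2 * m) * (cot y + y * S) - (\<Sum>i<2 * m. g i) * S)"
    by (simp add: sum_distrib_left[symmetric] sum_distrib_right[symmetric] sum_subtractf algebra_simps)
  \<comment> \<open>k \<pi> = 2 (k + 2) y by the choice of y, so for m = k + 2 the slope terms
    cancel; a larger m only adds positive terms cot y + y S.\<close>
  also have "\<dots> = \<omega> * (real (2 * m) * (cot y + y * S) - (2 * (real k + 2) * y) * S)"
    unfolding gsum by (simp add: y_def)
  finally have 1: "\<omega> * (real (2 * m) * (cot y + y * S) - (2 * (real k + 2) * y) * S) < integral {c..d} (\<lambda>t. q t - \<omega>\<^sup>2)"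
    unfolding Jsum .
  have cy: "cot y > 0" using y by (intro cot_gt_zero) auto
  have "2 * (real k + 2) * (cot y + y * S) \<le> real (2 * m) * (cot y + y * S)"
    using m cy y S0 by (intro mult_right_mono) auto
  then have "\<omega> * (2 * (real k + 2) * cot y) \<le> \<omega> * (real (2 * m) * (cot y + y * S) - (2 * (real k + 2) * y) * S)"
    using w by (intro mult_left_mono) (auto simp: algebra_simps)
  with 1 show ?thesis by (simp add: y_def)
qed

section \<open>Constant potentials\<close>

lemma const_hill_sols:
  fixes \<omega> :: real
  assumes "\<omega> \<noteq> 0"
  shows "hill_sol a b (\<lambda>t. \<omega>\<^sup>2) (\<lambda>t. sin (\<omega> * t) / \<omega>) (\<lambda>t. cos (\<omega> * t))"
    and "hill_sol a b (\<lambda>t. \<omega>\<^sup>2) (\<lambda>t. cos (\<omega> * t)) (\<lambda>t. - \<omega> * sin (\<omega> * t))"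
  unfolding hill_sol_def using assms
  by (auto intro!: indef_int_C1 derivative_eq_intros continuous_intros simp: power2_eq_square)

text \<open>Two independent antiperiodic solutions are explicit, so the rotation does not depend on
  the start. Its value is read off at the start 0 by showing that the angle \<theta> stays within
  \<pi>/2 of \<omega> t.\<close>

lemma const_rot:
  fixes k :: nat
  assumes T: "T > 0" and k: "odd k" and w: "\<omega> = real k * pi / T"
  shows "rmin T (\<lambda>t. \<omega>\<^sup>2) = real k * pi" "rmax T (\<lambda>t. \<omega>\<^sup>2) = real k * pi"
proof -
  have k0: "k > 0" using k by (rule odd_pos)
  have w0: "\<omega> > 0" using T k0 by (simp add: w)
  have wT: "\<omega> * T = real k * pi" using T by (simp add: w)
  have sT: "sin (\<omega> * T) = 0" unfolding wT by simp
  have cT: "cos (\<omega> * T) = -1" unfolding wT using sin_cos_add_odd_pi(2)[of "int k" 0] k by simp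
  note ai = abs_int_const[where c = "\<omega>\<^sup>2" and a = 0 and b = T]
  have a: "antisol T (\<lambda>t. \<omega>\<^sup>2) (\<lambda>t. sin (\<omega> * t) / \<omega>) (\<lambda>t. cos (\<omega> * t))"
    "antisol T (\<lambda>t. \<omega>\<^sup>2) (\<lambda>t. cos (\<omega> * t)) (\<lambda>t. - \<omega> * sin (\<omega> * t))"
    using const_hill_sols[of \<omega> 0 T] w0 sT cT by (auto simp: antisol_def)
  have eq: "rmin T (\<lambda>t. \<omega>\<^sup>2) = rmax T (\<lambda>t. \<omega>\<^sup>2)"
    by (rule antisol_basis[OF T ai a]) simp
  obtain \<theta> where t: "prufer 0 T (\<lambda>t. \<omega>\<^sup>2) \<theta>" "\<theta> 0 = 0" "\<theta> T = pangle T (\<lambda>t. \<omega>\<^sup>2) 0" by (rule pangle_ex[OF T ai])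
  obtain r where r: "\<forall>t. r t > 0" "r 0 = 1" "hill_sol 0 T (\<lambda>t. \<omega>\<^sup>2) (\<lambda>t. r t * sin (\<theta> t)) (\<lambda>t. r t * cos (\<theta> t))"
    by (rule hill_sol_polar[OF t(1) ai])
  have uv: "r t * sin (\<theta> t) = sin (\<omega> * t) / \<omega>" "r t * cos (\<theta> t) = cos (\<omega> * t)" if "t \<in> {0..T}" for t
    using hill_sol_unique[OF r(3) const_hill_sols(1) ai _ _ that] w0 r(2) t(2) by auto
  define \<delta> where "\<delta> t = \<theta> t - \<omega> * t" for t
  \<comment> \<open>r cos \<delta> = cos^2 (\<omega> t) + sin^2 (\<omega> t) / \<omega> is positive,
    so \<delta>, which starts at 0, never reaches \<pi>/2 in modulus.\<close>
  have cd: "cos (\<delta> t) > 0" if "t \<in> {0..T}" for t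
  proof -
    have "r t * cos (\<delta> t) = (r t * cos (\<theta> t)) * cos (\<omega> * t) + (r t * sin (\<theta> t)) * sin (\<omega> * t)"
      by (simp add: \<delta>_def cos_diff algebra_simps)
    also have "\<dots> = (cos (\<omega> * t))\<^sup>2 + (sin (\<omega> * t))\<^sup>2 / \<omega>" unfolding uv[OF that] by (simp add: power2_eq_square)
    also have "\<dots> > 0"
    proof (cases "sin (\<omega> * t) = 0")
      case True
      then have "cos (\<omega> * t) \<noteq> 0" using sin_zero_abs_cos_one by fastforce
      then show ?thesis using True by simp
    next
      case False then show ?thesis using w0 by (simp add: add_nonneg_pos)
    qed
    finally show ?thesis using r(1) by (simp add: zero_less_mult_iff) (metis not_less_iff_gr_or_eq)
  qed
  have dc: "continuous_on {0..T} \<delta>" unfolding \<delta>_def by (intro continuous_intros prufer_cont[OF t(1)])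
  have d: "\<bar>\<delta> T\<bar> < pi / 2"
  proof (rule ccontr)
    assume n: "\<not> ?thesis"
    have "\<exists>s\<in>{0..T}. \<delta> s = pi / 2 \<or> \<delta> s = - (pi / 2)"
    proof (cases "\<delta> T \<ge> 0")
      case True
      then have "\<exists>s\<ge>0. s \<le> T \<and> \<delta> s = pi / 2" using n T t(2) by (intro IVT' dc) (auto simp: \<delta>_def)
      then show ?thesis by auto
    next
      case False
      then have "\<exists>s\<ge>0. s \<le> T \<and> \<delta> s = - (pi / 2)" using n T t(2) by (intro IVT2' dc) (auto simp: \<delta>_def)
      then show ?thesis by auto
    qed
    then obtain s where s: "s \<in> {0..T}" "\<delta> s = pi / 2 \<or> \<delta> s = - (pi / 2)" by blast
    then have "cos (\<delta> s) = 0" by (metis cos_pi_half cos_minus)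
    then show False using cd[OF s(1)] by simp
  qed
  have "sin (\<theta> T) = 0"
  proof -
    have "r T * sin (\<theta> T) = 0" using uv(1)[of T] T sT by simp
    then show ?thesis using r(1) by (metis less_irrefl mult_eq_0_iff)
  qed
  then obtain j :: int where j: "\<theta> T = of_int j * pi" using sin_zero_iff_int2 by auto
  \<comment> \<open>A multiple of \<pi> of modulus below \<pi> is zero, which fixes j = k.\<close>
  have "\<delta> T = of_int (j - int k) * pi" by (simp add: \<delta>_def wT j left_diff_distrib)
  then have "\<bar>of_int (j - int k) * pi\<bar> < 1 * pi"
    using d pi_gt_zero by linarith
  then have "\<bar>of_int (j - int k) :: real\<bar> < 1"
    unfolding abs_mult by (simp only: abs_of_pos[OF pi_gt_zero] mult_less_cancel_right_pos[OF pi_gt_zero])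
  then have "j = int k" by linarith
  then have "rot T (\<lambda>t. \<omega>\<^sup>2) 0 = real k * pi" using t j by (simp add: rot_def)
  then show "rmin T (\<lambda>t. \<omega>\<^sup>2) = real k * pi" "rmax T (\<lambda>t. \<omega>\<^sup>2) = real k * pi"
    using rot_rmax[OF T ai, of 0] rot_rmin[OF T ai, of 0] eq by auto
qed

section \<open>The lower bound over one full period\<close>

lemma abs_int_shift:
  fixes f :: "real \<Rightarrow> real"
  shows "(\<lambda>x. f (x + c)) absolutely_integrable_on {a - c..b - c} \<longleftrightarrow> f absolutely_integrable_on {a..b}"
  unfolding absolutely_integrable_on_def
  using integrable_shift_real_ivl_iff[of f c a b] integrable_shift_real_ivl_iff[of "\<lambda>x. norm (f x)" c a b] by simp

lemma prufer_shift:
  assumes p: "prufer a b q \<theta>"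
  shows "prufer (a - c) (b - c) (\<lambda>t. q (t + c)) (\<lambda>t. \<theta> (t + c))"
  unfolding prufer_def
proof (rule indef_intI)
  let ?f = "\<lambda>t. 1 + (q t - 1) * (sin (\<theta> t))\<^sup>2"
  note p = p[unfolded prufer_def]
  show "(\<lambda>t. 1 + (q (t + c) - 1) * (sin (\<theta> (t + c)))\<^sup>2) absolutely_integrable_on {a - c..b - c}"
    using indef_int_abs_int[OF p] abs_int_shift[where f = ?f and c = c and a = a and b = b] by simp
  fix t assume t: "t \<in> {a - c..b - c}"
  have "\<theta> (t + c) = \<theta> a + integral {a..t + c} ?f" by (rule indef_intD[OF p]) (use t in auto)
  also have "integral {a..t + c} ?f = integral {a - c..t} (\<lambda>t. ?f (t + c))"
    using integral_shift_real_ivl[of a c "t + c" ?f] by simp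
  finally show "\<theta> (t + c) = \<theta> (a - c + c) + integral {a - c..t} (\<lambda>t. 1 + (q (t + c) - 1) * (sin (\<theta> (t + c)))\<^sup>2)" by simp
qed

lemma abs_int_union:
  fixes f :: "real \<Rightarrow> real"
  assumes "f absolutely_integrable_on {a..b}" "f absolutely_integrable_on {b..c}" "a \<le> b" "b \<le> c"
  shows "f absolutely_integrable_on {a..c}"
proof -
  have "{a..b} \<union> {b..c} = {a..c}" using assms by auto
  then show ?thesis using set_integrable_Un[OF assms(1,2)] by simp
qed

text \<open>The rotation exceeds that of the constant \<omega>^2, namely k \<pi>, and is an odd
  multiple of \<pi>; as k is odd, the next candidate is k + 2.\<close>

lemma antisol_rot_ge:
  fixes k :: nat and \<omega> :: real
  assumes T: "T > 0" and k: "odd k" and w: "\<omega> = real k * pi / T"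
    and q: "q absolutely_integrable_on {0..T}" "\<And>t. q t \<ge> \<omega>\<^sup>2"
    and pos: "integral {0..T} (\<lambda>t. q t - \<omega>\<^sup>2) > 0"
    and a: "antisol T q u v" "u 0 = c * sin \<alpha>" "v 0 = c * cos \<alpha>" "c \<noteq> 0"
  obtains m :: nat where "odd m" "m \<ge> k + 2" "pangle T q \<alpha> = \<alpha> + real m * pi"
proof -
  obtain j :: int where j: "odd j" "rot T q \<alpha> = of_int j * pi" using antisol_rot[OF T q(1) a] by blast
  have "rot T (\<lambda>t. \<omega>\<^sup>2) \<alpha> < rot T q \<alpha>"
    by (rule rot_mono(2)[OF T abs_int_const q(1) q(2) pos])
  then have "real k * pi < of_int j * pi"
    using rot_rmin[OF T abs_int_const[where c = "\<omega>\<^sup>2" and a = 0 and b = T], of \<alpha>] const_rot(1)[OF T k w] j(2) by linarith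
  then have "real k < of_int j" by (simp only: mult_less_cancel_right_pos[OF pi_gt_zero])
  then have "int k < j" by linarith
  moreover have "j \<noteq> int k + 1" using j(1) k by auto
  ultimately have "j \<ge> int (k + 2)" by simp
  then show thesis
    using j by (intro that[of "nat j"]) (auto simp: rot_def even_nat_iff le_nat_iff)
qed

text \<open>The quarter wave bound needs a window that starts at a zero of u, which need not be at
  0. The angle is continued over two periods, where periodicity of q gives \<theta>(t + T) =
  \<theta>(t) + m \<pi>; a window of length T starting at a zero then has the same rotation and the
  same integral.\<close>

lemma antisol_lower_bound:
  fixes k :: nat and \<omega> :: real
  assumes T: "T > 0" and k: "odd k" and w: "\<omega> = real k * pi / T"
    and per: "\<And>t. q (t + T) = q t" and q: "q absolutely_integrable_on {0..T}" "\<And>t. q t \<ge> \<omega>\<^sup>2"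
    and pos: "integral {0..T} (\<lambda>t. q t - \<omega>\<^sup>2) > 0"
    and a: "antisol T q u v" "u 0 \<noteq> 0 \<or> v 0 \<noteq> 0"
  shows "integral {0..T} (\<lambda>t. q t - \<omega>\<^sup>2) > \<omega> * (2 * (real k + 2) * cot (real k * pi / (2 * (real k + 2))))"
proof -
  have k0: "k \<ge> 1" using odd_pos[OF k] by simp
  have w0: "\<omega> > 0" using T k0 by (simp add: w)
  obtain c \<alpha> where c: "u 0 = c * sin \<alpha>" "v 0 = c * cos \<alpha>" by (rule polar_coords)
  then have "c \<noteq> 0" using a(2) by auto
  then obtain m :: nat where m: "m \<ge> k + 2" "pangle T q \<alpha> = \<alpha> + real m * pi"
    by (rule antisol_rot_ge[OF T k w q pos a(1) c])
  have q': "q absolutely_integrable_on {T..2 * T}"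
    using q(1) abs_int_shift[where f = q and c = T and a = T and b = "2 * T"] by (simp add: per)
  have q2: "q absolutely_integrable_on {0..2 * T}" by (rule abs_int_union[OF q(1) q']) (use T in auto)
  obtain \<theta> where p: "prufer 0 (2 * T) q \<theta>" "\<theta> 0 = \<alpha>" using prufer_exists[OF q2, of \<alpha>] T by auto
  have pT: "prufer 0 T q \<theta>" by (rule prufer_sub[OF p(1)]) (use T in auto)
  have \<theta>T: "\<theta> T = \<alpha> + real m * pi" using pangle_eq[OF T q(1) pT] p(2) m(2) by simp
  have "prufer (T - T) (2 * T - T) (\<lambda>t. q (t + T)) (\<lambda>t. \<theta> (t + T))"
    by (rule prufer_shift[OF prufer_sub[OF p(1)]]) (use T in auto)
  then have p2: "prufer 0 T q (\<lambda>t. \<theta> (t + T))" by (simp add: per)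
  have tr: "\<theta> (t + T) = \<theta> t + real m * pi" if "t \<in> {0..T}" for t
    using prufer_unique[OF p2 prufer_add_pi[OF pT, of "int m"] q(1) _ that] \<theta>T p(2) by simp
  \<comment> \<open>The first multiple of \<pi> at or above the start; the gain m \<pi> \<ge> \<pi>
    over [0, T] ensures that it is met there.\<close>
  obtain l :: int where l: "\<alpha> \<le> 0 + of_int l * pi" "0 + of_int l * pi < \<alpha> + pi" by (rule mod_pi)
  have "\<exists>s\<ge>0. s \<le> T \<and> \<theta> s = of_int l * pi"
  proof (rule IVT'[OF _ _ _ prufer_cont[OF pT]])
    have "1 * pi \<le> real m * pi" using m(1) by (intro mult_right_mono) auto
    then show "of_int l * pi \<le> \<theta> T" using l \<theta>T by linarith
  qed (use l p(2) T in auto)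
  then obtain s where s: "s \<in> {0..T}" "\<theta> s = of_int l * pi" by auto
  have P: "prufer s (s + T) q (\<lambda>t. \<theta> t + of_int (- l) * pi)"
    by (rule prufer_add_pi[OF prufer_sub[OF p(1)]]) (use s in auto)
  have z: "\<theta> s + of_int (- l) * pi = 0" "\<theta> (s + T) + of_int (- l) * pi = real m * pi" using s tr[OF s(1)] by auto
  have qs: "q absolutely_integrable_on {s..s + T}" by (rule abs_int_subinterval[OF q2]) (use s in auto)
  let ?g = "\<lambda>t. q t - \<omega>\<^sup>2"
  have g2: "?g absolutely_integrable_on {0..2 * T}" by (rule abs_int_diff_const[OF q2])
  have eqI: "integral {s..s + T} ?g = integral {0..T} ?g"
  proof -
    have "integral {s..s + T} ?g = integral {s..T} ?g + integral {T..s + T} ?g"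
      by (rule integral_split[OF abs_int_subinterval[OF g2]]) (use s in auto)
    also have "integral {T..s + T} ?g = integral {0..s} ?g"
      using integral_shift_real_ivl[of T T "s + T" ?g] by (simp add: per)
    also have "integral {s..T} ?g + integral {0..s} ?g = integral {0..T} ?g"
      using integral_split[OF abs_int_subinterval[OF g2, of 0 T], of s] s T by simp
    finally show ?thesis .
  qed
  have "\<omega> * (s + T - s) = real k * pi" using T by (simp add: w)
  from prufer_integral_lower_bound[OF P qs q(2) _ w0 z k0 this m(1)] T pos
  show ?thesis unfolding eqI by simp
qed

subsection \<open>Potentials above the eigenvalue\<close>

lemma indef_int_spike:
  assumes F: "indef_int a b F f" and N: "negligible N" and e: "\<And>t. t \<in> {a..b} - N \<Longrightarrow> g t = f t"
  shows "indef_int a b F g"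
proof (rule indef_intI)
  show "g absolutely_integrable_on {a..b}"
    by (rule absolutely_integrable_spike[OF indef_int_abs_int[OF F] N e])
  fix t assume t: "t \<in> {a..b}"
  have "integral {a..t} f = integral {a..t} g" by (rule integral_spike[OF N]) (use e t in auto)
  then show "F t = F a + integral {a..t} g" using indef_intD[OF F t] by simp
qed

lemma hill_sol_spike:
  assumes "hill_sol a b q1 u v" "negligible N" "\<And>t. t \<in> {a..b} - N \<Longrightarrow> q1 t = q2 t"
  shows "hill_sol a b q2 u v"
  using assms(1) indef_int_spike[OF _ assms(2), of a b v "\<lambda>t. - (q1 t * u t)" "\<lambda>t. - (q2 t * u t)"] assms(3)
  by (simp add: hill_sol_def)

lemma AE_lebesgue_iff_negligible: "(AE t in lebesgue. P t) \<longleftrightarrow> negligible {t. \<not> P t}"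
  by (simp add: completion.AE_iff_null_sets negligible_iff_null_sets)

text \<open>Positive measure is traded for non-negligibility; both agree because the set is
  measurable.\<close>

lemma prec_ae_const_iff:
  assumes a: "a absolutely_integrable_on {0..T}"
  shows "prec_ae T (\<lambda>_. c) a \<longleftrightarrow> negligible {t \<in> {0..T}. \<not> c \<le> a t} \<and> \<not> negligible {t \<in> {0..T}. c < a t}"
proof -
  have "{t. \<not> (t \<in> {0..T} \<longrightarrow> c \<le> a t)} = {t \<in> {0..T}. \<not> c \<le> a t}" by blast
  then have 1: "(AE t in lebesgue. t \<in> {0..T} \<longrightarrow> c \<le> a t) \<longleftrightarrow> negligible {t \<in> {0..T}. \<not> c \<le> a t}"
    by (simp only: AE_lebesgue_iff_negligible)
  have "a \<in> borel_measurable (lebesgue_on {0..T})"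
    by (rule absolutely_integrable_imp_borel_measurable[OF a]) simp
  then have "{t \<in> space (lebesgue_on {0..T}). c < a t} \<in> sets (lebesgue_on {0..T})"
    by (intro borel_measurable_less) auto
  then have "{t \<in> {0..T}. c < a t} \<in> sets lebesgue" by (subst (asm) sets_restrict_space_iff) auto
  then have "negligible {t \<in> {0..T}. c < a t} \<longleftrightarrow> emeasure lebesgue {t \<in> {0..T}. c < a t} = 0"
    by (rule negligible_iff_emeasure0)
  then show ?thesis unfolding prec_ae_def 1 by (simp add: zero_less_iff_neq_zero)
qed

lemma prec_ae_constI:
  fixes a :: "real \<Rightarrow> real"
  assumes a: "a absolutely_integrable_on {0..T}" and N: "negligible N" "\<And>t. t \<in> {0..T} - N \<Longrightarrow> c \<le> a t"
    and p: "integral {0..T} (\<lambda>t. a t - c) > 0"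
  shows "prec_ae T (\<lambda>_. c) a"
  unfolding prec_ae_const_iff[OF a]
proof
  show "negligible {t \<in> {0..T}. \<not> c \<le> a t}" by (rule negligible_subset[OF N(1)]) (use N(2) in auto)
  show "\<not> negligible {t \<in> {0..T}. c < a t}"
  proof
    assume "negligible {t \<in> {0..T}. c < a t}"
    then have n: "negligible (N \<union> {t \<in> {0..T}. c < a t})" using N(1) by (intro negligible_Un)
    have "integral {0..T} (\<lambda>t. a t - c) = integral {0..T} (\<lambda>t. 0)"
      by (rule integral_spike[OF n]) (use N(2) in force)
    then show False using p by simp
  qed
qed

text \<open>Truncating the potential from below changes it only on a null set, so that pointwise
  bounds may be assumed everywhere.\<close>

lemma L_per_truncate:
  assumes T: "T > 0" and a: "a \<in> L_per T" and p: "prec_ae T (\<lambda>_. c) a" and c: "c \<ge> 0"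
  obtains b where "\<forall>t. b (t + T) = b t" "b absolutely_integrable_on {0..T}" "\<forall>t. c \<le> b t"
    "integral {0..T} (\<lambda>t. b t - c) > 0" "integral {0..T} b = L1_norm T a"
    "\<forall>\<mu> u v. antiper_sol T (\<lambda>t. \<mu> + a t) u v \<longleftrightarrow> antiper_sol T (\<lambda>t. \<mu> + b t) u v"
proof -
  define b where "b t = max c (a t)" for t
  define N where "N = {t \<in> {0..T}. \<not> c \<le> a t}"
  have aa: "a absolutely_integrable_on {0..T}" and per: "\<And>t. a (t + T) = a t" using a by (auto simp: L_per_def)
  note P = p[unfolded prec_ae_const_iff[OF aa]]
  have N: "negligible N" using P by (simp add: N_def)
  have e: "b t = a t" if "t \<in> {0..T} - N" for t using that by (auto simp: b_def N_def)
  have ba: "b absolutely_integrable_on {0..T}" by (rule absolutely_integrable_spike[OF aa N e])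
  have bc: "c \<le> b t" for t by (simp add: b_def)
  note bca = abs_int_diff_const[OF ba, of c]
  have pos: "integral {0..T} (\<lambda>t. b t - c) > 0"
  proof (rule ccontr)
    assume n: "\<not> ?thesis"
    have "integral {0..T} (\<lambda>t. b t - c) \<ge> 0"
      by (rule integral_nonneg[OF abs_int_imp_int[OF bca]]) (use bc in simp)
    then have "integral {0..T} (\<lambda>t. b t - c) = 0" using n by simp
    then have "negligible {t \<in> {0..T}. b t - c \<noteq> 0}"
      by (intro nonneg_integral_zero_negligible[OF bca]) (use bc in simp_all)
    then have "negligible {t \<in> {0..T}. c < a t}"
      by (rule negligible_subset) (auto simp: b_def)
    then show False using P by simp
  qed
  have "integral {0..T} b = integral {0..T} (\<lambda>t. \<bar>a t\<bar>)"
  proof (rule integral_spike[OF N])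
    fix t assume t: "t \<in> {0..T} - N"
    \<comment> \<open>As c \<ge> 0, the truncated potential is nonnegative, so its integral is the
      norm.\<close>
    show "\<bar>a t\<bar> = b t" using e[OF t] bc[of t] c by simp
  qed
  then have L: "integral {0..T} b = L1_norm T a" by (simp add: L1_norm_def)
  have s: "antiper_sol T (\<lambda>t. \<mu> + a t) u v \<longleftrightarrow> antiper_sol T (\<lambda>t. \<mu> + b t) u v" for \<mu> u v
    unfolding antiper_sol_iff_antisol[OF T shifted_abs_int[OF T aa]] antiper_sol_iff_antisol[OF T shifted_abs_int[OF T ba]] antisol_def
    using hill_sol_spike[OF _ N, of 0 T "\<lambda>t. \<mu> + a t" u v "\<lambda>t. \<mu> + b t"]
      hill_sol_spike[OF _ N, of 0 T "\<lambda>t. \<mu> + b t" u v "\<lambda>t. \<mu> + a t"] e by auto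
  show thesis
    by (rule that[of b]) (use per ba bc pos L s in \<open>auto simp: b_def\<close>)
qed

lemma antiper_eig_cong:
  assumes "\<forall>\<mu> u v. antiper_sol T (\<lambda>t. \<mu> + a t) u v \<longleftrightarrow> antiper_sol T (\<lambda>t. \<mu> + b t) u v"
  shows "antiper_eig T a j = antiper_eig T b j"
  unfolding antiper_eig_def antiper_eigenvalue_def antiper_mult_def nontriv_antiper_sol_def
  using assms by simp

text \<open>In polar form u vanishes when the angle is an even multiple of \<pi>/2 and u' when it is
  an odd one; since the angle increases strictly from 0 to m \<pi>, these instants are exactly the
  partition points.\<close>

lemma antisol_interlaced:
  fixes m :: nat and \<omega> :: real
  assumes T: "T > 0" and q: "q absolutely_integrable_on {0..T}" "\<And>t. q t \<ge> \<omega>\<^sup>2" and w: "\<omega> > 0"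
    and a: "antisol T q u v" "u 0 = 0" "v 0 \<noteq> 0" and m: "pangle T q 0 = real m * pi"
  obtains t where "interlaced_zeros T u v m t" "\<forall>i<2 * m. \<omega> * (t (i + 1) - t i) \<le> pi / 2"
proof -
  obtain \<theta> where th: "prufer 0 T q \<theta>" "\<theta> 0 = 0" "\<theta> T = pangle T q 0" by (rule pangle_ex[OF T q(1)])
  obtain r where r: "\<forall>t. r t > 0" "r 0 = 1" "hill_sol 0 T q (\<lambda>t. r t * sin (\<theta> t)) (\<lambda>t. r t * cos (\<theta> t))"
    by (rule hill_sol_polar[OF th(1) q(1)])
  have h: "hill_sol 0 T q u v" using a(1) by (simp add: antisol_def)
  have uv: "u s = v 0 * (r s * sin (\<theta> s))" "v s = v 0 * (r s * cos (\<theta> s))" if "s \<in> {0..T}" for s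
    using hill_sol_eq_comb[OF h r(3) r(3) q(1) _ _ that, of "v 0" 0] a(2) th(2) r(2) by auto
  have rn: "r s \<noteq> 0" for s using r(1) less_irrefl by metis
  have u0: "u s = 0 \<longleftrightarrow> sin (\<theta> s) = 0" "v s = 0 \<longleftrightarrow> cos (\<theta> s) = 0" if "s \<in> {0..T}" for s
    unfolding uv[OF that] using a(3) rn by auto
  have thT: "\<theta> T = real m * pi" using th m by simp
  obtain z :: "nat \<Rightarrow> real" where z: "z 0 = 0" "z (2 * m) = T" "\<And>i. i \<le> 2 * m \<Longrightarrow> z i \<in> {0..T}"
    "\<And>i. i \<le> 2 * m \<Longrightarrow> \<theta> (z i) = real i * (pi / 2)" "\<And>i. i < 2 * m \<Longrightarrow> z i < z (i + 1)"
    by (rule prufer_partition[OF th(1) q(2) T w th(2) thT]) (rule that; assumption)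
  have w2: "\<omega>\<^sup>2 > 0" using w by simp
  note inc = prufer_strict_increasing[OF th(1) q(2) w2]
  have inj: "x = y" if "x \<in> {0..T}" "y \<in> {0..T}" "\<theta> x = \<theta> y" for x y
    using inc[of x y] inc[of y x] that by (cases x y rule: linorder_cases) auto
  have range: "0 \<le> \<theta> s \<and> \<theta> s \<le> real m * pi" if "s \<in> {0..T}" for s
    using inc[of 0 s] inc[of s T] that th(2) thT by (cases "s = 0"; cases "s = T") auto
  \<comment> \<open>An instant at which the angle is an integer multiple of \<pi>/2 is a partition
    point: the range of the angle puts the integer between 0 and 2 m, so \<open>nat j\<close> loses
    nothing.\<close>
  have hit: "\<exists>i\<le>2 * m. i = nat j \<and> s = z i" if s: "s \<in> {0..T}" and j: "\<theta> s = of_int j * (pi / 2)" for s j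
  proof -
    have "0 * (pi / 2) \<le> of_int j * (pi / 2)" "of_int j * (pi / 2) \<le> real (2 * m) * (pi / 2)"
      using range[OF s] j by simp_all
    then have "0 \<le> (of_int j :: real)" "of_int j \<le> real (2 * m)"
      by (simp_all only: mult_le_cancel_right_pos[OF pi_half_gt_zero])
    then have jj: "0 \<le> j" "nat j \<le> 2 * m" by linarith+
    have "\<theta> (z (nat j)) = \<theta> s" using z(4)[OF jj(2)] j jj(1) by simp
    then have "s = z (nat j)" using inj[OF s z(3)[OF jj(2)]] by simp
    then show ?thesis using jj by blast
  qed
  have zeros: "z ` {i. i \<le> 2 * m \<and> even i} = {s \<in> {0..T}. u s = 0}"
  proof (intro equalityI subsetI)
    fix s assume "s \<in> z ` {i. i \<le> 2 * m \<and> even i}"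
    then obtain i where i: "i \<le> 2 * m" "even i" "s = z i" by blast
    from i(2) obtain l where l: "i = 2 * l" by (rule evenE)
    have "\<theta> s = real l * pi" using z(4)[OF i(1)] i(3) by (simp add: l)
    then show "s \<in> {s \<in> {0..T}. u s = 0}" using z(3)[OF i(1)] i(3) u0(1)[of s] by simp
  next
    fix s assume s: "s \<in> {s \<in> {0..T}. u s = 0}"
    then have "sin (\<theta> s) = 0" using u0(1) by blast
    then obtain j :: int where "\<theta> s = of_int j * pi" using sin_zero_iff_int2 by blast
    then have e: "\<theta> s = of_int (2 * j) * (pi / 2)" by simp
    have "s \<in> {0..T}" using s by simp
    from hit[OF this e] obtain i where "i \<le> 2 * m" "i = nat (2 * j)" "s = z i" by blast
    moreover have "even (nat (2 * j))" by (cases "j \<ge> 0") (auto simp: even_nat_iff)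
    ultimately show "s \<in> z ` {i. i \<le> 2 * m \<and> even i}" by blast
  qed
  have dzeros: "z ` {i. i \<le> 2 * m \<and> odd i} = {s \<in> {0<..<T}. v s = 0}"
  proof (intro equalityI subsetI)
    fix s assume "s \<in> z ` {i. i \<le> 2 * m \<and> odd i}"
    then obtain i where i: "i \<le> 2 * m" "odd i" "s = z i" by blast
    have "\<theta> s = of_int (int i) * (pi / 2)" using z(4)[OF i(1)] i(3) by simp
    moreover have "odd (int i)" using i(2) by simp
    ultimately have "cos (\<theta> s) = 0" unfolding cos_zero_iff_int by blast
    \<comment> \<open>At both ends the angle is a multiple of \<pi>, where cos is 1 or -1.\<close>
    moreover from this have "s \<noteq> 0" "s \<noteq> T" using th(2) thT by (auto simp: cos_npi)
    ultimately show "s \<in> {s \<in> {0<..<T}. v s = 0}" using z(3)[OF i(1)] i(3) u0(2)[of s] by auto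
  next
    fix s assume s: "s \<in> {s \<in> {0<..<T}. v s = 0}"
    then have "cos (\<theta> s) = 0" using u0(2)[of s] by auto
    from this[unfolded cos_zero_iff_int] obtain j :: int
      where j: "odd j" "\<theta> s = of_int j * (pi / 2)" by (elim exE conjE) (rule that)
    have "s \<in> {0..T}" using s by simp
    from hit[OF this j(2)] obtain i where i: "i \<le> 2 * m" "i = nat j" "s = z i" by blast
    have "odd i"
    proof (cases "j \<ge> 0")
      case True then show ?thesis using i(2) j(1) by (simp add: even_nat_iff)
    next
      \<comment> \<open>Here \<open>nat j\<close> is 0, so s = z 0 = 0, which the open interval
        excludes.\<close>
      case False then show ?thesis using i s z(1) by simp
    qed
    then show "s \<in> z ` {i. i \<le> 2 * m \<and> odd i}" using i by blast
  qed
  have gaps: "\<omega> * (z (i + 1) - z i) \<le> pi / 2" if i: "i < 2 * m" for i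
  proof -
    have zi: "z i \<in> {0..T}" "z (i + 1) \<in> {0..T}" using z(3) i by auto
    have P: "prufer (z i) (z (i + 1)) q \<theta>" by (rule prufer_sub[OF th(1)]) (use zi in auto)
    have Q: "q absolutely_integrable_on {z i..z (i + 1)}" by (rule abs_int_subinterval[OF q(1)]) (use zi in auto)
    have e: "\<theta> (z i) = real i * (pi / 2)" "\<theta> (z (i + 1)) = real (i + 1) * (pi / 2)" using z(4) i by auto
    show ?thesis by (rule prufer_quarter_wave(1)[OF P Q q(2) z(5)[OF i] w e])
  qed
  show thesis
    by (rule that[of z]) (use z zeros dzeros gaps in \<open>auto simp: interlaced_zeros_def\<close>)
qed

section \<open>Zeros, lower bound and eigenvalue gap for a fixed index\<close>

context
  fixes T \<omega> :: real and n k :: nat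
  assumes T: "T > 0" and n: "n \<ge> 1" and k: "k = 2 * n - 1" and w: "\<omega> = real k * pi / T"
begin

lemma k_facts: "odd k" "k \<ge> 1" "real k = 2 * real n - 1" "k + 2 = 2 * n + 1" "\<omega> > 0" "\<omega> * T = real k * pi"
  using n T by (auto simp: k w of_nat_diff)

text \<open>The eigenvalue numbered 2 i + 1 belongs to the level (2 i + 1) \<pi> of the maximal
  rotation; here i = n - 1, and the constant \<omega>^2 rotates by exactly k \<pi>.\<close>

lemma antiper_eig0_eq: "antiper_eig0 T (2 * n - 1) = \<omega>\<^sup>2"
proof -
  have e: "2 * (n - 1) + 1 = k" "2 * real (n - 1) + 1 = real k" using n by (auto simp: k of_nat_diff)
  have "rmax T (\<lambda>t. \<omega>\<^sup>2 + 0) = (2 * real (n - 1) + 1) * pi"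
    using const_rot(2)[OF T k_facts(1) w] unfolding e(2) by simp
  from antiper_eig_odd[OF T abs_int_const this] show ?thesis unfolding e(1) k .
qed

lemma Lambda_antiper_iff:
  "a \<in> Lambda_antiper T n \<longleftrightarrow> a \<in> L_per T \<and> prec_ae T (\<lambda>_. \<omega>\<^sup>2) a \<and> (\<exists>u u'. nontriv_antiper_sol T a u u')"
  unfolding Lambda_antiper_def antiper_eig0_eq by simp

lemma Lambda_truncate:
  assumes "a \<in> L_per T" "prec_ae T (\<lambda>_. \<omega>\<^sup>2) a"
  obtains b where "\<forall>t. b (t + T) = b t" "b absolutely_integrable_on {0..T}" "\<forall>t. \<omega>\<^sup>2 \<le> b t"
    "integral {0..T} (\<lambda>t. b t - \<omega>\<^sup>2) > 0" "integral {0..T} b = L1_norm T a"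
    "\<forall>u v. nontriv_antiper_sol T a u v \<longleftrightarrow> antisol T b u v \<and> (u 0 \<noteq> 0 \<or> v 0 \<noteq> 0)"
    "\<forall>j. antiper_eig T a j = antiper_eig T b j"
proof -
  obtain b where b: "\<forall>t. b (t + T) = b t" "b absolutely_integrable_on {0..T}" "\<forall>t. \<omega>\<^sup>2 \<le> b t"
    "integral {0..T} (\<lambda>t. b t - \<omega>\<^sup>2) > 0" "integral {0..T} b = L1_norm T a"
    and s: "\<forall>\<mu> u v. antiper_sol T (\<lambda>t. \<mu> + a t) u v \<longleftrightarrow> antiper_sol T (\<lambda>t. \<mu> + b t) u v"
    by (rule L_per_truncate[OF T assms zero_le_power2]) (rule that; assumption)
  have "nontriv_antiper_sol T a u v \<longleftrightarrow> antisol T b u v \<and> (u 0 \<noteq> 0 \<or> v 0 \<noteq> 0)" for u v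
    using s[rule_format, of 0 u v] nontriv_antiper_sol_iff[OF T b(2), of u v] by (simp add: nontriv_antiper_sol_def)
  then show thesis using antiper_eig_cong[OF s] b by (intro that[of b]) blast+
qed

text \<open>The claimed infimum in terms of \<omega> and k: T \<omega>^2 plus the least excess, that
  of 2 (k + 2) quarter waves of equal length.\<close>

definition gamma_val :: real where
  "gamma_val = T * \<omega>\<^sup>2 + \<omega> * (2 * (real k + 2) * cot (real k * pi / (2 * (real k + 2))))"

lemma integral_minus_omega:
  assumes "b absolutely_integrable_on {0..T}"
  shows "integral {0..T} (\<lambda>t. b t - \<omega>\<^sup>2) = integral {0..T} b - T * \<omega>\<^sup>2"
  using integral_diff_abs[OF assms abs_int_const[where c = "\<omega>\<^sup>2"]] T by simp

text \<open>Strictness serves two purposes: it bounds the infimum from below and shows that no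
  element attains it.\<close>

lemma Lambda_norm_gt:
  assumes a: "a \<in> Lambda_antiper T n"
  shows "L1_norm T a > gamma_val"
proof -
  obtain u v where uv: "nontriv_antiper_sol T a u v" and a: "a \<in> L_per T" "prec_ae T (\<lambda>_. \<omega>\<^sup>2) a"
    using a unfolding Lambda_antiper_iff by blast
  obtain b where b: "\<forall>t. b (t + T) = b t" "b absolutely_integrable_on {0..T}" "\<forall>t. \<omega>\<^sup>2 \<le> b t"
    "integral {0..T} (\<lambda>t. b t - \<omega>\<^sup>2) > 0" "integral {0..T} b = L1_norm T a"
    "\<forall>u v. nontriv_antiper_sol T a u v \<longleftrightarrow> antisol T b u v \<and> (u 0 \<noteq> 0 \<or> v 0 \<noteq> 0)"
    by (rule Lambda_truncate[OF a]) (rule that; assumption)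
  have "antisol T b u v" "u 0 \<noteq> 0 \<or> v 0 \<noteq> 0" using uv b(6) by blast+
  from antisol_lower_bound[OF T k_facts(1) w b(1)[rule_format] b(2) b(3)[rule_format] b(4) this]
  show ?thesis unfolding integral_minus_omega[OF b(2)] b(5) gamma_val_def by simp
qed

lemma zeros_structure:
  assumes a: "a \<in> Lambda_antiper T n" and uv: "nontriv_antiper_sol T a u u'" "u 0 = 0"
  shows "\<exists>m t. interlaced_zeros T u u' m t \<and>
           (\<forall>i\<le>2 * m - 1. t (i + 1) - t i \<le> T / (2 * (2 * real n - 1))) \<and>
           (\<exists>i\<le>2 * m - 1. t (i + 1) - t i < T / (2 * (2 * real n - 1))) \<and>
           odd m \<and> m \<ge> 2 * n + 1"
proof -
  have a: "a \<in> L_per T" "prec_ae T (\<lambda>_. \<omega>\<^sup>2) a" using a unfolding Lambda_antiper_iff by blast+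
  obtain b where b: "\<forall>t. b (t + T) = b t" "b absolutely_integrable_on {0..T}" "\<forall>t. \<omega>\<^sup>2 \<le> b t"
    "integral {0..T} (\<lambda>t. b t - \<omega>\<^sup>2) > 0" "integral {0..T} b = L1_norm T a"
    "\<forall>u v. nontriv_antiper_sol T a u v \<longleftrightarrow> antisol T b u v \<and> (u 0 \<noteq> 0 \<or> v 0 \<noteq> 0)"
    by (rule Lambda_truncate[OF a]) (rule that; assumption)
  have s: "antisol T b u u'" "u' 0 \<noteq> 0" using uv b(6) by auto
  obtain m :: nat where m: "odd m" "m \<ge> k + 2" "pangle T b 0 = 0 + real m * pi"
    by (rule antisol_rot_ge[OF T k_facts(1) w b(2) b(3)[rule_format] b(4) s(1), of "u' 0" 0]) (use uv s in auto)
  have pm: "pangle T b 0 = real m * pi" using m(3) by simp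
  obtain t where t: "interlaced_zeros T u u' m t" and g: "\<forall>i<2 * m. \<omega> * (t (i + 1) - t i) \<le> pi / 2"
    by (rule antisol_interlaced[OF T b(2) b(3)[rule_format] k_facts(5) s(1) uv(2) s(2) pm])
  have L: "T / (2 * (2 * real n - 1)) = pi / 2 / \<omega>"
    using k_facts(2) T by (simp add: k_facts(3)[symmetric] w)
  have le: "x \<le> T / (2 * (2 * real n - 1)) \<longleftrightarrow> \<omega> * x \<le> pi / 2" for x
    unfolding L pos_le_divide_eq[OF k_facts(5)] by (simp add: mult.commute)
  have iff: "i \<le> 2 * m - 1 \<longleftrightarrow> i < 2 * m" for i using m(2) by auto
  \<comment> \<open>If no gap were shorter than T / (2 k), the 2 m gaps would add up to at least m T
    / k > T.\<close>
  have ex: "\<exists>i<2 * m. t (i + 1) - t i < T / (2 * (2 * real n - 1))"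
  proof (rule ccontr)
    assume "\<not> ?thesis"
    then have "\<And>i. i \<in> {..<2 * m} \<Longrightarrow> T / (2 * (2 * real n - 1)) \<le> t (i + 1) - t i" by force
    then have "real (card {..<2 * m}) * (T / (2 * (2 * real n - 1))) \<le> (\<Sum>i<2 * m. t (i + 1) - t i)"
      by (rule sum_bounded_below)
    also have "(\<Sum>i<2 * m. t (i + 1) - t i) = t (2 * m) - t 0" using sum_lessThan_telescope[of t "2 * m"] by simp
    also have "\<dots> = T" using t by (simp add: interlaced_zeros_def)
    finally have "real (2 * m) * (pi / 2 / \<omega>) \<le> T" unfolding L by simp
    then have "real m * pi \<le> \<omega> * T" using k_facts(5) by (simp add: field_simps)
    then have "real m * pi \<le> real k * pi" unfolding k_facts(6) .
    then show False using m(2) by simp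
  qed
  show ?thesis
  proof (rule exI[of _ m], rule exI[of _ t], intro conjI t m(1))
    show "\<forall>i\<le>2 * m - 1. t (i + 1) - t i \<le> T / (2 * (2 * real n - 1))" unfolding le iff by (rule g)
    show "\<exists>i\<le>2 * m - 1. t (i + 1) - t i < T / (2 * (2 * real n - 1))" unfolding iff by (rule ex)
    show "2 * n + 1 \<le> m" using m(2) k_facts(4) by simp
  qed
qed

text \<open>Witness: the constant (m \<pi> / T)^2 with the solution sin (\<nu> t) / \<nu>; it
  exceeds \<omega>^2 because m > k.\<close>

lemma zeros_realised:
  assumes m: "odd m" "m \<ge> 2 * n + 1"
  shows "\<exists>a\<in>Lambda_antiper T n. \<exists>u u' t. nontriv_antiper_sol T a u u' \<and> u 0 = 0 \<and> u T = 0 \<and> interlaced_zeros T u u' m t"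
proof -
  define \<nu> where "\<nu> = real m * pi / T"
  have mk: "m > k" using m k_facts(4) by simp
  have \<nu>: "\<nu> > \<omega>" using mk T by (simp add: \<nu>_def w divide_strict_right_mono)
  then have \<nu>0: "\<nu> > 0" using k_facts(5) by simp
  have sq: "\<nu>\<^sup>2 > \<omega>\<^sup>2" using \<nu> k_facts(5) by (simp add: power_strict_mono)
  let ?q = "\<lambda>t::real. \<nu>\<^sup>2"
  have ai: "?q absolutely_integrable_on {0..T}" by (rule abs_int_const)
  have pr: "prec_ae T (\<lambda>_. \<omega>\<^sup>2) ?q"
    by (rule prec_ae_constI[OF ai negligible_empty]) (use sq T in auto)
  have nT: "\<nu> * T = real m * pi" using T by (simp add: \<nu>_def)
  have s: "antisol T ?q (\<lambda>t. sin (\<nu> * t) / \<nu>) (\<lambda>t. cos (\<nu> * t))"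
    using const_hill_sols(1)[of \<nu> 0 T] \<nu>0 sin_cos_add_odd_pi[of "int m" 0] m(1)
    by (simp add: antisol_def nT)
  have "rot T ?q 0 = real m * pi"
    using rot_rmax[OF T ai, of 0] rot_rmin[OF T ai, of 0] const_rot[OF T m(1) \<nu>_def] by simp
  then have pm: "pangle T ?q 0 = real m * pi" by (simp add: rot_def)
  obtain t where t: "interlaced_zeros T (\<lambda>t. sin (\<nu> * t) / \<nu>) (\<lambda>t. cos (\<nu> * t)) m t"
    by (rule antisol_interlaced[OF T ai order_refl \<nu>0 s _ _ pm]) simp_all
  have nt: "nontriv_antiper_sol T ?q (\<lambda>t. sin (\<nu> * t) / \<nu>) (\<lambda>t. cos (\<nu> * t))"
    unfolding nontriv_antiper_sol_iff[OF T ai] using s by simp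
  then have "?q \<in> Lambda_antiper T n" unfolding Lambda_antiper_iff using ai pr by (auto simp: L_per_def)
  then show ?thesis using nt t nT
    by (intro bexI[of _ ?q] exI[of _ "\<lambda>t. sin (\<nu> * t) / \<nu>"] exI[of _ "\<lambda>t. cos (\<nu> * t)"] exI[of _ t]) auto
qed

text \<open>If \<open>rmax\<close> reached \<open>(k + 2) \<pi>\<close>, then so would it at some potential of the segment from \<open>\<omega>\<^sup>2\<close> to \<open>a\<close>,
  which then lies in \<open>\<Lambda>\<close> although its norm is at most that of \<open>a\<close>.\<close>

lemma eigenvalue_gap:
  assumes a: "a \<in> L_per T" "prec_ae T (\<lambda>_. \<omega>\<^sup>2) a" and le: "L1_norm T a \<le> gamma_val"
  shows "antiper_eig T a (2 * n) < 0" "0 < antiper_eig T a (2 * n + 1)"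
proof -
  obtain b where b: "\<forall>t. b (t + T) = b t" "b absolutely_integrable_on {0..T}" "\<forall>t. \<omega>\<^sup>2 \<le> b t"
    "integral {0..T} (\<lambda>t. b t - \<omega>\<^sup>2) > 0" "integral {0..T} b = L1_norm T a"
    and e: "\<forall>j. antiper_eig T a j = antiper_eig T b j"
    by (rule Lambda_truncate[OF a]) (rule that; assumption)
  have ca: "(\<lambda>t. \<omega>\<^sup>2) absolutely_integrable_on {0..T}" by (rule abs_int_const)
  have nk: "2 * (n - 1) + 2 = 2 * n" "2 * real (n - 1) + 1 = real k" using n by (auto simp: k of_nat_diff)
  \<comment> \<open>Strict monotonicity in the potential raises even the minimal rotation above k
    \<pi>, which settles the eigenvalue numbered 2 n.\<close>
  have "(2 * real (n - 1) + 1) * pi < rmin T b"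
    unfolding nk(2) const_rot(1)[OF T k_facts(1) w, symmetric]
    by (rule rmin_mono(2)[OF T ca b(2) b(3)[rule_format] b(4)])
  from antiper_eig_even_neg[OF T b(2) this] show "antiper_eig T a (2 * n) < 0" unfolding nk(1) using e by simp
  have nk2: "(2 * real n + 1) * pi = real (k + 2) * pi" by (simp add: k_facts(3))
  have "rmax T b < (2 * real n + 1) * pi"
  proof (rule ccontr)
    assume N: "\<not> ?thesis"
    let ?d = "\<lambda>t. b t - \<omega>\<^sup>2"
    have da: "?d absolutely_integrable_on {0..T}" by (rule abs_int_diff_const[OF b(2)])
    let ?R = "\<lambda>s. rmax T (\<lambda>t. \<omega>\<^sup>2 + s * ?d t)"
    have "\<exists>s\<ge>0. s \<le> 1 \<and> ?R s = (2 * real n + 1) * pi"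
    proof (rule IVT')
      show "?R 0 \<le> (2 * real n + 1) * pi" using const_rot(2)[OF T k_facts(1) w] unfolding nk2 by simp
      show "(2 * real n + 1) * pi \<le> ?R 1" using N by simp
      show "continuous_on {0..1} ?R"
        by (rule continuous_on_subset[OF rmax_path_cont[OF T ca da]]) simp
    qed simp
    then obtain s where s: "0 \<le> s" "s \<le> 1" "?R s = (2 * real n + 1) * pi" by blast
    \<comment> \<open>At s = 0 the potential is \<omega>^2 itself with rotation k \<pi>; s > 0 makes
      the intermediate potential exceed it on a set of positive measure.\<close>
    have "s \<noteq> 0"
    proof
      assume "s = 0"
      then have "real k * pi = real (k + 2) * pi" using s(3) const_rot(2)[OF T k_facts(1) w] unfolding nk2 by simp
      then show False by simp
    qed
    then have s0: "s > 0" using s by simp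
    let ?q = "\<lambda>t. \<omega>\<^sup>2 + s * ?d t"
    have qa: "?q absolutely_integrable_on {0..T}" by (rule path_abs_int[OF T ca da])
    obtain u v where uv: "antisol T ?q u v" "u 0 \<noteq> 0 \<or> v 0 \<noteq> 0"
      using extremal_imp_antisol[OF T qa, of n] s(3) by blast
    have d0: "?d t \<ge> 0" for t using b(3) by simp
    have ip: "integral {0..T} (\<lambda>t. ?q t - \<omega>\<^sup>2) = s * integral {0..T} ?d" by simp
    have "prec_ae T (\<lambda>_. \<omega>\<^sup>2) ?q"
      by (rule prec_ae_constI[OF qa negligible_empty]) (use d0 s s0 b(4) ip in \<open>auto simp: mult_nonneg_nonneg\<close>)
    moreover have "?q \<in> L_per T" using qa b(1) by (simp add: L_per_def)
    moreover have "nontriv_antiper_sol T ?q u v" unfolding nontriv_antiper_sol_iff[OF T qa] using uv by simp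
    ultimately have "?q \<in> Lambda_antiper T n" unfolding Lambda_antiper_iff by blast
    from Lambda_norm_gt[OF this] have "gamma_val < L1_norm T ?q" .
    also have "L1_norm T ?q \<le> integral {0..T} b"
      unfolding L1_norm_def
    proof (rule integral_mono_abs[OF abs_int_imp_abs[OF qa] b(2)])
      fix t
      have "s * ?d t \<le> 1 * ?d t" using s d0 by (intro mult_right_mono) auto
      moreover have "0 \<le> s * ?d t" using s d0 by simp
      ultimately show "\<bar>?q t\<bar> \<le> b t" by simp
    qed
    finally show False using le b(5) by simp
  qed
  \<comment> \<open>Some shift must reach the level (k + 2) \<pi>: since b is nonnegative, the
    constant with exactly that rotation suffices.\<close>
  moreover have "(2 * real n + 1) * pi \<le> rmax T (\<lambda>t. ((k + 2) * pi / T)\<^sup>2 + b t)"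
  proof -
    have o: "odd (k + 2)" using k_facts(1) by simp
    have "rmax T (\<lambda>t. (real (k + 2) * pi / T)\<^sup>2) = real (k + 2) * pi" by (rule const_rot(2)[OF T o refl])
    moreover have "0 \<le> b t" for t using b(3) zero_le_power2[of \<omega>] order_trans by blast
    then have "rmax T (\<lambda>t. (real (k + 2) * pi / T)\<^sup>2) \<le> rmax T (\<lambda>t. (real (k + 2) * pi / T)\<^sup>2 + b t)"
      by (intro rmax_mono(1)[OF T abs_int_const shifted_abs_int[OF T b(2)]]) simp
    ultimately show ?thesis unfolding nk2 by simp
  qed
  ultimately show "0 < antiper_eig T a (2 * n + 1)"
    using antiper_eig_odd_pos[OF T b(2), of n] e by simp
qed

end

subsection \<open>Potentials of nearly minimal norm\<close>

lemma mult_cot_le_one: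
  assumes "0 < z" "z < pi / 2"
  shows "z * cot z \<le> 1"
proof -
  have "sin 0 - 0 * cos 0 \<le> sin z - z * cos z"
  proof (rule DERIV_nonneg_imp_nondecreasing[where f = "\<lambda>z. sin z - z * cos z" and a = 0 and b = z])
    fix x assume x: "0 \<le> x" "x \<le> z"
    have "((\<lambda>x. sin x - x * cos x) has_real_derivative x * sin x) (at x)"
      by (auto intro!: derivative_eq_intros)
    moreover have "0 \<le> x * sin x" using x assms by (intro mult_nonneg_nonneg sin_ge_zero) auto
    ultimately show "\<exists>y. ((\<lambda>x. sin x - x * cos x) has_real_derivative y) (at x) \<and> 0 \<le> y" by blast
  qed (use assms in simp)
  moreover have "sin z > 0" using assms by (intro sin_gt_zero) auto
  ultimately show ?thesis by (simp add: cot_def divide_le_eq_1)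
qed

lemma cot_antimono:
  assumes "0 < x" "x \<le> y" "y < pi"
  shows "cot y \<le> cot x"
proof -
  have s: "sin x > 0" "sin y > 0" using assms by (auto intro: sin_gt_zero)
  have "0 \<le> sin (y - x)" using assms by (intro sin_ge_zero) auto
  then have "cos y * sin x \<le> cos x * sin y" by (simp add: sin_diff mult.commute)
  then show ?thesis using s by (simp add: cot_def frac_le_eq divide_simps mult.commute)
qed

lemma arcsin_facts:
  assumes "0 < s" "s < 1"
  shows "0 < arcsin s" "arcsin s < pi / 2" "sin (arcsin s) = s" "cos (arcsin s) = sqrt (1 - s\<^sup>2)"
  using assms arcsin_less_mono[of 0 s] arcsin_less_mono[of s 1] cos_arcsin[of s] by auto

text \<open>Comparison of cot (\<kappa> arcsin s) with cot (arcsin s) = sqrt (1 - s^2) / s makes the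
  right side at least 1 / (1 - s^2). This is why the smoothed potential exceeds (c
  \<kappa>)^2.\<close>

lemma kappa_cot_gt:
  assumes s: "0 < s" "s < 1" and \<kappa>: "0 < \<kappa>" "\<kappa> < 1"
  shows "\<kappa> / (1 - s\<^sup>2) < cot (\<kappa> * arcsin s) * s / ((1 - s\<^sup>2) * sqrt (1 - s\<^sup>2))"
proof -
  note Y = arcsin_facts[OF s]
  have s2: "s\<^sup>2 < 1" using s by (simp add: abs_square_less_1)
  define D where "D = 1 - s\<^sup>2"
  have D: "D > 0" "sqrt D > 0" using s2 by (simp_all add: D_def)
  have "\<kappa> * arcsin s \<le> 1 * arcsin s" using Y \<kappa> by (intro mult_right_mono) auto
  then have "cot (arcsin s) \<le> cot (\<kappa> * arcsin s)" using Y \<kappa> by (intro cot_antimono) auto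
  then have "sqrt D / s \<le> cot (\<kappa> * arcsin s)" using Y by (simp add: cot_def D_def)
  then have "sqrt D \<le> cot (\<kappa> * arcsin s) * s" using s by (simp add: pos_divide_le_eq)
  then have "1 \<le> cot (\<kappa> * arcsin s) * s / sqrt D" using D by (simp add: pos_le_divide_eq)
  then have "\<kappa> < cot (\<kappa> * arcsin s) * s / sqrt D" using \<kappa> by simp
  then have "\<kappa> / D < cot (\<kappa> * arcsin s) * s / sqrt D / D" by (rule divide_strict_right_mono[OF _ D(1)])
  then show ?thesis by (simp add: D_def mult.commute)
qed

text \<open>Where arcsin s \<ge> y, monotonicity of cot gives the constant cot (\<kappa> y).
  Elsewhere z cot z \<le> 1 and s \<le> arcsin s bound the left side by 1 / cos^3 y, uniformly in
  s.\<close>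

lemma kappa_cot_le:
  assumes s: "0 < s" "s < 1" and \<kappa>: "0 < \<kappa>" "\<kappa> < 1" and y: "0 < y" "y < pi / 2"
  shows "\<kappa> * cot (\<kappa> * arcsin s) * (s / ((1 - s\<^sup>2) * sqrt (1 - s\<^sup>2)))
     \<le> \<kappa> * cot (\<kappa> * y) * (s / ((1 - s\<^sup>2) * sqrt (1 - s\<^sup>2))) + 1 / (cos y) ^ 3"
proof -
  note Y = arcsin_facts[OF s]
  have s2: "s\<^sup>2 < 1" using s by (simp add: abs_square_less_1)
  define R where "R = sqrt (1 - s\<^sup>2)"
  have R: "R > 0" using s2 by (simp add: R_def)
  have R2: "1 - s\<^sup>2 = R\<^sup>2" using s2 by (simp add: R_def)
  have cy: "cos y > 0" using y by (intro cos_gt_zero_pi) auto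
  have ky: "\<kappa> * x < pi / 2" if "0 < x" "x < pi / 2" for x
  proof -
    have "\<kappa> * x \<le> 1 * x" using that \<kappa> by (intro mult_right_mono) auto
    then show ?thesis using that by linarith
  qed
  let ?E = "s / (R\<^sup>2 * R)"
  have E: "?E > 0" using s R by simp
  have "\<kappa> * cot (\<kappa> * arcsin s) * ?E \<le> \<kappa> * cot (\<kappa> * y) * ?E + 1 / (cos y) ^ 3"
  proof (cases "y \<le> arcsin s")
    case True
    have "cot (\<kappa> * arcsin s) \<le> cot (\<kappa> * y)"
      using True y \<kappa> ky[OF Y(1,2)] by (intro cot_antimono) auto
    then have "\<kappa> * cot (\<kappa> * arcsin s) * ?E \<le> \<kappa> * cot (\<kappa> * y) * ?E" using \<kappa> E by (intro mult_right_mono mult_left_mono) auto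
    then show ?thesis using cy by (simp add: add_increasing2)
  next
    case False
    have "(\<kappa> * arcsin s) * cot (\<kappa> * arcsin s) \<le> 1"
      using Y \<kappa> by (intro mult_cot_le_one ky) auto
    moreover have "\<kappa> * cot (\<kappa> * arcsin s) * s \<le> \<kappa> * cot (\<kappa> * arcsin s) * arcsin s"
    proof (rule mult_left_mono)
      show "s \<le> arcsin s" using sin_x_le_x[of "arcsin s"] Y by simp
      have "cot (\<kappa> * arcsin s) > 0" using Y \<kappa> ky[OF Y(1,2)] by (intro cot_gt_zero) auto
      then show "0 \<le> \<kappa> * cot (\<kappa> * arcsin s)" using \<kappa> by simp
    qed
    ultimately have 1: "\<kappa> * cot (\<kappa> * arcsin s) * s \<le> 1" by (simp add: algebra_simps)
    have "cos y \<le> cos (arcsin s)" using False Y y by (intro cos_monotone_0_pi_le) auto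
    then have cR: "cos y \<le> R" using Y by (simp add: R_def)
    have "\<kappa> * cot (\<kappa> * arcsin s) * ?E = \<kappa> * cot (\<kappa> * arcsin s) * s / R ^ 3" by (simp add: eval_nat_numeral)
    also have "\<dots> \<le> 1 / R ^ 3" using 1 R by (intro divide_right_mono) auto
    also have "\<dots> \<le> 1 / (cos y) ^ 3" using cR cy by (intro divide_left_mono power_mono) (auto intro: mult_pos_pos)
    finally have A: "\<kappa> * cot (\<kappa> * arcsin s) * ?E \<le> 1 / (cos y) ^ 3" .
    have "cot (\<kappa> * y) > 0" using y \<kappa> ky[OF y] by (intro cot_gt_zero) auto
    then have "0 \<le> \<kappa> * cot (\<kappa> * y) * ?E" using \<kappa> E by (intro mult_nonneg_nonneg) auto
    then show ?thesis using A by linarith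
  qed
  then show ?thesis unfolding R_def[symmetric] unfolding R2 .
qed

text \<open>The potential is read off from \<open>u = sin (\<kappa> arcsin (\<rho> sin (c t)))\<close>. As \<open>\<rho> \<rightarrow> 1\<close> the inner function tends to the triangle
  wave with slopes \<open>\<plusminus>c\<close>, and \<open>a = - u'' / u\<close> to \<open>(c \<kappa>)\<^sup>2\<close> plus a point mass \<open>2 c \<kappa> cot (\<kappa> \<pi> / 2)\<close> at each corner.\<close>

context
  fixes T c \<kappa> \<rho> :: real and m :: nat
  assumes T: "T > 0" and m: "odd m" and c: "c = real m * pi / T" and \<kappa>: "0 < \<kappa>" "\<kappa> < 1" and \<rho>: "0 < \<rho>" "\<rho> < 1"
begin

definition bump_s :: "real \<Rightarrow> real" where "bump_s t = \<rho> * sin (c * t)"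
definition bump_W :: "real \<Rightarrow> real" where "bump_W t = c * \<rho> * cos (c * t) / sqrt (1 - (bump_s t)\<^sup>2)"
text \<open>Minus the second derivative of arcsin (\<rho> sin (c t)): the smoothed point masses,
  with alternating signs.\<close>

definition bump_E :: "real \<Rightarrow> real" where
  "bump_E t = c\<^sup>2 * (1 - \<rho>\<^sup>2) * (bump_s t / ((1 - (bump_s t)\<^sup>2) * sqrt (1 - (bump_s t)\<^sup>2)))"
text \<open>Where s = 0 the quotient - u'' / u is undefined, and the formula with cot 0 = 0 gives (c
  \<kappa> \<rho>)^2, which lies below (c \<kappa>)^2; such points form a null set.\<close>

definition bump_a :: "real \<Rightarrow> real" where
  "bump_a t = \<kappa>\<^sup>2 * (bump_W t)\<^sup>2 + \<kappa> * cot (\<kappa> * arcsin (bump_s t)) * bump_E t"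
definition bump_u :: "real \<Rightarrow> real" where "bump_u t = sin (\<kappa> * arcsin (bump_s t))"
definition bump_v :: "real \<Rightarrow> real" where "bump_v t = \<kappa> * cos (\<kappa> * arcsin (bump_s t)) * bump_W t"

lemma c_pos: "c > 0" using m T odd_pos[OF m] by (simp add: c)

lemma cT: "c * T = real m * pi" using T by (simp add: c)

lemma bump_s_abs: "\<bar>bump_s t\<bar> < 1"
proof -
  have "\<bar>bump_s t\<bar> \<le> \<rho> * 1" using \<rho> unfolding bump_s_def abs_mult by (intro mult_mono) auto
  then show ?thesis using \<rho> by simp
qed

lemma bump_s_sq: "(bump_s t)\<^sup>2 < 1" using bump_s_abs[of t] by (simp add: abs_square_less_1)

lemma one_minus_rho: "1 - \<rho>\<^sup>2 > 0" using \<rho> by (simp add: abs_square_less_1)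

lemma bump_s_deriv: "(bump_s has_real_derivative \<rho> * c * cos (c * t)) (at t)"
  unfolding bump_s_def[abs_def] by (auto intro!: derivative_eq_intros)

lemma bump_arcsin_deriv: "((\<lambda>t. arcsin (bump_s t)) has_real_derivative bump_W t) (at t)"
proof -
  have b: "-1 < bump_s t" "bump_s t < 1" using bump_s_abs[of t] by auto
  from DERIV_chain2[OF DERIV_arcsin[OF b] bump_s_deriv] show ?thesis
    by (simp add: bump_W_def divide_inverse mult_ac)
qed

text \<open>cos is eliminated through \<rho>^2 cos^2 = (1 - s^2) - (1 - \<rho>^2), which separates
  the constant c^2 from a part carrying the factor 1 - \<rho>^2, like \<open>bump_E\<close>.\<close>

lemma bump_W_sq: "(bump_W t)\<^sup>2 = c\<^sup>2 - c\<^sup>2 * (1 - \<rho>\<^sup>2) / (1 - (bump_s t)\<^sup>2)"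
proof -
  have D: "1 - (bump_s t)\<^sup>2 > 0" using bump_s_sq by simp
  have "(bump_W t)\<^sup>2 = c\<^sup>2 * (\<rho>\<^sup>2 * (cos (c * t))\<^sup>2) / (1 - (bump_s t)\<^sup>2)"
    using D by (simp add: bump_W_def power_divide power_mult_distrib mult.assoc)
  also have "\<rho>\<^sup>2 * (cos (c * t))\<^sup>2 = (1 - (bump_s t)\<^sup>2) - (1 - \<rho>\<^sup>2)"
    by (simp add: bump_s_def power_mult_distrib cos_squared_eq algebra_simps)
  finally have e: "(bump_W t)\<^sup>2 = c\<^sup>2 * ((1 - (bump_s t)\<^sup>2) - (1 - \<rho>\<^sup>2)) / (1 - (bump_s t)\<^sup>2)" .
  have "x * (d - y) / d = x - x * y / d" if "d > 0" for x y d :: real using that by (simp add: field_simps)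
  from this[OF D] show ?thesis unfolding e .
qed

lemma bump_W_deriv: "(bump_W has_real_derivative - bump_E t) (at t)"
proof -
  define s where "s = bump_s t"
  define R where "R = sqrt (1 - s\<^sup>2)"
  have R: "R > 0" and R2: "R\<^sup>2 = 1 - s\<^sup>2" using bump_s_sq[of t] by (simp_all add: R_def s_def)
  have s': "s = \<rho> * sin (c * t)" by (simp add: s_def bump_s_def)
  have "((\<lambda>t. 1 - (bump_s t)\<^sup>2) has_real_derivative - 2 * s * (\<rho> * c * cos (c * t))) (at t)"
    by (rule derivative_eq_intros bump_s_deriv refl)+ (simp add: s_def)
  then have dR: "((\<lambda>t. sqrt (1 - (bump_s t)\<^sup>2)) has_real_derivative (inverse R / 2) * (- 2 * s * (\<rho> * c * cos (c * t)))) (at t)"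
    unfolding R_def s_def by (intro DERIV_chain2[OF DERIV_real_sqrt]) (use bump_s_sq[of t] in auto)
  have dN: "((\<lambda>t. c * \<rho> * cos (c * t)) has_real_derivative - (c\<^sup>2 * s)) (at t)"
    by (auto intro!: derivative_eq_intros simp: s' power2_eq_square)
  have "(bump_W has_real_derivative ((- (c\<^sup>2 * s)) * R - (c * \<rho> * cos (c * t)) * ((inverse R / 2) * (- 2 * s * (\<rho> * c * cos (c * t))))) / (R * R)) (at t)"
    using DERIV_divide[OF dN dR] R by (simp add: bump_W_def[abs_def] R_def s_def)
  also have "((- (c\<^sup>2 * s)) * R - (c * \<rho> * cos (c * t)) * ((inverse R / 2) * (- 2 * s * (\<rho> * c * cos (c * t))))) / (R * R) = - bump_E t"
  proof -
    have rc: "\<rho>\<^sup>2 * (cos (c * t))\<^sup>2 = R\<^sup>2 - (1 - \<rho>\<^sup>2)"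
      unfolding R2 by (simp add: s' power_mult_distrib cos_squared_eq algebra_simps)
    have "(- (c\<^sup>2 * s)) * R - (c * \<rho> * cos (c * t)) * ((inverse R / 2) * (- 2 * s * (\<rho> * c * cos (c * t))))
        = (- (c\<^sup>2 * s) * R\<^sup>2 + c\<^sup>2 * s * (\<rho>\<^sup>2 * (cos (c * t))\<^sup>2)) / R"
      using R by (simp add: field_simps power2_eq_square)
    also have "\<dots> = - (c\<^sup>2 * (1 - \<rho>\<^sup>2) * s) / R" unfolding rc by (simp add: algebra_simps)
    finally have e: "(- (c\<^sup>2 * s)) * R - (c * \<rho> * cos (c * t)) * ((inverse R / 2) * (- 2 * s * (\<rho> * c * cos (c * t))))
        = - (c\<^sup>2 * (1 - \<rho>\<^sup>2) * s) / R" .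
    show ?thesis
      unfolding e bump_E_def s_def[symmetric] R_def[symmetric] R2[symmetric] using R by (simp add: power2_eq_square mult_ac)
  qed
  finally show ?thesis .
qed

lemma bump_cont: "continuous_on S bump_s" "continuous_on S (\<lambda>t. arcsin (bump_s t))" "continuous_on S bump_W" "continuous_on S bump_E"
proof -
  show s: "continuous_on S bump_s" unfolding bump_s_def[abs_def] by (intro continuous_intros)
  show "continuous_on S (\<lambda>t. arcsin (bump_s t))"
    by (intro continuous_intros s) (use bump_s_abs in \<open>auto simp: abs_less_iff less_imp_le minus_less_iff\<close>)
  have "1 - (bump_s t)\<^sup>2 \<noteq> 0" "sqrt (1 - (bump_s t)\<^sup>2) \<noteq> 0" for t using bump_s_sq[of t] by auto
  then show "continuous_on S bump_W" "continuous_on S bump_E"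
    unfolding bump_W_def[abs_def] bump_E_def[abs_def] by (auto intro!: continuous_intros s)
qed

lemma bump_sol: "hill_sol 0 T bump_a bump_u bump_v"
  unfolding hill_sol_def
proof
  have u: "(bump_u has_real_derivative bump_v t) (at t)" for t
    unfolding bump_u_def[abs_def] bump_v_def
    by (rule derivative_eq_intros bump_arcsin_deriv refl)+ (simp add: mult_ac)
  have "continuous_on {0..T} bump_v" unfolding bump_v_def[abs_def] by (intro continuous_intros bump_cont)
  then show "indef_int 0 T bump_u bump_v"
    by (intro indef_int_C1 has_field_derivative_at_within[OF u])
  let ?g = "\<lambda>t. - (\<kappa>\<^sup>2 * sin (\<kappa> * arcsin (bump_s t)) * (bump_W t)\<^sup>2) - \<kappa> * cos (\<kappa> * arcsin (bump_s t)) * bump_E t"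
  have v: "(bump_v has_real_derivative ?g t) (at t)" for t
    unfolding bump_v_def[abs_def]
    by (rule derivative_eq_intros bump_arcsin_deriv bump_W_deriv refl)+ (simp add: power2_eq_square algebra_simps)
  have "continuous_on {0..T} ?g" by (intro continuous_intros bump_cont)
  then have "indef_int 0 T bump_v ?g" by (intro indef_int_C1 has_field_derivative_at_within[OF v])
  then show "indef_int 0 T bump_v (\<lambda>t. - (bump_a t * bump_u t))"
  proof (rule indef_int_cong)
    fix t
    \<comment> \<open>The cancellation cot x sin x = cos x could fail only at zeros of sin; as |x| <
      \<pi>, this means x = 0, where the factor \<open>bump_E\<close> vanishes.\<close>
    have "cot (\<kappa> * arcsin (bump_s t)) * sin (\<kappa> * arcsin (bump_s t)) * bump_E t = cos (\<kappa> * arcsin (bump_s t)) * bump_E t"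
    proof (cases "bump_s t = 0")
      case True then show ?thesis by (simp add: bump_E_def)
    next
      case False
      have b: "-1 \<le> bump_s t" "bump_s t \<le> 1" using bump_s_abs[of t] by auto
      have nz: "arcsin (bump_s t) \<noteq> 0" using False b by (simp add: arcsin_eq_iff[of _ 0, simplified])
      have "\<bar>arcsin (bump_s t)\<bar> \<le> pi / 2" using arcsin_bounded[OF b] by auto
      then have "\<kappa> * \<bar>arcsin (bump_s t)\<bar> \<le> 1 * (pi / 2)" using \<kappa> by (intro mult_mono) auto
      moreover have "\<bar>\<kappa> * arcsin (bump_s t)\<bar> = \<kappa> * \<bar>arcsin (bump_s t)\<bar>" using \<kappa> by (simp add: abs_mult)
      ultimately have "\<bar>\<kappa> * arcsin (bump_s t)\<bar> < pi" using pi_gt_zero by linarith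
      then have "sin (\<kappa> * arcsin (bump_s t)) \<noteq> 0"
        using nz \<kappa> sin_eq_0_pi[of "\<kappa> * arcsin (bump_s t)"] by (auto simp: abs_less_iff)
      then show ?thesis by (simp add: cot_def)
    qed
    then show "?g t = - (bump_a t * bump_u t)" by (simp add: bump_a_def bump_u_def algebra_simps)
  qed auto
qed

lemma bump_antisol: "antisol T bump_a bump_u bump_v" "bump_v 0 \<noteq> 0"
proof -
  have "sin (c * T) = 0" "cos (c * T) = -1" unfolding cT using sin_cos_add_odd_pi[of "int m" 0] m by simp_all
  then show "antisol T bump_a bump_u bump_v"
    using bump_sol by (simp add: antisol_def bump_u_def bump_v_def bump_W_def bump_s_def)
  show "bump_v 0 \<noteq> 0" using \<kappa> \<rho> c_pos by (simp add: bump_v_def bump_W_def bump_s_def)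
qed

text \<open>s, W and E all change sign over a period because m is odd, and the potential is
  invariant under this joint change.\<close>

lemma bump_periodic: "bump_a (t + T) = bump_a t"
proof -
  have "c * (t + T) = c * t + of_int (int m) * pi" using cT by (simp add: distrib_left)
  then have sc: "sin (c * (t + T)) = - sin (c * t)" "cos (c * (t + T)) = - cos (c * t)"
    using sin_cos_add_odd_pi[of "int m" "c * t"] m by simp_all
  have s: "bump_s (t + T) = - bump_s t" by (simp add: bump_s_def sc)
  have E: "bump_E (t + T) = - bump_E t" by (simp add: bump_E_def s)
  have W: "bump_W (t + T) = - bump_W t" by (simp add: bump_W_def s sc)
  have "arcsin (bump_s (t + T)) = - arcsin (bump_s t)" unfolding s
    by (rule arcsin_minus) (use bump_s_abs[of t] in auto)
  then show ?thesis by (simp add: bump_a_def E W)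
qed

text \<open>Rewritten in |s| so that the inequalities for 0 < s < 1 cover both signs; the bracket is
  the difference estimated in \<open>kappa_cot_gt\<close>.\<close>

lemma bump_a_even:
  "bump_a t = c\<^sup>2 * \<kappa>\<^sup>2 + c\<^sup>2 * (1 - \<rho>\<^sup>2) * (\<kappa> * (cot (\<kappa> * arcsin \<bar>bump_s t\<bar>) * \<bar>bump_s t\<bar> / ((1 - \<bar>bump_s t\<bar>\<^sup>2) * sqrt (1 - \<bar>bump_s t\<bar>\<^sup>2)) - \<kappa> / (1 - \<bar>bump_s t\<bar>\<^sup>2)))"
proof -
  have "arcsin \<bar>bump_s t\<bar> = (if bump_s t \<ge> 0 then arcsin (bump_s t) else - arcsin (bump_s t))"
    using bump_s_abs[of t] arcsin_minus[of "bump_s t"] by auto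
  then have "cot (\<kappa> * arcsin \<bar>bump_s t\<bar>) * \<bar>bump_s t\<bar> = cot (\<kappa> * arcsin (bump_s t)) * bump_s t" by auto
  then show ?thesis unfolding bump_a_def bump_W_sq bump_E_def power2_abs
    by (simp add: power2_eq_square algebra_simps)
qed

lemma bump_a_gt:
  assumes "bump_s t \<noteq> 0"
  shows "(c * \<kappa>)\<^sup>2 < bump_a t"
proof -
  have "\<kappa> / (1 - \<bar>bump_s t\<bar>\<^sup>2) < cot (\<kappa> * arcsin \<bar>bump_s t\<bar>) * \<bar>bump_s t\<bar> / ((1 - \<bar>bump_s t\<bar>\<^sup>2) * sqrt (1 - \<bar>bump_s t\<bar>\<^sup>2))"
    by (rule kappa_cot_gt) (use assms bump_s_abs \<kappa> in auto)
  then have "0 < c\<^sup>2 * (1 - \<rho>\<^sup>2) * (\<kappa> * (cot (\<kappa> * arcsin \<bar>bump_s t\<bar>) * \<bar>bump_s t\<bar> / ((1 - \<bar>bump_s t\<bar>\<^sup>2) * sqrt (1 - \<bar>bump_s t\<bar>\<^sup>2)) - \<kappa> / (1 - \<bar>bump_s t\<bar>\<^sup>2)))"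
    using \<kappa> c_pos one_minus_rho by (intro mult_pos_pos) auto
  then show ?thesis unfolding bump_a_even power_mult_distrib by simp
qed

lemma bump_a_nonneg: "0 \<le> bump_a t"
proof (cases "bump_s t = 0")
  case True then show ?thesis by (simp add: bump_a_def bump_E_def)
next
  case False
  have "0 \<le> (c * \<kappa>)\<^sup>2" by simp
  then show ?thesis using bump_a_gt[OF False] by linarith
qed

text \<open>A nonpositive part is dropped and cot is frozen at the angle y. Besides the constant
  there remain |E|, whose integral is explicit, and a term that for fixed y vanishes as \<rho> tends
  to 1.\<close>

lemma bump_a_le:
  assumes y: "0 < y" "y < pi / 2"
  shows "bump_a t \<le> (c * \<kappa>)\<^sup>2 + (\<kappa> * cot (\<kappa> * y) * \<bar>bump_E t\<bar> + c\<^sup>2 * (1 - \<rho>\<^sup>2) / (cos y) ^ 3)"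
proof (cases "bump_s t = 0")
  case True
  have "bump_a t = \<kappa>\<^sup>2 * (bump_W t)\<^sup>2" "bump_E t = 0" using True by (simp_all add: bump_a_def bump_E_def)
  moreover have "(bump_W t)\<^sup>2 \<le> c\<^sup>2" unfolding bump_W_sq using True one_minus_rho by simp
  then have "\<kappa>\<^sup>2 * (bump_W t)\<^sup>2 \<le> \<kappa>\<^sup>2 * c\<^sup>2" by (intro mult_left_mono) auto
  moreover have "cos y > 0" using y by (intro cos_gt_zero_pi) auto
  ultimately show ?thesis using one_minus_rho by (simp add: power_mult_distrib mult.commute add_increasing2)
next
  case False
  define s where "s = \<bar>bump_s t\<bar>"
  define G where "G = s / ((1 - s\<^sup>2) * sqrt (1 - s\<^sup>2))"
  have s: "0 < s" "s < 1" using False bump_s_abs[of t] by (auto simp: s_def)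
  have s2: "1 - s\<^sup>2 > 0" using bump_s_sq[of t] by (simp add: s_def)
  have E: "\<bar>bump_E t\<bar> = c\<^sup>2 * (1 - \<rho>\<^sup>2) * G"
    using one_minus_rho s2 by (simp add: bump_E_def G_def s_def abs_mult abs_divide)
  define C where "C = c\<^sup>2 * (1 - \<rho>\<^sup>2)"
  have C: "C \<ge> 0" using one_minus_rho by (simp add: C_def)
  have "bump_a t = (c * \<kappa>)\<^sup>2 + C * (\<kappa> * cot (\<kappa> * arcsin s) * G) - C * (\<kappa> * \<kappa> / (1 - s\<^sup>2))"
    unfolding bump_a_even s_def[symmetric] C_def[symmetric] by (simp add: G_def power_mult_distrib algebra_simps)
  moreover have "0 \<le> C * (\<kappa> * \<kappa> / (1 - s\<^sup>2))" using C s2 \<kappa> by simp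
  moreover have "C * (\<kappa> * cot (\<kappa> * arcsin s) * G) \<le> C * (\<kappa> * cot (\<kappa> * y) * G + 1 / (cos y) ^ 3)"
    unfolding G_def by (intro mult_left_mono kappa_cot_le s \<kappa> y C)
  moreover have "C * (\<kappa> * cot (\<kappa> * y) * G + 1 / (cos y) ^ 3) = \<kappa> * cot (\<kappa> * y) * (C * G) + C / (cos y) ^ 3"
    by (simp add: distrib_left)
  ultimately show ?thesis unfolding E C_def[symmetric] by linarith
qed

text \<open>Between consecutive zeros of sin (c t) the sign of E is constant and - E is the
  derivative of W, so each of the m intervals contributes the change 2 c \<rho> of W.\<close>

lemma bump_E_integral: "integral {0..T} (\<lambda>t. \<bar>bump_E t\<bar>) = 2 * real m * c * \<rho>"
proof -
  have m0: "real m > 0" using odd_pos[OF m] by simp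
  define z where "z i = real i * T / real m" for i
  have cz: "c * z i = real i * pi" for i using m0 T by (simp add: z_def c)
  have z: "z 0 = 0" "z m = T" "z i < z (i + 1)" "z i \<ge> 0" for i
    using m0 T by (auto simp: z_def divide_strict_right_mono)
  have zT: "z i \<in> {0..T}" if "i \<le> m" for i
  proof -
    have "real i * T \<le> real m * T" using that T by (intro mult_right_mono) auto
    then show ?thesis using z(4)[of i] m0 by (simp add: z_def pos_divide_le_eq mult.commute)
  qed
  have I: "integral {z i..z (i + 1)} (\<lambda>t. \<bar>bump_E t\<bar>) = 2 * c * \<rho>" for i
  proof -
    have "integral {z i..z (i + 1)} (\<lambda>t. \<bar>bump_E t\<bar>) = integral {z i..z (i + 1)} (\<lambda>t. (-1) ^ i * bump_E t)"
    proof (rule integral_cong)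
      fix t assume t: "t \<in> {z i..z (i + 1)}"
      have "c * z i \<le> c * t" "c * t \<le> c * z (i + 1)" using t c_pos by auto
      then have x: "0 \<le> c * t - real i * pi" "c * t - real i * pi \<le> pi" unfolding cz by (auto simp: algebra_simps)
      have "sin (c * t) = sin ((c * t - real i * pi) + real i * pi)" by simp
      also have "\<dots> = (-1) ^ i * sin (c * t - real i * pi)" unfolding sin_add by (simp add: cos_npi sin_npi mult.commute)
      finally have "(-1) ^ i * sin (c * t) = sin (c * t - real i * pi)" by (simp flip: power_mult_distrib mult.assoc)
      also have "\<dots> \<ge> 0" using x by (rule sin_ge_zero)
      finally have "0 \<le> (-1) ^ i * sin (c * t)" .
      moreover have "0 \<le> \<rho> * (c\<^sup>2 * (1 - \<rho>\<^sup>2) / ((1 - (bump_s t)\<^sup>2) * sqrt (1 - (bump_s t)\<^sup>2)))"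
        using \<rho> one_minus_rho bump_s_sq[of t] by (intro mult_nonneg_nonneg divide_nonneg_nonneg) auto
      ultimately have "0 \<le> (-1) ^ i * sin (c * t) * (\<rho> * (c\<^sup>2 * (1 - \<rho>\<^sup>2) / ((1 - (bump_s t)\<^sup>2) * sqrt (1 - (bump_s t)\<^sup>2))))"
        by (rule mult_nonneg_nonneg)
      also have "\<dots> = (-1) ^ i * bump_E t" by (simp add: bump_E_def bump_s_def)
      finally have "0 \<le> (-1) ^ i * bump_E t" .
      then show "\<bar>bump_E t\<bar> = (-1) ^ i * bump_E t" by (cases "even i") auto
    qed
    also have "\<dots> = (-1) ^ i * integral {z i..z (i + 1)} bump_E" by simp
    also have "integral {z i..z (i + 1)} bump_E = bump_W (z i) - bump_W (z (i + 1))"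
    proof -
      have "indef_int (z i) (z (i + 1)) bump_W (\<lambda>t. - bump_E t)"
        by (intro indef_int_C1 has_field_derivative_at_within[OF bump_W_deriv] continuous_intros bump_cont)
      from indef_intD[OF this, of "z (i + 1)"] z(3)[of i] show ?thesis by simp
    qed
    also have W: "bump_W (z j) = c * \<rho> * (-1) ^ j" for j by (simp add: bump_W_def bump_s_def cz sin_npi cos_npi)
    have "(-1) ^ i * (bump_W (z i) - bump_W (z (i + 1))) = 2 * c * \<rho> * ((-1) ^ i * (-1) ^ i)" unfolding W by simp
    also have "\<dots> = 2 * c * \<rho>" by (simp flip: power_mult_distrib)
    finally show ?thesis .
  qed
  have ai: "(\<lambda>t. \<bar>bump_E t\<bar>) absolutely_integrable_on {0..T}"
    by (intro absolutely_integrable_continuous_real continuous_intros bump_cont)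
  have "(\<Sum>i<m. integral {z i..z (i + 1)} (\<lambda>t. \<bar>bump_E t\<bar>)) = integral {0..z m} (\<lambda>t. \<bar>bump_E t\<bar>)"
    by (rule integral_partition[OF ai z(1) zT z(3)])
  then show ?thesis unfolding I z(2) by simp
qed

text \<open>The potential is discontinuous at the zeros of s, so measurability and a continuous
  majorant are used.\<close>

lemma bump_a_integrable: "bump_a absolutely_integrable_on {0..T}"
proof -
  have cc: "continuous_on {0..T} f \<Longrightarrow> f \<in> borel_measurable (lebesgue_on {0..T})" for f :: "real \<Rightarrow> real"
    by (rule continuous_imp_measurable_on_sets_lebesgue) simp_all
  have meas: "bump_a \<in> borel_measurable (lebesgue_on {0..T})"
    unfolding bump_a_def[abs_def] cot_def
    by (intro borel_measurable_add borel_measurable_times borel_measurable_divide cc) (auto intro!: continuous_intros bump_cont)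
  \<comment> \<open>The majorant for the angle y = 1, which is below \<pi>/2 because \<pi> >
    3.\<close>
  let ?g = "\<lambda>t. (c * \<kappa>)\<^sup>2 + (\<kappa> * cot (\<kappa> * 1) * \<bar>bump_E t\<bar> + c\<^sup>2 * (1 - \<rho>\<^sup>2) / (cos 1) ^ 3)"
  have g: "?g absolutely_integrable_on {0..T}"
    by (intro absolutely_integrable_continuous_real continuous_intros bump_cont)
  show ?thesis
    by (rule measurable_bounded_by_integrable_imp_absolutely_integrable[OF meas _ abs_int_imp_int[OF g]])
      (use bump_a_le[of 1] bump_a_nonneg pi_gt3 in auto)
qed

lemma bump_integral_le:
  assumes y: "0 < y" "y < pi / 2"
  shows "integral {0..T} bump_a \<le> T * (c * \<kappa>)\<^sup>2 + 2 * real m * (c * \<kappa>) * cot (\<kappa> * y) + T * (c\<^sup>2 * (1 - \<rho>\<^sup>2) / (cos y) ^ 3)"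
proof -
  have Ea: "(\<lambda>t. \<kappa> * cot (\<kappa> * y) * \<bar>bump_E t\<bar>) absolutely_integrable_on {0..T}"
    by (intro absolutely_integrable_continuous_real continuous_intros bump_cont)
  have g2: "(\<lambda>t. \<kappa> * cot (\<kappa> * y) * \<bar>bump_E t\<bar> + c\<^sup>2 * (1 - \<rho>\<^sup>2) / (cos y) ^ 3) absolutely_integrable_on {0..T}"
    by (rule set_integral_add(1)[OF Ea abs_int_const])
  have g: "(\<lambda>t. (c * \<kappa>)\<^sup>2 + (\<kappa> * cot (\<kappa> * y) * \<bar>bump_E t\<bar> + c\<^sup>2 * (1 - \<rho>\<^sup>2) / (cos y) ^ 3)) absolutely_integrable_on {0..T}"
    by (rule set_integral_add(1)[OF abs_int_const g2])
  have "integral {0..T} bump_a \<le> integral {0..T} (\<lambda>t. (c * \<kappa>)\<^sup>2 + (\<kappa> * cot (\<kappa> * y) * \<bar>bump_E t\<bar> + c\<^sup>2 * (1 - \<rho>\<^sup>2) / (cos y) ^ 3))"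
    by (rule integral_mono_abs[OF bump_a_integrable g]) (rule bump_a_le[OF y])
  also have "\<dots> = T * (c * \<kappa>)\<^sup>2 + (\<kappa> * cot (\<kappa> * y) * (2 * real m * c * \<rho>) + T * (c\<^sup>2 * (1 - \<rho>\<^sup>2) / (cos y) ^ 3))"
    unfolding integral_add_abs[OF abs_int_const g2] integral_add_abs[OF Ea abs_int_const] bump_E_integral[symmetric]
    using T by simp
  also have "\<kappa> * cot (\<kappa> * y) * (2 * real m * c * \<rho>) = \<rho> * (2 * real m * (c * \<kappa>) * cot (\<kappa> * y))" by simp
  also have "\<dots> \<le> 1 * (2 * real m * (c * \<kappa>) * cot (\<kappa> * y))"
  proof (rule mult_right_mono)
    have "\<kappa> * y \<le> 1 * y" using y \<kappa> by (intro mult_right_mono) auto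
    then have "\<kappa> * y < pi / 2" using y by linarith
    then have "cot (\<kappa> * y) > 0" using y \<kappa> by (intro cot_gt_zero) auto
    then show "0 \<le> 2 * real m * (c * \<kappa>) * cot (\<kappa> * y)" using c_pos \<kappa> by simp
  qed (use \<rho> in simp)
  finally show ?thesis by simp
qed

lemma bump_null: "negligible {t. bump_s t = 0}"
proof (rule negligible_countable)
  have "{t. bump_s t = 0} \<subseteq> range (\<lambda>j::int. of_int j * pi / c)"
  proof
    fix t assume "t \<in> {t. bump_s t = 0}"
    then have "sin (c * t) = 0" using \<rho> by (simp add: bump_s_def)
    then obtain j :: int where "c * t = of_int j * pi" using sin_zero_iff_int2 by blast
    then have "t = of_int j * pi / c" using c_pos by (simp add: field_simps)
    then show "t \<in> range (\<lambda>j::int. of_int j * pi / c)" by blast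
  qed
  then show "countable {t. bump_s t = 0}" by (rule countable_subset) simp
qed

end

section \<open>The value of the infimum\<close>

context
  fixes T \<omega> :: real and n k :: nat
  assumes T: "T > 0" and n: "n \<ge> 1" and k: "k = 2 * n - 1" and w: "\<omega> = real k * pi / T"
begin

text \<open>\<kappa> = k / m with m = k + 2 makes c \<kappa> = \<omega> and \<kappa> \<pi> / 2 = k
  \<pi> / (2 (k + 2)), the phase of a quarter wave at which the lower bound is sharp. The order of
  the limits matters: y is moved to \<pi>/2, and only then, for that y, \<rho> to 1, since the error
  contains 1 / cos^3 y.\<close>

lemma Lambda_norm_approx:
  assumes e: "\<epsilon> > 0"
  shows "\<exists>a\<in>Lambda_antiper T n. L1_norm T a < gamma_val T \<omega> k + \<epsilon>"
proof -
  note kf = k_facts[OF T n k w]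
  define m where "m = k + 2"
  define c where "c = real m * pi / T"
  define \<kappa> where "\<kappa> = real k / real m"
  have \<kappa>: "0 < \<kappa>" "\<kappa> < 1" using kf(2) by (auto simp: \<kappa>_def m_def)
  have m: "odd m" using kf(1) by (simp add: m_def)
  have ck: "c * \<kappa> = \<omega>" by (simp add: c_def \<kappa>_def w m_def)
  define g where "g y = 2 * real m * (c * \<kappa>) * cot (\<kappa> * y)" for y
  have gv: "gamma_val T \<omega> k = T * (c * \<kappa>)\<^sup>2 + g (pi / 2)"
  proof -
    have e: "\<kappa> * (pi / 2) = real k * pi / (2 * (real k + 2))" by (simp add: \<kappa>_def m_def)
    have rm: "real m = real k + 2" by (simp add: m_def)
    show ?thesis unfolding gamma_val_def[OF T n k w] g_def ck e rm by (simp only: mult_ac)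
  qed
  have "0 < \<kappa> * (pi / 2)" "\<kappa> * (pi / 2) < pi" using \<kappa> mult_strict_right_mono[of \<kappa> 1 "pi/2"] pi_gt_zero by auto
  then have "sin (\<kappa> * (pi / 2)) > 0" by (rule sin_gt_zero)
  then have "isCont g (pi / 2)" unfolding g_def by (auto intro!: continuous_intros)
  then have "(g \<longlongrightarrow> g (pi / 2)) (at_left (pi / 2))" by (auto simp: isCont_def filterlim_at_split)
  then have "\<forall>\<^sub>F y in at_left (pi / 2). g y < g (pi / 2) + \<epsilon> / 2" by (rule order_tendstoD) (use e in simp)
  moreover have "\<forall>\<^sub>F y in at_left (pi / 2). 0 < y \<and> y < pi / 2"
    using eventually_at_left_real[of 0 "pi / 2"] by (auto elim: eventually_mono)
  ultimately obtain y where y: "0 < y" "y < pi / 2" "g y < g (pi / 2) + \<epsilon> / 2"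
    using eventually_happens[OF eventually_conj] by (metis (no_types, lifting) trivial_limit_at_left_real)
  have cy: "cos y > 0" using y by (intro cos_gt_zero_pi) auto
  let ?h = "\<lambda>\<rho>. T * (c\<^sup>2 * (1 - \<rho>\<^sup>2) / (cos y) ^ 3)"
  have "(?h \<longlongrightarrow> T * (c\<^sup>2 * (1 - 1\<^sup>2) / (cos y) ^ 3)) (at_left 1)" using cy by (intro tendsto_intros) auto
  then have "\<forall>\<^sub>F \<rho> in at_left 1. ?h \<rho> < \<epsilon> / 2" by (rule order_tendstoD) (use e in simp)
  moreover have "\<forall>\<^sub>F \<rho> in at_left (1::real). 0 < \<rho> \<and> \<rho> < 1"
    using eventually_at_left_real[of 0 "1::real"] by (auto elim: eventually_mono)
  ultimately obtain \<rho> where \<rho>: "0 < \<rho>" "\<rho> < 1" and h: "?h \<rho> < \<epsilon> / 2"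
    using eventually_happens[OF eventually_conj] by (metis (no_types, lifting) trivial_limit_at_left_real)
  note B = T m c_def \<kappa> \<rho>
  let ?a = "bump_a c \<kappa> \<rho>"
  note ai = bump_a_integrable[OF B]
  have "integral {0..T} ?a \<le> T * (c * \<kappa>)\<^sup>2 + g y + ?h \<rho>" unfolding g_def by (rule bump_integral_le[OF B y(1,2)])
  also have "\<dots> < gamma_val T \<omega> k + \<epsilon>" using y(3) h unfolding gv by linarith
  finally have lt: "integral {0..T} ?a < gamma_val T \<omega> k + \<epsilon>" .
  have L: "L1_norm T ?a = integral {0..T} ?a" using bump_a_nonneg[OF B] by (simp add: L1_norm_def)
  \<comment> \<open>The potential exceeds \<omega>^2 off the null set of zeros of s, so the strict
    inequality holds almost everywhere.\<close>
  have "\<not> negligible {t \<in> {0..T}. \<omega>\<^sup>2 < ?a t}"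
  proof
    assume "negligible {t \<in> {0..T}. \<omega>\<^sup>2 < ?a t}"
    then have "negligible ({t. bump_s c \<rho> t = 0} \<union> {t \<in> {0..T}. \<omega>\<^sup>2 < ?a t})"
      using bump_null[OF B] by (intro negligible_Un)
    then have "negligible {0..T}"
      by (rule negligible_subset) (use bump_a_gt[OF B] in \<open>auto simp: ck\<close>)
    then show False using T negligible_interval(1)[of 0 T] by simp
  qed
  moreover have "negligible {t \<in> {0..T}. \<not> \<omega>\<^sup>2 \<le> ?a t}"
    by (rule negligible_subset[OF bump_null[OF B]]) (use bump_a_gt[OF B] in \<open>force simp: ck\<close>)
  ultimately have "prec_ae T (\<lambda>_. \<omega>\<^sup>2) ?a" unfolding prec_ae_const_iff[OF ai] by blast
  moreover have "?a \<in> L_per T" using ai bump_periodic[OF B] by (simp add: L_per_def)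
  moreover have "nontriv_antiper_sol T ?a (bump_u c \<kappa> \<rho>) (bump_v c \<kappa> \<rho>)"
    unfolding nontriv_antiper_sol_iff[OF T ai] using bump_antisol[OF B] by simp
  ultimately have mem: "?a \<in> Lambda_antiper T n" unfolding Lambda_antiper_iff[OF T n k w] by blast
  show ?thesis by (rule bexI[OF _ mem]) (use lt L in simp)
qed

lemma gamma_antiper_eq: "gamma_antiper T n = gamma_val T \<omega> k"
proof (rule antisym)
  have ne: "Lambda_antiper T n \<noteq> {}" using Lambda_norm_approx[of 1] by auto
  show "gamma_val T \<omega> k \<le> gamma_antiper T n"
    unfolding gamma_antiper_def
    by (rule cINF_greatest[OF ne]) (use Lambda_norm_gt[OF T n k w] in \<open>auto intro: less_imp_le\<close>)
  show "gamma_antiper T n \<le> gamma_val T \<omega> k"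
  proof (rule field_le_epsilon)
    fix \<epsilon> :: real assume "\<epsilon> > 0"
    then obtain a where a: "a \<in> Lambda_antiper T n" "L1_norm T a < gamma_val T \<omega> k + \<epsilon>"
      using Lambda_norm_approx by blast
    have "bdd_below (L1_norm T ` Lambda_antiper T n)"
      by (rule bdd_belowI2[where m = "gamma_val T \<omega> k"]) (use Lambda_norm_gt[OF T n k w] in \<open>auto intro: less_imp_le\<close>)
    then have "gamma_antiper T n \<le> L1_norm T a" unfolding gamma_antiper_def by (rule cINF_lower[OF _ a(1)])
    then show "gamma_antiper T n \<le> gamma_val T \<omega> k + \<epsilon>" using a(2) by simp
  qed
qed

end

theorem theorem2p2:
  fixes T :: real and n :: nat
  assumes "T > 0" and "n \<ge> 1"
  shows
    "(\<forall>a\<in>Lambda_antiper T n. \<forall>u u'. nontriv_antiper_sol T a u u' \<and> u 0 = 0 \<and> u T = 0 \<longrightarrow>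
        (\<exists>m t. interlaced_zeros T u u' m t \<and>
           (\<forall>i\<le>2 * m - 1. t (i + 1) - t i \<le> T / (2 * (2 * real n - 1))) \<and>
           (\<exists>i\<le>2 * m - 1. t (i + 1) - t i < T / (2 * (2 * real n - 1))) \<and>
           odd m \<and> m \<ge> 2 * n + 1)) \<and>
     (\<forall>m. odd m \<and> m \<ge> 2 * n + 1 \<longrightarrow>
        (\<exists>a\<in>Lambda_antiper T n. \<exists>u u' t.
           nontriv_antiper_sol T a u u' \<and> u 0 = 0 \<and> u T = 0 \<and> interlaced_zeros T u u' m t)) \<and>
     \<not> (\<exists>a\<in>Lambda_antiper T n. L1_norm T a = gamma_antiper T n) \<and>
     gamma_antiper T n = T * antiper_eig0 T (2 * n - 1) +
        2 * pi * (2 * real n - 1) * (2 * real n + 1) / T *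
        cot ((2 * real n - 1) * pi / (2 * (2 * real n + 1))) \<and>
     (\<forall>a\<in>L_per T.
        prec_ae T (\<lambda>_. antiper_eig0 T (2 * n - 1)) a \<and> L1_norm T a \<le> gamma_antiper T n \<longrightarrow>
        antiper_eig T a (2 * n) < 0 \<and> 0 < antiper_eig T a (2 * n + 1))"
proof -
  define k where "k = 2 * n - 1"
  define \<omega> where "\<omega> = real k * pi / T"
  note K = assms k_def \<omega>_def
  have k: "real k = 2 * real n - 1" "real k + 2 = 2 * real n + 1" using k_facts(3)[OF K] by simp_all
  have g: "\<omega> * (2 * (2 * real n + 1) * x) = 2 * pi * (2 * real n - 1) * (2 * real n + 1) / T * x" for x
    by (simp add: \<omega>_def k)
  have "gamma_val T \<omega> k = T * antiper_eig0 T (2 * n - 1) +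
        2 * pi * (2 * real n - 1) * (2 * real n + 1) / T * cot ((2 * real n - 1) * pi / (2 * (2 * real n + 1)))"
    unfolding gamma_val_def[OF K] antiper_eig0_eq[OF K] k(2) unfolding k(1) g ..
  moreover have "\<not> (\<exists>a\<in>Lambda_antiper T n. L1_norm T a = gamma_val T \<omega> k)"
    using Lambda_norm_gt[OF K] by force
  ultimately show ?thesis
    unfolding gamma_antiper_eq[OF K] antiper_eig0_eq[OF K]
    by (intro conjI ballI allI impI; (elim conjE)?)
      (assumption | rule zeros_structure[OF K] zeros_realised[OF K] eigenvalue_gap[OF K])+
qed

end
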